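(* Let $f:\mathbb{R}^n\to\mathbb{R}$ be a locally Lipschitz tame function and let $S:=\{x\in\mathbb{R}^n:0\in\partial f(x)\}$ be its set of critical points. Assume that $S$ is a $C^2$ manifold at some $x^*\in S$ of dimension less than $n$. Assume that there exist $\theta_1\geqslant 0$, a neighborhood $U$ of $x^*$, and a continuous function $C:\mathbb{R}^n\to\mathbb{R}$ such that for all $\alpha>0$ there exists $c_1>0$ such that for any sequence $x_0,x_1,\ldots\in U\setminus S$ generated by the subgradient method with constant step size $\alpha$, we have $C(x_{k+1})-C(x_k)\geqslant c_1\,d(x_k,S)^{\theta_1}$ for all $k\in\mathbb{N}$. Then $x^*$ is a strongly unstable point of $f$ if at least one of the following holds: 1) $\theta_1=0$; or 2) $\partial f$ is metrically $\theta_2$-subregular at $(x^*,0)$ with some $\theta_2>1$, and $f$ satisfies the Verdier condition at $x^*$ along $S$.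
   Context: $\mathbb{N}=\{0,1,2,\ldots\}$. $\|\cdot\|$ is the norm induced by an inner product $\langle\cdot,\cdot\rangle$ on $\mathbb{R}^n$; $B(a,r)$ is the closed ball; $d(x,S):=\inf\{\|x-y\|:y\in S\}$; $P_S$ denotes projection onto $S$. For a locally Lipschitz $f:\mathbb{R}^n\to\mathbb{R}$, the Clarke subdifferential is $\partial f(x):=\{s\in\mathbb{R}^n: f^\circ(x,d)\geqslant\langle s,d\rangle\ \forall d\in\mathbb{R}^n\}$, where $f^\circ(x,d):=\limsup_{y\to x,\,t\searrow 0}\frac{f(y+td)-f(y)}{t}$. The subgradient method with constant step size $\alpha>0$ generates sequences with $x_{k+1}\in x_k-\alpha\,\partial f(x_k)$ for all $k\in\mathbb{N}$. An o-minimal structure on the real field is a sequence $(S_k)_{k\in\mathbb{N}}$ such that for all $k$: (1) $S_k$ is a boolean algebra of subsets of $\mathbb{R}^k$ with $\mathbb{R}^k\in S_k$; (2) $S_k$ contains $\{x\in\mathbb{R}^k:x_i=x_j\}$ for $1\leqslant i<j\leqslant k$; (3) if $A\in S_k$, then $A\times\mathbb{R}$ and $\mathbb{R}\times A$ belong to $S_{k+1}$; (4) if $A\in S_{k+1}$ and $\pi:\mathbb{R}^{k+1}\to\mathbb{R}^k$ is the projection onto the first $k$ coordinates, then $\pi(A)\in S_k$; (5) $S_3$ contains the graphs of addition and multiplication; (6) $S_1$ consists exactly of the finite unions of open intervals and singletons. An arbitrary o-minimal structure on the real field is fixed. A set $C\subset\mathbb{R}^n$ is tame if $C\cap B(x,r)\in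 S_n$ for all $x\in\mathbb{R}^n$ and $r>0$; a function is tame if its graph is tame. Strong instability: $x^*$ is a strongly unstable point of $f$ if there exists $\epsilon>0$ such that for all but finitely many constant step sizes $\alpha>0$ and for (Lebesgue) almost every initial point $x_0\in B(x^*,\epsilon)$, for any sequence generated by the subgradient method with step size $\alpha$ from $x_0$, at least one of the iterates does not belong to $B(x^*,\epsilon)$. Manifold: $S\subset\mathbb{R}^n$ is a $C^p$ manifold ($p\geqslant 1$) of dimension $m\in\mathbb{N}$ at $x\in S$ if there exist a Euclidean space $E$ of dimension $n-m$, an open neighborhood $U$ of $x$ in $\mathbb{R}^n$, and a $p$ times continuously differentiable $\varphi:U\to E$ with surjective Jacobian such that $S\cap U=\varphi^{-1}(0)$. The tangent cone $T_S(x)$ is the kernel of the Jacobian $\varphi'(x)$. Metric subregularity: a set-valued mapping $F:\mathbb{R}^n\rightrightarrows\mathbb{R}^m$ is metrically $\theta$-subregular at $(\bar x,\bar y)$, where $\bar y\in F(\bar x)$ and $\theta\in\mathbb{R}$, if there exist $c>0$ and a neighborhood $U$ of $\bar x$ such that $d(x,F^{-1}(\bar y))\leqslant c\,d(\bar y,F(x))^\theta$ for all $x\in U$, where $F^{-1}(\bar y)=\{x:\bar y\in F(x)\}$. Smoothness on a manifold: for $S$ a $C^p$ manifold at $x$, $f$ is $C^p$ on $S$ at $x$ if there exist a neighborhood $U$ of $x$ and a $p$ times continuously differentiable $\bar f:U\to\mathbb{R}$ with $f(y)=\bar f(y)$ for all $y\in S\cap U$; the Riemannian gradient is $\nabla_S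 f(x):=P_{T_S(x)}(\nabla\bar f(x))$. Verdier condition: let $S$ be a $C^1$ manifold at $x^*$ and $f$ be $C^1$ on $S$ at $x^*$. $f$ satisfies the Verdier condition at $x^*$ along $S$ if there exist a neighborhood $U$ of $x^*$ and $c>0$ such that for all $y\in S\cap U$, $x\in U\setminus S$ and $v\in\partial f(x)$, $\|P_{T_S(y)}(v)-\nabla_S f(y)\|\leqslant c\|x-y\|$. *)

theory Defs
  imports "HOL-Analysis.Analysis"
begin

text \<open>
  The space \<open>\<real>\<^sup>n\<close> with an arbitrary inner product is a type \<open>'a :: euclidean_space\<close>, with
  \<open>n = DIM('a)\<close>, together with a list \<open>bs\<close> of vectors forming a linear basis, which need not be
  orthonormal: the coordinates of a point are its coefficients in \<open>bs\<close>, so the inner product of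
  \<open>'a\<close> becomes the inner product on \<open>\<real>\<^sup>n\<close> with Gram matrix \<open>bs ! i \<bullet> bs ! j\<close>, and every inner product
  arises in this way. Coordinates matter only for tameness, since the dimension of the sets in
  an o-minimal structure varies; there, a point of \<open>\<real>\<^sup>k\<close> is a list of length \<open>k\<close>.
\<close>

subsection \<open>O-minimal structures and tameness\<close>

definition o_minimal_structure :: "(nat \<Rightarrow> real list set set) \<Rightarrow> bool" where
  "o_minimal_structure Om \<longleftrightarrow>
     (\<forall>k. algebra {xs. length xs = k} (Om k)) \<and>
     (\<forall>k i j. i < j \<and> j < k \<longrightarrow> {xs. length xs = k \<and> xs ! i = xs ! j} \<in> Om k) \<and>
     (\<forall>k. \<forall>A\<in>Om k. {xs @ [t] |xs t. xs \<in> A} \<in> Om (Suc k) \<and>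
                    {t # xs |xs t. xs \<in> A} \<in> Om (Suc k)) \<and>
     (\<forall>k. \<forall>A\<in>Om (Suc k). take k ` A \<in> Om k) \<and>
     {[x, y, x + y] |x y. True} \<in> Om 3 \<and>
     {[x, y, x * y] |x y. True} \<in> Om 3 \<and>
     Om 1 = {(\<lambda>t. [t]) ` \<Union>F |F. finite F \<and>
               (\<forall>I\<in>F. (open I \<and> is_interval I) \<or> (\<exists>a. I = {a}))}"

definition coordinate_basis :: "'a::euclidean_space list \<Rightarrow> bool" where
  "coordinate_basis bs \<longleftrightarrow> distinct bs \<and> independent (set bs) \<and> span (set bs) = UNIV"

definition coordinates_of :: "'a::euclidean_space list \<Rightarrow> 'a set \<Rightarrow> real list set" where
  "coordinates_of bs A =
     {xs. length xs = length bs \<and> (\<Sum>i<length bs. xs ! i *\<^sub>R bs ! i) \<in> A}"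

definition tame_set ::
    "(nat \<Rightarrow> real list set set) \<Rightarrow> 'a::euclidean_space list \<Rightarrow> 'a set \<Rightarrow> bool" where
  "tame_set Om bs A \<longleftrightarrow>
     (\<forall>x r. r > 0 \<longrightarrow> coordinates_of bs (A \<inter> cball x r) \<in> Om (length bs))"

text \<open>The value of the function is the last coordinate of a point of its graph.\<close>

definition tame_fun ::
    "(nat \<Rightarrow> real list set set) \<Rightarrow> 'a::euclidean_space list \<Rightarrow> ('a \<Rightarrow> real) \<Rightarrow> bool" where
  "tame_fun Om bs f \<longleftrightarrow>
     tame_set Om (map (\<lambda>b. (b, 0)) bs @ [(0, 1)]) {(x, f x) |x. True}"

subsection \<open>Clarke subdifferential and the subgradient method\<close>

definition locally_lipschitz :: "('a::metric_space \<Rightarrow> 'b::metric_space) \<Rightarrow> bool" where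
  "locally_lipschitz f \<longleftrightarrow> (\<forall>x. \<exists>r>0. \<exists>L. L-lipschitz_on (ball x r) f)"

definition clarke_derivative ::
    "('a::euclidean_space \<Rightarrow> real) \<Rightarrow> 'a \<Rightarrow> 'a \<Rightarrow> ereal" where
  "clarke_derivative f x d =
     Limsup (nhds x \<times>\<^sub>F at_right 0) (\<lambda>(y, t). ereal ((f (y + t *\<^sub>R d) - f y) / t))"

definition clarke_subdiff :: "('a::euclidean_space \<Rightarrow> real) \<Rightarrow> 'a \<Rightarrow> 'a set" where
  "clarke_subdiff f x = {s. \<forall>d. clarke_derivative f x d \<ge> ereal (s \<bullet> d)}"

definition subgradient_sequence ::
    "('a::euclidean_space \<Rightarrow> real) \<Rightarrow> real \<Rightarrow> (nat \<Rightarrow> 'a) \<Rightarrow> bool" where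
  "subgradient_sequence f \<alpha> x \<longleftrightarrow>
     (\<forall>k. x (Suc k) \<in> {x k - \<alpha> *\<^sub>R s |s. s \<in> clarke_subdiff f (x k)})"

definition strongly_unstable :: "('a::euclidean_space \<Rightarrow> real) \<Rightarrow> 'a \<Rightarrow> bool" where
  "strongly_unstable f xs \<longleftrightarrow>
     (\<exists>\<epsilon>>0. finite {\<alpha>. \<alpha> > 0 \<and>
        \<not> (AE x0 in lebesgue. x0 \<in> cball xs \<epsilon> \<longrightarrow>
             (\<forall>x. subgradient_sequence f \<alpha> x \<and> x 0 = x0 \<longrightarrow> (\<exists>k. x k \<notin> cball xs \<epsilon>)))})"

subsection \<open>Manifolds and smoothness on manifolds\<close>

text \<open>
  \<open>C\<^sup>p\<close> regularity on an open set \<open>U\<close>. In finite dimension the derivative is of class \<open>C\<^sup>k\<close> iff its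
  value in every fixed direction \<open>v\<close> is, which avoids iterating spaces of linear maps.
\<close>

fun Ck_on ::
    "nat \<Rightarrow> 'a set \<Rightarrow> ('a::euclidean_space \<Rightarrow> 'b::real_normed_vector) \<Rightarrow> bool" where
  "Ck_on 0 U f \<longleftrightarrow> continuous_on U f"
| "Ck_on (Suc k) U f \<longleftrightarrow>
     (\<forall>x\<in>U. f differentiable (at x)) \<and>
     (\<forall>v. Ck_on k U (\<lambda>x. frechet_derivative f (at x) v))"

text \<open>
  \<open>\<phi> : U \<rightarrow> E\<close> is a local equation of the \<open>m\<close>-dimensional manifold \<open>S\<close> at \<open>x\<close>. The Euclidean space
  \<open>E\<close> of dimension \<open>n - m\<close> is taken, without loss of generality, to be a subspace of \<open>'a\<close>, because
  one cannot quantify over types.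
\<close>

definition local_equation ::
    "nat \<Rightarrow> 'a::euclidean_space set \<Rightarrow> nat \<Rightarrow> 'a \<Rightarrow> 'a set \<Rightarrow> 'a set \<Rightarrow> ('a \<Rightarrow> 'a) \<Rightarrow> bool" where
  "local_equation p S m x E U \<phi> \<longleftrightarrow>
     subspace E \<and> dim E + m = DIM('a) \<and> open U \<and> x \<in> U \<and>
     \<phi> ` U \<subseteq> E \<and> Ck_on p U \<phi> \<and> (\<forall>y\<in>U. range (frechet_derivative \<phi> (at y)) = E) \<and>
     S \<inter> U = {y \<in> U. \<phi> y = 0}"

definition Cp_manifold_at :: "nat \<Rightarrow> nat \<Rightarrow> 'a::euclidean_space set \<Rightarrow> 'a \<Rightarrow> bool" where
  "Cp_manifold_at p m S x \<longleftrightarrow> p \<ge> 1 \<and> x \<in> S \<and> (\<exists>E U \<phi>. local_equation p S m x E U \<phi>)"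

text \<open>
  The kernel of the Jacobian of a local equation depends only on \<open>S\<close> and \<open>x\<close>, and so does the
  projection of the gradient of a smooth extension onto it; hence the two definite descriptions
  below are legitimate wherever \<open>S\<close> is a \<open>C\<^sup>1\<close> manifold and \<open>f\<close> is \<open>C\<^sup>1\<close> on it.
\<close>

definition tangent_cone :: "'a::euclidean_space set \<Rightarrow> 'a \<Rightarrow> 'a set" where
  "tangent_cone S x =
     (THE T. \<exists>m E U \<phi>. local_equation 1 S m x E U \<phi> \<and>
               T = {v. frechet_derivative \<phi> (at x) v = 0})"

definition Cp_extension ::
    "nat \<Rightarrow> ('a::euclidean_space \<Rightarrow> real) \<Rightarrow> 'a set \<Rightarrow> 'a \<Rightarrow> 'a set \<Rightarrow> ('a \<Rightarrow> real) \<Rightarrow> bool" where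
  "Cp_extension p f S x U g \<longleftrightarrow>
     open U \<and> x \<in> U \<and> Ck_on p U g \<and> (\<forall>y\<in>S \<inter> U. f y = g y)"

definition Cp_on_manifold_at ::
    "nat \<Rightarrow> ('a::euclidean_space \<Rightarrow> real) \<Rightarrow> 'a set \<Rightarrow> 'a \<Rightarrow> bool" where
  "Cp_on_manifold_at p f S x \<longleftrightarrow>
     (\<exists>m. Cp_manifold_at p m S x) \<and> (\<exists>U g. Cp_extension p f S x U g)"

definition riemannian_gradient ::
    "('a::euclidean_space \<Rightarrow> real) \<Rightarrow> 'a set \<Rightarrow> 'a \<Rightarrow> 'a" where
  "riemannian_gradient f S x =
     (THE w. \<exists>U g D. Cp_extension 1 f S x U g \<and> (GDERIV g x :> D) \<and>
               w = closest_point (tangent_cone S x) D)"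

subsection \<open>Regularity conditions\<close>

text \<open>
  The convention \<open>d(x, {}) = \<infinity>\<close> makes the inequality void where \<open>F x = {}\<close>, whereas \<open>infdist\<close> is 0
  there. With \<open>powr\<close>, where \<open>0 powr \<theta> = 0\<close>, the definition is the intended one for \<open>\<theta> > 0\<close>.
\<close>

definition metrically_subregular ::
    "real \<Rightarrow> ('a::metric_space \<Rightarrow> 'b::metric_space set) \<Rightarrow> 'a \<Rightarrow> 'b \<Rightarrow> bool" where
  "metrically_subregular \<theta> F xbar ybar \<longleftrightarrow>
     ybar \<in> F xbar \<and>
     (\<exists>c>0. \<exists>U. xbar \<in> interior U \<and>
        (\<forall>x\<in>U. F x \<noteq> {} \<longrightarrow>
           infdist x {z. ybar \<in> F z} \<le> c * infdist ybar (F x) powr \<theta>))"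

definition verdier_condition ::
    "('a::euclidean_space \<Rightarrow> real) \<Rightarrow> 'a set \<Rightarrow> 'a \<Rightarrow> bool" where
  "verdier_condition f S xs \<longleftrightarrow>
     Cp_on_manifold_at 1 f S xs \<and>
     (\<exists>U. xs \<in> interior U \<and> (\<exists>c>0. \<forall>y\<in>S \<inter> U. \<forall>x\<in>U - S. \<forall>v\<in>clarke_subdiff f x.
        norm (closest_point (tangent_cone S y) v - riemannian_gradient f S y)
          \<le> c * norm (x - y)))"

end

theory Submission
  imports Defs
begin

text \<open>
  Near \<open>xs\<close> the function is \<open>C\<^sup>1\<close> outside a definable set \<open>Z\<close> with empty interior, which is Lebesgue
  null. For all but finitely many \<open>\<alpha>\<close> the gradient step maps no ball of the good set to a set with
  empty interior: the bad \<open>\<alpha>\<close> form a definable set, which would be uncountable if it were infinite; then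
  uncountably many \<open>\<alpha>\<close> would be bad for one and the same ball, although at a point of differentiability
  of the gradient the step is a local homeomorphism unless \<open>1/\<alpha>\<close> is an eigenvalue of the Hessian. Hence
  from almost every initial point the iterates never hit \<open>S\<close>, and a sequence trapped in a small ball makes
  \<open>C\<close> grow along it, so that \<open>d(x\<^sub>k, S) \<rightarrow> 0\<close>. This is impossible for \<open>\<theta>\<^sub>1 = 0\<close>. In the second case the step is
  nearly normal to \<open>S\<close> by the Verdier condition and much longer than the distance to \<open>S\<close> by metric
  subregularity, so the distance to \<open>S\<close> eventually stops decreasing.

  Genericity statements about definable sets are obtained from the Baire category theorem together with the
  one-dimensional axiom, without cell decomposition.
\<close>

subsection \<open>Closure properties of an o-minimal structure\<close>

text \<open>Strict differentiability carries the proof: it is a pointwise first-order condition, it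
  makes the Clarke subdifferential a singleton, and it makes the gradient continuous on open sets.
  So off a definable exceptional set the set-valued step is a single definable map. Smallness is
  pulled back along the iteration as emptiness of the interior, because nondegeneracy of
  \<open>\<alpha>\<close> controls interiors of images and not measures; it becomes nullness only at
  the end. Since tameness speaks of bounded pieces of the graph, \<open>f\<close> is replaced near
  \<open>xs\<close> by a globally definable \<open>F\<close> that agrees with it on a ball.

  In the second case the Verdier inequality bounds the tangential part of a subgradient only once
  the Riemannian gradient is known to vanish on \<open>S\<close>. This follows from 0 being a Clarke
  subgradient there: a nonzero value would push all nearby gradients into one open half-space. The
  remaining errors, from the tangential part and from the curvature of \<open>S\<close>, are
  proportional to the old distance or a small fraction of the step, so a step long enough compared
  with the distance cannot bring the iterate closer.\<close>

locale o_minimal =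
  fixes Om :: "nat \<Rightarrow> real list set set"
  assumes om: "o_minimal_structure Om"
begin

text \<open>Predicates instead of sets, so that the axioms turn into formation rules for connectives
  and quantifiers.\<close>

definition om_pred :: "nat \<Rightarrow> (real list \<Rightarrow> bool) \<Rightarrow> bool" where
  "om_pred m P \<longleftrightarrow> {xs. length xs = m \<and> P xs} \<in> Om m"

lemma om_algebra: "algebra {xs. length xs = k} (Om k)"
  using om by (simp add: o_minimal_structure_def)

lemma om_diag: "i < j \<Longrightarrow> j < k \<Longrightarrow> {xs. length xs = k \<and> xs ! i = xs ! j} \<in> Om k"
  using om[unfolded o_minimal_structure_def, THEN conjunct2, THEN conjunct1] by simp

lemma om_Cons: "A \<in> Om k \<Longrightarrow> {t # xs |xs t. xs \<in> A} \<in> Om (Suc k)"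
  using om[unfolded o_minimal_structure_def, THEN conjunct2, THEN conjunct2, THEN conjunct1] by simp

lemma om_take: "A \<in> Om (Suc k) \<Longrightarrow> take k ` A \<in> Om k"
  using om[unfolded o_minimal_structure_def, THEN conjunct2, THEN conjunct2, THEN conjunct2, THEN conjunct1]
  by simp

lemma om_length: "A \<in> Om k \<Longrightarrow> xs \<in> A \<Longrightarrow> length xs = k"
  using om_algebra[of k] unfolding algebra_iff_Un by blast

lemma om_pred_mem: "A \<in> Om k \<Longrightarrow> om_pred k (\<lambda>xs. xs \<in> A)"
proof -
  assume "A \<in> Om k"
  moreover from this have "{xs. length xs = k \<and> xs \<in> A} = A" using om_length by blast
  ultimately show ?thesis by (simp add: om_pred_def)
qed

lemma om_pred_True: "om_pred m (\<lambda>_. True)"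
  using algebra.top[OF om_algebra[of m]] by (simp add: om_pred_def)

lemma om_pred_not: "om_pred m P \<Longrightarrow> om_pred m (\<lambda>xs. \<not> P xs)"
proof -
  assume "om_pred m P"
  then have "{xs. length xs = m} - {xs. length xs = m \<and> P xs} \<in> Om m"
    using om_algebra[of m] unfolding om_pred_def by (meson algebra_iff_Un)
  moreover have "{xs. length xs = m} - {xs. length xs = m \<and> P xs} = {xs. length xs = m \<and> \<not> P xs}"
    by auto
  ultimately show ?thesis by (simp add: om_pred_def)
qed

lemma om_pred_conj:
  assumes "om_pred m P" "om_pred m Q" shows "om_pred m (\<lambda>xs. P xs \<and> Q xs)"
proof -
  have "{xs. length xs = m \<and> P xs} \<inter> {xs. length xs = m \<and> Q xs} \<in> Om m"
    using assms om_algebra[of m] unfolding om_pred_def by (meson algebra_iff_Int)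
  moreover have "{xs. length xs = m \<and> P xs} \<inter> {xs. length xs = m \<and> Q xs}
    = {xs. length xs = m \<and> P xs \<and> Q xs}"
    by auto
  ultimately show ?thesis by (simp add: om_pred_def)
qed

lemma om_pred_cong:
  assumes "om_pred m P" "\<And>xs. length xs = m \<Longrightarrow> P xs \<longleftrightarrow> Q xs" shows "om_pred m Q"
proof -
  have "{xs. length xs = m \<and> P xs} = {xs. length xs = m \<and> Q xs}" using assms(2) by auto
  then show ?thesis using assms(1) by (simp add: om_pred_def)
qed

lemma om_pred_Ball:
  assumes "finite I" "\<And>i. i \<in> I \<Longrightarrow> om_pred m (P i)" shows "om_pred m (\<lambda>xs. \<forall>i\<in>I. P i xs)"
  using assms
proof (induction I rule: finite_induct)
  case empty then show ?case by (simp add: om_pred_True)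
next
  case (insert a I)
  have "om_pred m (\<lambda>xs. P a xs \<and> (\<forall>i\<in>I. P i xs))"
    by (rule om_pred_conj) (use insert in auto)
  then show ?case by (rule om_pred_cong) auto
qed

lemma om_pred_ex1: "om_pred (Suc m) P \<Longrightarrow> om_pred m (\<lambda>xs. \<exists>t. P (xs @ [t]))"
proof -
  assume "om_pred (Suc m) P"
  then have "take m ` {xs. length xs = Suc m \<and> P xs} \<in> Om m"
    unfolding om_pred_def by (rule om_take)
  moreover have "take m ` {xs. length xs = Suc m \<and> P xs} = {xs. length xs = m \<and> (\<exists>t. P (xs @ [t]))}"
  proof (intro set_eqI iffI)
    fix xs :: "real list" assume "xs \<in> take m ` {xs. length xs = Suc m \<and> P xs}"
    then obtain ys where "length ys = Suc m" "P ys" "xs = take m ys" by auto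
    then show "xs \<in> {xs. length xs = m \<and> (\<exists>t. P (xs @ [t]))}"
      by (auto intro!: exI[of _ "ys ! m"] simp: take_Suc_conv_app_nth[symmetric])
  next
    fix xs :: "real list" assume "xs \<in> {xs. length xs = m \<and> (\<exists>t. P (xs @ [t]))}"
    then obtain t where "length xs = m" "P (xs @ [t])" by auto
    then show "xs \<in> take m ` {xs. length xs = Suc m \<and> P xs}"
      by (auto intro!: image_eqI[of _ _ "xs @ [t]"])
  qed
  ultimately show ?thesis by (simp add: om_pred_def)
qed

lemma om_pred_ex:
  "om_pred (m + n) P \<Longrightarrow> om_pred m (\<lambda>xs. \<exists>ys. length ys = n \<and> P (xs @ ys))"
proof (induction n arbitrary: P)
  case 0 then show ?case by simp
next
  case (Suc n)
  have "om_pred (m + n) (\<lambda>xs. \<exists>t. P (xs @ [t]))" using om_pred_ex1 Suc.prems by simp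
  from Suc.IH[OF this] show ?case
    by (rule om_pred_cong) (auto simp: length_Suc_conv_rev)
qed

lemma om_pred_prepend: "om_pred k P \<Longrightarrow> om_pred (n + k) (\<lambda>xs. P (drop n xs))"
proof (induction n)
  case (Suc n)
  have "{t # xs |xs t. xs \<in> {xs. length xs = n + k \<and> P (drop n xs)}} \<in> Om (Suc (n + k))"
    using Suc unfolding om_pred_def by (intro om_Cons) simp
  moreover have "{t # xs |xs t. xs \<in> {xs. length xs = n + k \<and> P (drop n xs)}}
    = {xs. length xs = Suc (n + k) \<and> P (drop (Suc n) xs)}" (is "?L = ?R")
  proof (intro set_eqI iffI)
    show "xs \<in> ?R" if "xs \<in> ?L" for xs using that by auto
    show "xs \<in> ?L" if "xs \<in> ?R" for xs using that by (cases xs) auto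
  qed
  ultimately show ?case by (simp add: om_pred_def)
qed simp

lemma om_pred_eq:
  assumes "i < m" "j < m" shows "om_pred m (\<lambda>xs. xs ! i = xs ! j)"
proof -
  have *: "om_pred m (\<lambda>xs. xs ! i = xs ! j)" if "i < j" "j < m" for i j
    using that unfolding om_pred_def by (rule om_diag)
  consider "i < j" | "i = j" | "j < i" by linarith
  then show ?thesis
  proof cases
    case 3 then show ?thesis using *[of j i] assms by (auto elim: om_pred_cong)
  qed (use * assms in \<open>auto simp: om_pred_True\<close>)
qed

text \<open>Substitution of variables: \<open>k\<close> fresh coordinates are tied to the chosen
  ones by diagonals and then projected away. Hence \<open>\<sigma>\<close> may repeat, permute or
  drop coordinates.\<close>

lemma om_pred_reindex:
  assumes P: "om_pred k P" and \<sigma>: "\<And>i. i < k \<Longrightarrow> \<sigma> i < m"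
  shows "om_pred m (\<lambda>xs. P (map (\<lambda>i. xs ! \<sigma> i) [0..<k]))"
proof -
  have "om_pred (m + k) (\<lambda>xs. P (drop m xs) \<and> (\<forall>i\<in>{..<k}. xs ! (\<sigma> i) = xs ! (m + i)))"
    using \<sigma> by (intro om_pred_conj om_pred_prepend P om_pred_Ball om_pred_eq)
      (auto simp: trans_less_add1)
  from om_pred_ex[OF this] show ?thesis
  proof (rule om_pred_cong)
    fix xs :: "real list" assume len: "length xs = m"
    have *: "(\<forall>i\<in>{..<k}. (xs @ ys) ! \<sigma> i = (xs @ ys) ! (m + i)) \<longleftrightarrow> ys = map (\<lambda>i. xs ! \<sigma> i) [0..<k]"
      if "length ys = k" for ys
      using that len \<sigma> by (auto simp: nth_append list_eq_iff_nth_eq)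
    show "(\<exists>ys. length ys = k \<and> P (drop m (xs @ ys)) \<and>
             (\<forall>i\<in>{..<k}. (xs @ ys) ! \<sigma> i = (xs @ ys) ! (m + i))) =
          P (map (\<lambda>i. xs ! \<sigma> i) [0..<k])" (is "?L = ?R")
    proof
      show ?R if ?L using that * len by auto
      show ?L if ?R
        by (rule exI[of _ "map (\<lambda>i. xs ! \<sigma> i) [0..<k]"]) (use that * len in simp)
    qed
  qed
qed

lemma om_1:
  "A \<in> Om 1 \<longleftrightarrow> (\<exists>F. A = (\<lambda>t. [t]) ` \<Union>F \<and> finite F \<and>
     (\<forall>I\<in>F. (open I \<and> is_interval I) \<or> (\<exists>a. I = {a})))"
  using om[unfolded o_minimal_structure_def, THEN conjunct2, THEN conjunct2, THEN conjunct2,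
    THEN conjunct2, THEN conjunct2, THEN conjunct2]
  by (simp add: image_iff)

lemma om_pred_single:
  assumes "(open I \<and> is_interval I) \<or> (\<exists>a. I = {a})" "i < m"
  shows "om_pred m (\<lambda>xs. xs ! i \<in> I)"
proof -
  have "(\<lambda>t. [t]) ` I \<in> Om 1" unfolding om_1 by (rule exI[of _ "{I}"]) (use assms in simp)
  from om_pred_reindex[OF om_pred_mem[OF this], of "\<lambda>_. i" m] assms
  show ?thesis by (auto elim: om_pred_cong)
qed

lemma om_pred_const: "i < m \<Longrightarrow> om_pred m (\<lambda>xs. xs ! i = c)"
  using om_pred_single[of "{c}" i m] by simp

lemma om_pred_add:
  assumes "i < m" "j < m" "l < m" shows "om_pred m (\<lambda>xs. xs ! l = xs ! i + xs ! j)"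
proof -
  have "{[x, y, x + y] |x y. True} \<in> Om 3" using om by (simp add: o_minimal_structure_def)
  then have "om_pred m (\<lambda>xs. map (\<lambda>n. xs ! ([i, j, l] ! n)) [0..<3] \<in> {[x, y, x + y] |x y. True})"
    by (intro om_pred_reindex om_pred_mem) (use assms in \<open>auto simp: numeral_3_eq_3 less_Suc_eq\<close>)
  then show ?thesis
    by (rule om_pred_cong) (auto simp: numeral_3_eq_3)
qed

lemma om_pred_mult:
  assumes "i < m" "j < m" "l < m" shows "om_pred m (\<lambda>xs. xs ! l = xs ! i * xs ! j)"
proof -
  have "{[x, y, x * y] |x y. True} \<in> Om 3" using om by (simp add: o_minimal_structure_def)
  then have "om_pred m (\<lambda>xs. map (\<lambda>n. xs ! ([i, j, l] ! n)) [0..<3] \<in> {[x, y, x * y] |x y. True})"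
    by (intro om_pred_reindex om_pred_mem) (use assms in \<open>auto simp: numeral_3_eq_3 less_Suc_eq\<close>)
  then show ?thesis
    by (rule om_pred_cong) (auto simp: numeral_3_eq_3)
qed

text \<open>Coordinate \<open>m\<close> carries the value of the form. The axioms give one addition
  and one multiplication at a time, hence the induction on the number of summands.\<close>

lemma om_pred_linear_form:
  assumes "k \<le> m" shows "om_pred (Suc m) (\<lambda>xs. xs ! m = (\<Sum>i<k. xs ! i * c i))"
  using assms
proof (induction k)
  case 0 then show ?case using om_pred_const[of m "Suc m" 0] by simp
next
  case (Suc k)
  \<comment> \<open>Redirects the value coordinate to \<open>m + 1\<close>, where the induction
    hypothesis puts the partial sum.\<close>
  define \<sigma> where "\<sigma> i = (if i = m then Suc m else i)" for i
  let ?P = "\<lambda>xs. map (\<lambda>i. xs ! \<sigma> i) [0..<Suc m] ! m = (\<Sum>i<k. map (\<lambda>i. xs ! \<sigma> i) [0..<Suc m] ! i * c i)"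
  \<comment> \<open>Fresh coordinates: \<open>m + 1\<close> for the partial sum,
    \<open>m + 2\<close> for the constant \<open>c k\<close>, \<open>m + 3\<close> for the
    product.\<close>
  have "om_pred (Suc m + 3) (\<lambda>xs. ?P xs \<and> xs ! (m + 2) = c k \<and>
    xs ! (m + 3) = xs ! k * xs ! (m + 2) \<and> xs ! m = xs ! (m + 1) + xs ! (m + 3))"
    by (intro om_pred_conj om_pred_reindex[where P = "\<lambda>xs. xs ! m = (\<Sum>i<k. xs ! i * c i)"]
      om_pred_const om_pred_add om_pred_mult) (use Suc in \<open>auto simp: \<sigma>_def\<close>)
  from om_pred_ex[OF this] show ?case
  proof (rule om_pred_cong)
    fix xs :: "real list" assume len: "length xs = Suc m"
    have *: "?P (xs @ ys) \<longleftrightarrow> ys ! 0 = (\<Sum>i<k. xs ! i * c i)" for ys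
    proof -
      have "map (\<lambda>i. (xs @ ys) ! \<sigma> i) [0..<Suc m] ! i = xs ! i" if "i < k" for i
        using that Suc.prems len by (auto simp: \<sigma>_def nth_append simp del: upt_Suc)
      moreover have "map (\<lambda>i. (xs @ ys) ! \<sigma> i) [0..<Suc m] ! m = ys ! 0"
        using len by (auto simp: \<sigma>_def nth_append simp del: upt_Suc)
      ultimately show ?thesis by simp
    qed
    have nth: "(xs @ ys) ! (m + 1) = ys ! 0" "(xs @ ys) ! (m + 2) = ys ! 1"
       "(xs @ ys) ! (m + 3) = ys ! 2" "(xs @ ys) ! m = xs ! m" "(xs @ ys) ! k = xs ! k" for ys
      using len Suc.prems by (auto simp: nth_append numeral_2_eq_2 numeral_3_eq_3)
    show "(\<exists>ys. length ys = 3 \<and> ?P (xs @ ys) \<and> (xs @ ys) ! (m + 2) = c k \<and>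
       (xs @ ys) ! (m + 3) = (xs @ ys) ! k * (xs @ ys) ! (m + 2) \<and>
       (xs @ ys) ! m = (xs @ ys) ! (m + 1) + (xs @ ys) ! (m + 3)) =
      (xs ! m = (\<Sum>i<Suc k. xs ! i * c i))" (is "?L = ?R")
    proof
      show ?R if ?L using that unfolding * nth by auto
      show ?L if ?R unfolding * nth
        by (rule exI[of _ "[\<Sum>i<k. xs ! i * c i, c k, xs ! k * c k]"]) (use that in simp)
    qed
  qed
qed

subsection \<open>Definable sets in Euclidean spaces\<close>

text \<open>
  Quantifying over all lists of vectors, instead of only over bases, makes preimages under linear
  maps definable for trivial reasons.
\<close>

definition definable :: "'e::euclidean_space set \<Rightarrow> bool" where
  "definable A \<longleftrightarrow> (\<forall>bs. coordinates_of bs A \<in> Om (length bs))"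

lemma definable_alt:
  "definable A \<longleftrightarrow> (\<forall>bs. om_pred (length bs) (\<lambda>xs. (\<Sum>i<length bs. xs ! i *\<^sub>R bs ! i) \<in> A))"
  by (simp add: definable_def om_pred_def coordinates_of_def)

lemma basis_coordinates:
  fixes bs :: "'e::euclidean_space list"
  assumes "coordinate_basis bs"
  obtains R where "\<And>v. (\<Sum>j<length bs. R v j *\<^sub>R bs ! j) = v" "\<And>j. linear (\<lambda>v. R v j)"
    "\<And>ys. length ys = length bs \<Longrightarrow> \<forall>j<length bs. R (\<Sum>j<length bs. ys ! j *\<^sub>R bs ! j) j = ys ! j"
proof -
  have ind: "independent (set bs)" and sp: "span (set bs) = UNIV" and dis: "distinct bs"
    using assms by (auto simp: coordinate_basis_def)
  define R where "R v j = representation (set bs) v (bs ! j)" for v j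
  have eq: "(\<Sum>j<length bs. g (bs ! j)) = sum g (set bs)" for g :: "'e \<Rightarrow> 'e"
    by (rule sum.reindex_bij_betw[OF bij_betw_nth[OF dis refl refl]])
  have 1: "(\<Sum>j<length bs. R v j *\<^sub>R bs ! j) = v" for v
    unfolding R_def eq[of "\<lambda>b. representation (set bs) v b *\<^sub>R b"]
    by (rule real_vector.sum_representation_eq[OF ind]) (auto simp: sp)
  have 2: "linear (\<lambda>v. R v j)" for j
    unfolding R_def by (rule linearI)
      (simp_all add: real_vector.representation_add[OF ind] real_vector.representation_scale[OF ind] sp)
  have 3: "\<forall>j<length bs. R (\<Sum>j<length bs. ys ! j *\<^sub>R bs ! j) j = ys ! j" if "length ys = length bs" for ys
  proof (intro allI impI)
    fix j assume j: "j < length bs"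
    have "R (\<Sum>i<length bs. ys ! i *\<^sub>R bs ! i) j = (\<Sum>i<length bs. ys ! i * R (bs ! i) j)"
      by (simp add: linear_sum[OF 2] linear_cmul[OF 2])
    also have "\<dots> = (\<Sum>i<length bs. ys ! i * (if i = j then 1 else 0))"
      by (intro sum.cong refl)
        (use j dis in \<open>auto simp: R_def real_vector.representation_basis[OF ind] nth_eq_iff_index_eq\<close>)
    also have "\<dots> = ys ! j" using j by (subst sum.cong[OF refl, of _ _ "\<lambda>i. if i = j then ys ! i else 0"]) auto
    finally show "R (\<Sum>j<length bs. ys ! j *\<^sub>R bs ! j) j = ys ! j" .
  qed
  show thesis by (rule that[OF 1 2 3])
qed

text \<open>One basis suffices: the \<open>bs\<close>-coordinates of a combination of
  \<open>cs\<close> are linear forms in its coefficients. Fresh coordinates constrained by these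
  forms and projected away transport definability to any list \<open>cs\<close>, even a dependent
  one.\<close>

lemma definableI:
  fixes bs :: "'e::euclidean_space list"
  assumes b: "coordinate_basis bs" and A: "coordinates_of bs A \<in> Om (length bs)"
  shows "definable A"
  unfolding definable_alt
proof
  fix cs :: "'e list"
  obtain R where R: "\<And>v. (\<Sum>j<length bs. R v j *\<^sub>R bs ! j) = v" "\<And>j. linear (\<lambda>v. R v j)"
    "\<And>ys. length ys = length bs \<Longrightarrow> \<forall>j<length bs. R (\<Sum>j<length bs. ys ! j *\<^sub>R bs ! j) j = ys ! j"
    by (rule basis_coordinates[OF b]) blast
  let ?m = "length cs" and ?n = "length bs"
  define \<sigma> where "\<sigma> j i = (if i = ?m then ?m + j else i)" for i j
  let ?M = "\<lambda>j xs. map (\<lambda>i. xs ! \<sigma> j i) [0..<Suc ?m]"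
  have "om_pred (?m + ?n) (\<lambda>zs. drop ?m zs \<in> coordinates_of bs A \<and>
     (\<forall>j\<in>{..<?n}. ?M j zs ! ?m = (\<Sum>i<?m. ?M j zs ! i * R (cs ! i) j)))"
    by (intro om_pred_conj om_pred_prepend om_pred_mem A om_pred_Ball
        om_pred_reindex[where P = "\<lambda>xs. xs ! ?m = (\<Sum>i<?m. xs ! i * R (cs ! i) _)"] om_pred_linear_form)
      (auto simp: \<sigma>_def)
  from om_pred_ex[OF this]
  show "om_pred ?m (\<lambda>xs. (\<Sum>i<?m. xs ! i *\<^sub>R cs ! i) \<in> A)"
  proof (rule om_pred_cong)
    fix xs :: "real list" assume len: "length xs = ?m"
    let ?v = "\<Sum>i<?m. xs ! i *\<^sub>R cs ! i"
    have M: "(xs @ ys) ! \<sigma> j i = (if i = ?m then ys ! j else xs ! i)" if "i \<le> ?m" for j i ys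
      using that len by (auto simp: \<sigma>_def nth_append)
    have *: "(\<forall>j\<in>{..<?n}. ?M j (xs @ ys) ! ?m = (\<Sum>i<?m. ?M j (xs @ ys) ! i * R (cs ! i) j)) \<longleftrightarrow>
      (\<Sum>j<?n. ys ! j *\<^sub>R bs ! j) = ?v" if ys: "length ys = ?n" for ys
    proof -
      have "R ?v j = (\<Sum>i<?m. xs ! i * R (cs ! i) j)" for j
        by (simp add: linear_sum[OF R(2)] linear_cmul[OF R(2)])
      then have "(\<forall>j\<in>{..<?n}. ?M j (xs @ ys) ! ?m = (\<Sum>i<?m. ?M j (xs @ ys) ! i * R (cs ! i) j)) \<longleftrightarrow>
        (\<forall>j<?n. ys ! j = R ?v j)"
        by (simp add: M Ball_def del: upt_Suc)
      also have "\<dots> \<longleftrightarrow> (\<Sum>j<?n. ys ! j *\<^sub>R bs ! j) = ?v"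
      proof
        assume "\<forall>j<?n. ys ! j = R ?v j"
        then have "(\<Sum>j<?n. ys ! j *\<^sub>R bs ! j) = (\<Sum>j<?n. R ?v j *\<^sub>R bs ! j)" by simp
        then show "(\<Sum>j<?n. ys ! j *\<^sub>R bs ! j) = ?v" by (simp add: R(1))
      qed (use R(3)[OF ys] in auto)
      finally show ?thesis .
    qed
    show "(\<exists>ys. length ys = ?n \<and> drop ?m (xs @ ys) \<in> coordinates_of bs A \<and>
       (\<forall>j\<in>{..<?n}. ?M j (xs @ ys) ! ?m = (\<Sum>i<?m. ?M j (xs @ ys) ! i * R (cs ! i) j))) \<longleftrightarrow> ?v \<in> A"
      (is "?L \<longleftrightarrow> _")
    proof
      assume ?L
      then show "?v \<in> A" using * len by (auto simp: coordinates_of_def)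
    next
      assume v: "?v \<in> A"
      let ?ys = "map (R ?v) [0..<?n]"
      have "(\<Sum>j<?n. ?ys ! j *\<^sub>R bs ! j) = (\<Sum>j<?n. R ?v j *\<^sub>R bs ! j)" by (intro sum.cong) auto
      then have s: "(\<Sum>j<?n. ?ys ! j *\<^sub>R bs ! j) = ?v" by (simp add: R(1))
      show ?L
        by (rule exI[of _ ?ys]) (use * s v len in \<open>auto simp: coordinates_of_def\<close>)
    qed
  qed
qed

lemma definable_Compl: "definable A \<Longrightarrow> definable (- A)"
  unfolding definable_alt Compl_iff by (intro allI om_pred_not) blast

lemma definable_Int: "definable A \<Longrightarrow> definable B \<Longrightarrow> definable (A \<inter> B)"
  unfolding definable_alt Int_iff by (intro allI om_pred_conj) blast+

lemma definable_vimage_linear: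
  assumes "definable A" "linear L" shows "definable (L -` A)"
  unfolding definable_alt
proof
  fix bs
  have "L (\<Sum>i<length bs. xs ! i *\<^sub>R bs ! i) = (\<Sum>i<length bs. xs ! i *\<^sub>R map L bs ! i)" for xs
    by (simp add: linear_sum[OF assms(2)] linear_cmul[OF assms(2)])
  then show "om_pred (length bs) (\<lambda>xs. (\<Sum>i<length bs. xs ! i *\<^sub>R bs ! i) \<in> L -` A)"
    using assms(1)[unfolded definable_alt, rule_format, of "map L bs"] by simp
qed

lemma coordinate_basis_exists: "\<exists>bs :: 'e::euclidean_space list. coordinate_basis bs"
proof -
  obtain bs :: "'e list" where "set bs = Basis" "distinct bs"
    using finite_distinct_list[OF finite_Basis] by blast
  then have "coordinate_basis bs" by (simp add: coordinate_basis_def independent_Basis)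
  then show ?thesis ..
qed

text \<open>Appending a basis of the second factor to \<open>bs\<close> turns the projection of
  pairs into a projection of trailing coordinates.\<close>

lemma definable_fst_image:
  fixes A :: "('p::euclidean_space \<times> 'q::euclidean_space) set"
  assumes "definable A" shows "definable (fst ` A)"
  unfolding definable_alt
proof
  fix bs :: "'p list"
  obtain cs :: "'q list" where cs: "coordinate_basis cs" using coordinate_basis_exists by blast
  obtain R where R: "\<And>v. (\<Sum>j<length cs. R v j *\<^sub>R cs ! j) = v"
    by (rule basis_coordinates[OF cs]) blast
  let ?m = "length bs" and ?n = "length cs"
  let ?bs = "map (\<lambda>b. (b, 0)) bs @ map (\<lambda>c. (0, c)) cs"
  have "om_pred (?m + ?n) (\<lambda>zs. (\<Sum>i<?m + ?n. zs ! i *\<^sub>R ?bs ! i) \<in> A)"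
    using assms[unfolded definable_alt, rule_format, of ?bs] by simp
  from om_pred_ex[OF this]
  show "om_pred (length bs) (\<lambda>xs. (\<Sum>i<length bs. xs ! i *\<^sub>R bs ! i) \<in> fst ` A)"
  proof (rule om_pred_cong)
    fix xs :: "real list" assume len: "length xs = ?m"
    have s: "(\<Sum>i<?m + ?n. (xs @ ys) ! i *\<^sub>R ?bs ! i)
      = ((\<Sum>i<?m. xs ! i *\<^sub>R bs ! i), (\<Sum>i<?n. ys ! i *\<^sub>R cs ! i))" for ys
    proof -
      have "(\<Sum>i<?m + ?n. (xs @ ys) ! i *\<^sub>R ?bs ! i) =
        (\<Sum>i<?m. (xs @ ys) ! i *\<^sub>R ?bs ! i) + (\<Sum>i<?n. (xs @ ys) ! (?m + i) *\<^sub>R ?bs ! (?m + i))"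
        unfolding lessThan_atLeast0
        by (subst sum.atLeastLessThan_concat[symmetric, of 0 ?m "?m + ?n"])
          (simp_all add: sum.atLeastLessThan_shift_0[of _ ?m "?m + ?n"])
      also have "(\<Sum>i<?m. (xs @ ys) ! i *\<^sub>R ?bs ! i) = (\<Sum>i<?m. (xs ! i *\<^sub>R bs ! i, 0))"
        by (intro sum.cong) (use len in \<open>auto simp: nth_append\<close>)
      also have "(\<Sum>i<?n. (xs @ ys) ! (?m + i) *\<^sub>R ?bs ! (?m + i)) = (\<Sum>i<?n. (0, ys ! i *\<^sub>R cs ! i))"
        by (intro sum.cong) (use len in \<open>auto simp: nth_append\<close>)
      finally show ?thesis by (simp add: prod_eq_iff fst_sum snd_sum)
    qed
    show "(\<exists>ys. length ys = ?n \<and> (\<Sum>i<?m + ?n. (xs @ ys) ! i *\<^sub>R ?bs ! i) \<in> A) =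
      ((\<Sum>i<?m. xs ! i *\<^sub>R bs ! i) \<in> fst ` A)" (is "?L = ?R")
    proof
      show ?R if ?L using that unfolding s by force
    next
      assume ?R
      then obtain v where v: "((\<Sum>i<?m. xs ! i *\<^sub>R bs ! i), v) \<in> A" by force
      have "(\<Sum>j<?n. map (R v) [0..<?n] ! j *\<^sub>R cs ! j) = (\<Sum>j<?n. R v j *\<^sub>R cs ! j)"
        by (intro sum.cong) auto
      then show ?L unfolding s by (intro exI[of _ "map (R v) [0..<?n]"]) (use v R in simp)
    qed
  qed
qed

lemma definable_sing: "definable {c}"
proof -
  obtain cs :: "'a list" where cs: "coordinate_basis cs" using coordinate_basis_exists by blast
  obtain R where R: "\<And>v. (\<Sum>j<length cs. R v j *\<^sub>R cs ! j) = v"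
    "\<And>ys. length ys = length cs \<Longrightarrow> \<forall>j<length cs. R (\<Sum>j<length cs. ys ! j *\<^sub>R cs ! j) j = ys ! j"
    by (rule basis_coordinates[OF cs]) blast
  have "om_pred (length cs) (\<lambda>xs. \<forall>j\<in>{..<length cs}. xs ! j = R c j)"
    by (intro om_pred_Ball om_pred_const) auto
  then have "om_pred (length cs) (\<lambda>xs. (\<Sum>i<length cs. xs ! i *\<^sub>R cs ! i) \<in> {c})"
  proof (rule om_pred_cong)
    fix xs :: "real list" assume len: "length xs = length cs"
    show "(\<forall>j\<in>{..<length cs}. xs ! j = R c j) = ((\<Sum>i<length cs. xs ! i *\<^sub>R cs ! i) \<in> {c})" (is "?L = ?R")
    proof
      assume ?L
      then have "(\<Sum>i<length cs. xs ! i *\<^sub>R cs ! i) = (\<Sum>i<length cs. R c i *\<^sub>R cs ! i)" by simp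
      then show ?R by (simp add: R)
    qed (use R(2)[OF len] in auto)
  qed
  then show ?thesis
    by (intro definableI[OF cs]) (simp add: om_pred_def coordinates_of_def)
qed

lemma coordinate_basis_real: "coordinate_basis [1::real]"
proof -
  have "span {1::real} = UNIV" using span_Basis[where 'a = real] by simp
  then show ?thesis by (simp add: coordinate_basis_def)
qed

lemma coordinates_of_real: "coordinates_of [1::real] A = (\<lambda>t. [t]) ` A"
  by (auto simp: coordinates_of_def length_Suc_conv)

lemma definable_real:
  "definable (A :: real set) \<longleftrightarrow> (\<exists>F. A = \<Union>F \<and> finite F \<and>
     (\<forall>I\<in>F. (open I \<and> is_interval I) \<or> (\<exists>a. I = {a})))"
proof -
  have inj: "inj (\<lambda>t::real. [t])" by (auto simp: inj_def)
  have "definable A \<longleftrightarrow> (\<lambda>t. [t]) ` A \<in> Om 1"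
  proof
    show "definable A" if "(\<lambda>t. [t]) ` A \<in> Om 1"
      by (rule definableI[OF coordinate_basis_real]) (use that in \<open>simp add: coordinates_of_real\<close>)
    show "(\<lambda>t. [t]) ` A \<in> Om 1" if "definable A"
      using that[unfolded definable_def, rule_format, of "[1]"] by (simp add: coordinates_of_real)
  qed
  then show ?thesis unfolding om_1 inj_image_eq_iff[OF inj] .
qed

lemma definable_interval: "open I \<Longrightarrow> is_interval I \<Longrightarrow> definable (I :: real set)"
  unfolding definable_real by (rule exI[of _ "{I}"]) simp

lemma definable_mult_graph: "definable {(x, y, z). (z::real) = x * y}"
proof -
  let ?bs = "[(1, 0, 0), (0, 1, 0), (0, 0, 1)] :: (real \<times> real \<times> real) list"
  have sp: "span (set ?bs) = UNIV"
  proof -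
    have "(x, y, z) \<in> span (set ?bs)" for x y z
    proof -
      have "x *\<^sub>R (1, 0, 0) + y *\<^sub>R (0, 1, 0) + z *\<^sub>R (0, 0, 1) \<in> span (set ?bs)"
        by (intro span_add span_scale span_base) auto
      then show ?thesis by simp
    qed
    then show ?thesis by auto
  qed
  have "independent (set ?bs)"
    by (rule card_le_dim_spanning[of _ UNIV]) (use sp in auto)
  with sp have b: "coordinate_basis ?bs" by (simp add: coordinate_basis_def)
  have "om_pred 3 (\<lambda>xs. xs ! 2 = xs ! 0 * xs ! 1)" by (rule om_pred_mult) auto
  then have "coordinates_of ?bs {(x, y, z). (z::real) = x * y} \<in> Om (length ?bs)"
    by (simp add: om_pred_def coordinates_of_def numeral_3_eq_3 numeral_2_eq_2)
  then show ?thesis by (rule definableI[OF b])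
qed

subsection \<open>First-order definability\<close>

definition dpred :: "('p::euclidean_space \<Rightarrow> bool) \<Rightarrow> bool" where
  "dpred P \<longleftrightarrow> definable {p. P p}"

text \<open>Functions enter formulas through their graphs: applying one costs an existential
  quantifier over its value, as in \<open>dpred_compose\<close>.\<close>

definition dterm :: "('p::euclidean_space \<Rightarrow> 'q::euclidean_space) \<Rightarrow> bool" where
  "dterm h \<longleftrightarrow> definable {(p, y). y = h p}"

lemma dpred_not: "dpred P \<Longrightarrow> dpred (\<lambda>p. \<not> P p)"
  unfolding dpred_def by (drule definable_Compl) (simp add: Collect_neg_eq)

lemma dpred_conj: "dpred P \<Longrightarrow> dpred Q \<Longrightarrow> dpred (\<lambda>p. P p \<and> Q p)"
  unfolding dpred_def by (drule (1) definable_Int) (simp add: Collect_conj_eq)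

lemma dpred_disj: "dpred P \<Longrightarrow> dpred Q \<Longrightarrow> dpred (\<lambda>p. P p \<or> Q p)"
  using dpred_not[OF dpred_conj[OF dpred_not dpred_not, of P Q]] by simp

lemma dpred_imp: "dpred P \<Longrightarrow> dpred Q \<Longrightarrow> dpred (\<lambda>p. P p \<longrightarrow> Q p)"
  using dpred_disj[OF dpred_not[of P], of Q] by simp

lemma dpred_ex:
  assumes "dpred (\<lambda>z. P (fst z) (snd z))" shows "dpred (\<lambda>p. \<exists>y. P p y)"
proof -
  have "fst ` {z. P (fst z) (snd z)} = {p. \<exists>y. P p y}" by (auto simp: image_iff)
  then show ?thesis using definable_fst_image[of "{z. P (fst z) (snd z)}"] assms by (simp add: dpred_def)
qed

lemma dpred_all:
  assumes "dpred (\<lambda>z. P (fst z) (snd z))" shows "dpred (\<lambda>p. \<forall>y. P p y)"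
  using dpred_not[OF dpred_ex[of "\<lambda>p y. \<not> P p y"]] dpred_not[OF assms] by simp

lemma dpred_vimage_linear: "dpred P \<Longrightarrow> linear L \<Longrightarrow> dpred (\<lambda>p. P (L p))"
  unfolding dpred_def by (drule (1) definable_vimage_linear) (simp add: vimage_def)

lemma dterm_linear: assumes "linear h" shows "dterm h"
proof -
  have "linear (\<lambda>z. snd z - h (fst z))"
    using assms by (intro linear_compose_sub linear_compose[OF linear_fst assms, unfolded o_def] linear_snd)
  from definable_vimage_linear[OF definable_sing[of 0] this]
  show ?thesis unfolding dterm_def by (rule back_subst[of definable]) auto
qed

lemma dterm_const: "dterm (\<lambda>_. c)"
  using definable_vimage_linear[OF definable_sing[of c] linear_snd] unfolding dterm_def
  by (rule back_subst[of definable]) auto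

lemma dpred_graph:
  assumes "dterm h" "linear L" "linear K" shows "dpred (\<lambda>p. K p = h (L p))"
proof -
  have "linear (\<lambda>p. (L p, K p))"
    using assms(2,3) by (intro linearI) (auto simp: linear_add linear_cmul)
  from definable_vimage_linear[OF assms(1)[unfolded dterm_def] this]
  show ?thesis by (simp add: dpred_def vimage_def)
qed

lemma dpred_compose: assumes "dpred P" "dterm h" shows "dpred (\<lambda>p. P (h p))"
proof -
  have "dpred (\<lambda>z. snd z = h (fst z) \<and> P (snd z))"
    by (rule dpred_conj[OF dpred_graph[OF assms(2) linear_fst linear_snd]
          dpred_vimage_linear[OF assms(1) linear_snd]])
  from dpred_ex[of "\<lambda>p y. y = h p \<and> P y", OF this] show ?thesis by simp
qed

lemma dpred_mem: "definable A \<Longrightarrow> dterm h \<Longrightarrow> dpred (\<lambda>p. h p \<in> A)"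
  by (rule dpred_compose) (simp_all add: dpred_def)

lemma dterm_compose:
  fixes F :: "'q::euclidean_space \<Rightarrow> 'r::euclidean_space" and h :: "'p::euclidean_space \<Rightarrow> 'q"
  assumes "dterm F" "dterm h" shows "dterm (\<lambda>p. F (h p))"
proof -
  have l: "linear (\<lambda>z :: (('p \<times> 'r) \<times> 'q). snd (fst z))" "linear (\<lambda>z :: (('p \<times> 'r) \<times> 'q). fst (fst z))"
    by (auto intro!: linearI)
  have "dpred (\<lambda>z. snd z = h (fst (fst z)) \<and> snd (fst z) = F (snd z))"
    by (rule dpred_conj[OF dpred_graph[OF assms(2) l(2) linear_snd] dpred_graph[OF assms(1) linear_snd l(1)]])
  from dpred_ex[of "\<lambda>w z. z = h (fst w) \<and> snd w = F z", OF this]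
  show ?thesis unfolding dterm_def dpred_def by (rule back_subst[of definable]) auto
qed

lemma dterm_id: "dterm (\<lambda>p. p)"
  by (rule dterm_linear) (rule linear_id[unfolded id_def])

lemma dterm_fst: "dterm h \<Longrightarrow> dterm (\<lambda>p. fst (h p))"
  by (rule dterm_compose[OF dterm_linear[OF linear_fst]])

lemma dterm_snd: "dterm h \<Longrightarrow> dterm (\<lambda>p. snd (h p))"
  by (rule dterm_compose[OF dterm_linear[OF linear_snd]])

lemma dterm_Pair: assumes "dterm h" "dterm k" shows "dterm (\<lambda>p. (h p, k p))"
proof -
  have l: "linear (\<lambda>w. fst (snd w))" "linear (\<lambda>w. snd (snd w))" by (auto intro!: linearI)
  have "dpred (\<lambda>w. fst (snd w) = h (fst w) \<and> snd (snd w) = k (fst w))"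
    by (rule dpred_conj[OF dpred_graph[OF assms(1) linear_fst l(1)] dpred_graph[OF assms(2) linear_fst l(2)]])
  then show ?thesis unfolding dterm_def dpred_def
    by (rule back_subst[of definable]) auto
qed

lemma dterm_linear2:
  assumes "linear (\<lambda>z. L (fst z) (snd z))" "dterm h" "dterm k" shows "dterm (\<lambda>p. L (h p) (k p))"
  using dterm_compose[OF dterm_linear[OF assms(1)] dterm_Pair[OF assms(2,3)]] by simp

lemma dterm_add: "dterm h \<Longrightarrow> dterm k \<Longrightarrow> dterm (\<lambda>p. h p + k p)"
  by (rule dterm_linear2[where L = "(+)"]) (auto intro!: linearI simp: algebra_simps)

lemma dterm_diff: "dterm h \<Longrightarrow> dterm k \<Longrightarrow> dterm (\<lambda>p. h p - k p)"
  by (rule dterm_linear2[where L = "(-)"]) (auto intro!: linearI simp: algebra_simps)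

lemma dterm_inner_const: "dterm h \<Longrightarrow> dterm (\<lambda>p. h p \<bullet> b)"
  by (rule dterm_compose[where F = "\<lambda>x. x \<bullet> b", OF dterm_linear])
    (auto intro!: linearI simp: inner_add_left)

lemma dterm_scaleR_const: "dterm h \<Longrightarrow> dterm (\<lambda>p. h p *\<^sub>R b)"
  by (rule dterm_compose[where F = "\<lambda>t. t *\<^sub>R b", OF dterm_linear])
    (auto intro!: linearI simp: scaleR_add_left)

lemma dterm_minus: "dterm h \<Longrightarrow> dterm (\<lambda>p. - h p)"
  by (rule dterm_compose[where F = uminus, OF dterm_linear]) (auto intro!: linearI)

lemma dterm_mult:
  fixes h k :: "'p::euclidean_space \<Rightarrow> real"
  assumes "dterm h" "dterm k" shows "dterm (\<lambda>p. h p * k p)"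
proof -
  have "definable ((\<lambda>(z, w). (fst z, snd z, w)) -` {(x, y, z). (z::real) = x * y})"
    by (rule definable_vimage_linear[OF definable_mult_graph]) (auto intro!: linearI)
  then have "dterm (\<lambda>z::real \<times> real. fst z * snd z)"
    unfolding dterm_def by (rule back_subst[of definable]) auto
  from dterm_compose[OF this dterm_Pair[OF assms]] show ?thesis by simp
qed

lemma dterm_sum: "finite I \<Longrightarrow> (\<And>i. i \<in> I \<Longrightarrow> dterm (h i)) \<Longrightarrow> dterm (\<lambda>p. \<Sum>i\<in>I. h i p)"
  by (induction I rule: finite_induct) (auto intro: dterm_const dterm_add)

lemma dterm_inner: "dterm h \<Longrightarrow> dterm k \<Longrightarrow> dterm (\<lambda>p. h p \<bullet> k p)"
  by (subst ext[of "\<lambda>p. h p \<bullet> k p" "\<lambda>p. \<Sum>b\<in>Basis. (h p \<bullet> b) * (k p \<bullet> b)", OF euclidean_inner])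
    (intro dterm_sum dterm_mult dterm_inner_const finite_Basis)

lemma dterm_scaleR:
  fixes k :: "'p::euclidean_space \<Rightarrow> 'q::euclidean_space"
  assumes "dterm h" "dterm k" shows "dterm (\<lambda>p. h p *\<^sub>R k p)"
proof -
  have "dterm (\<lambda>p. \<Sum>b\<in>Basis. (h p * (k p \<bullet> b)) *\<^sub>R b)"
    by (intro dterm_sum dterm_mult dterm_inner_const dterm_scaleR_const finite_Basis assms)
  moreover have "(\<Sum>b\<in>Basis. (h p * (k p \<bullet> b)) *\<^sub>R b) = h p *\<^sub>R k p" for p
    using euclidean_representation[of "h p *\<^sub>R k p"] by (simp add: inner_scaleR_left)
  ultimately show ?thesis by simp
qed

lemma dpred_eq: "dterm h \<Longrightarrow> dterm k \<Longrightarrow> dpred (\<lambda>p. h p = k p)"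
  using dpred_mem[OF definable_sing[of 0] dterm_diff, of h k] by simp

lemma dpred_less: "dterm h \<Longrightarrow> dterm k \<Longrightarrow> dpred (\<lambda>p. (h p :: real) < k p)"
  using dpred_mem[OF definable_interval[of "{0<..}"] dterm_diff, of k h]
  by (simp add: is_interval_oi)

lemma dpred_le: "dterm h \<Longrightarrow> dterm k \<Longrightarrow> dpred (\<lambda>p. (h p :: real) \<le> k p)"
  using dpred_not[OF dpred_less, of k h] by (simp add: not_less)

lemma dterm_relation:
  assumes "dpred (\<lambda>z. R (fst z) (snd z))" "\<And>p y. R p y \<longleftrightarrow> y = h p" shows "dterm h"
  using assms(1) unfolding dpred_def dterm_def assms(2) by (rule back_subst[of definable]) auto

lemma dterm_norm: assumes "dterm h" shows "dterm (\<lambda>p. norm (h p))"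
proof -
  have "dterm (norm :: 'b \<Rightarrow> real)"
  proof (rule dterm_relation[where R = "\<lambda>x y. 0 \<le> y \<and> y * y = x \<bullet> x"])
    show "dpred (\<lambda>z::'b \<times> real. 0 \<le> snd z \<and> snd z * snd z = fst z \<bullet> fst z)"
      by (intro dpred_conj dpred_le dpred_eq dterm_mult dterm_inner dterm_snd dterm_fst dterm_const dterm_id)
    show "(0 \<le> y \<and> y * y = x \<bullet> x) = (y = norm x)" for x :: 'b and y
      by (auto simp: norm_eq_sqrt_inner power2_eq_square intro!: real_sqrt_unique[symmetric])
  qed
  from dterm_compose[OF this assms] show ?thesis .
qed

lemma dterm_dist: "dterm h \<Longrightarrow> dterm k \<Longrightarrow> dterm (\<lambda>p. dist (h p) (k p))"
  unfolding dist_norm by (intro dterm_norm dterm_diff)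

lemma dterm_abs: "dterm h \<Longrightarrow> dterm (\<lambda>p. \<bar>h p :: real\<bar>)"
  using dterm_norm[of h] by simp

text \<open>With these rules definability is proved by following the syntax of a formula.
  Quantifiers range over whole spaces, so bounded ones are written out with implications and
  conjunctions.\<close>

lemmas dintros = dpred_not dpred_conj dpred_disj dpred_imp dpred_ex dpred_all dpred_less dpred_le
  dpred_eq dterm_id dterm_fst dterm_snd dterm_Pair dterm_add dterm_diff dterm_minus dterm_mult
  dterm_scaleR dterm_inner dterm_norm dterm_dist dterm_abs dterm_const

lemma definable_ball: "definable (ball x r)"
proof -
  have "dpred (\<lambda>y. dist x y < r)" by (intro dintros)
  then show ?thesis by (simp add: dpred_def ball_def)
qed

lemma definable_closure: assumes "definable A" shows "definable (closure A)"
proof -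
  have "dpred (\<lambda>x. \<forall>e. 0 < e \<longrightarrow> (\<exists>y. y \<in> A \<and> dist y x < e))"
    by (intro dintros dpred_mem[OF assms])
  moreover have "{x. \<forall>e. 0 < e \<longrightarrow> (\<exists>y. y \<in> A \<and> dist y x < e)} = closure A"
    by (auto simp: closure_approachable Bex_def)
  ultimately show ?thesis by (simp add: dpred_def)
qed

end

subsection \<open>Genericity for definable sets\<close>

text \<open>If no closure of an \<open>A i\<close> contained an open part of \<open>W\<close>, the
  complements of the closures would be open and dense in \<open>W\<close> and would share a point of
  \<open>W\<close>, which no \<open>A i\<close> could contain.\<close>

lemma Baire_cover:
  fixes W :: "'a::euclidean_space set"
  assumes W: "open W" "W \<noteq> {}" and I: "countable I" and cov: "W \<subseteq> (\<Union>i\<in>I. A i)"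
  obtains i V where "i \<in> I" "open V" "V \<noteq> {}" "V \<subseteq> W" "V \<subseteq> closure (A i)"
proof (rule ccontr)
  note obt = that
  assume nt: "\<not> thesis"
  have no: "V = {}" if "i \<in> I" "open V" "V \<subseteq> W" "V \<subseteq> closure (A i)" for i V
    using obt[of i V] nt that by metis
  \<comment> \<open>The summand \<open>- closure W\<close> makes \<open>T i\<close> dense in the
    whole space and contains no point of \<open>W\<close>.\<close>
  define T where "T i = - closure (A i) \<union> - closure W" for i
  have dense: "UNIV \<subseteq> closure (T i)" if i: "i \<in> I" for i
  proof -
    have "interior (closure (A i) \<inter> closure W) \<inter> W = {}"
      by (rule no[OF i]) (use interior_subset in \<open>auto intro!: open_Int W\<close>)
    then have "interior (closure (A i) \<inter> closure W) \<inter> closure W = {}"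
      using open_Int_closure_eq_empty[OF open_interior, of "closure (A i) \<inter> closure W" W] by blast
    then have "interior (closure (A i) \<inter> closure W) = {}"
      using interior_subset[of "closure (A i) \<inter> closure W"] by blast
    moreover have "T i = - (closure (A i) \<inter> closure W)" by (auto simp: T_def)
    ultimately show ?thesis by (simp add: closure_complement) blast
  qed
  have "UNIV \<subseteq> closure (\<Inter> (T ` I))"
  proof (rule Baire)
    show "openin (top_of_set UNIV) S \<and> UNIV \<subseteq> closure S" if "S \<in> T ` I" for S
      using that dense by (auto simp: T_def simp del: closure_Un intro!: open_Un)
  qed (use I in auto)
  then have "W \<inter> \<Inter> (T ` I) \<noteq> {}"
    using W open_Int_closure_eq_empty[OF W(1), of "\<Inter> (T ` I)"] by auto
  then obtain x where x: "x \<in> W" "\<And>i. i \<in> I \<Longrightarrow> x \<in> T i" by blast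
  then obtain i where "i \<in> I" "x \<in> A i" using cov by blast
  with x(2)[of i] have "x \<notin> closure W" using closure_subset by (auto simp: T_def)
  with x(1) show False using closure_subset by blast
qed

text \<open>Fubini exchanges the two quantifiers, and for fixed \<open>t\<close> the inner statement
  is a translate of the right-hand side. Closedness of \<open>A\<close> supplies measurability on
  the product.\<close>

lemma AE_lines_iff:
  fixes A :: "'a::euclidean_space set" and b :: 'a
  assumes "closed A"
  shows "(AE x in lborel. AE t in lborel. x + t *\<^sub>R b \<notin> A) \<longleftrightarrow> (AE x in lborel. x \<notin> A)"
proof -
  have "closed ((\<lambda>z. fst z + snd z *\<^sub>R b) -` A)"
    by (intro continuous_closed_vimage assms) (auto intro!: continuous_intros)
  then have "{z. fst z + snd z *\<^sub>R b \<notin> A} \<in> sets borel"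
    using borel_closed borel_comp by (fastforce simp: vimage_def Collect_neg_eq)
  moreover have "sets ((lborel :: 'a measure) \<Otimes>\<^sub>M (lborel :: real measure)) = sets borel"
    by (subst lborel_prod) simp
  ultimately have "{z \<in> space (lborel \<Otimes>\<^sub>M lborel). fst z + snd z *\<^sub>R b \<notin> A} \<in> sets (lborel \<Otimes>\<^sub>M lborel)"
    by (simp only: space_pair_measure space_lborel space_borel UNIV_Times_UNIV UNIV_I simp_thms)
  then have "(AE x in lborel. AE t in lborel. x + t *\<^sub>R b \<notin> A) \<longleftrightarrow>
    (AE t in lborel. AE x in lborel. x + t *\<^sub>R b \<notin> A)"
    using lborel_pair.AE_commute[of "\<lambda>x t. x + t *\<^sub>R b \<notin> A"] by (simp add: case_prod_beta')
  also have "\<dots> \<longleftrightarrow> (AE t in (lborel :: real measure). AE x in lborel. x \<notin> A)"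
  proof -
    have "(AE x in lborel. x + c \<notin> A) \<longleftrightarrow> (AE x in lborel. x \<notin> A)" for c
    proof -
      have "(AE x in distr lborel borel ((+) c). x \<notin> A) \<longleftrightarrow> (AE x in lborel. c + x \<notin> A)"
        using borel_closed[OF assms] by (intro AE_distr_iff) auto
      then show ?thesis unfolding lborel_distr_plus by (simp add: add.commute)
    qed
    then show ?thesis by simp
  qed
  also have "\<dots> \<longleftrightarrow> (AE x in lborel. x \<notin> A)"
  proof (cases "AE x in lborel. x \<notin> A")
    case False
    have "\<not> (AE t in (lborel :: real measure). False)"
      using AE_iff_measurable[of UNIV lborel "\<lambda>_::real. False"] by simp
    with False show ?thesis by simp
  qed simp
  finally show ?thesis .
qed

lemma negligible_iff_AE:
  assumes "closed A" shows "negligible A \<longleftrightarrow> (AE x in lborel. x \<notin> A)"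
proof -
  have "A \<in> sets lborel" using borel_closed[OF assms] by simp
  then show ?thesis
    by (simp add: negligible_iff_null_sets AE_iff_null_sets AE_completion_iff null_sets_completion_iff)
qed

text \<open>For a basis vector \<open>b\<close> the displayed point is \<open>x\<close> with its
  \<open>b\<close>-coordinate replaced by \<open>t\<close>. The slab is thus a full cylinder in
  direction \<open>b\<close>, over those base points whose fibre in \<open>A\<close> contains the
  interval from \<open>c\<close> to \<open>d\<close>.\<close>

definition slab :: "'a::euclidean_space \<Rightarrow> 'a set \<Rightarrow> real \<Rightarrow> real \<Rightarrow> 'a set" where
  "slab b A c d = {x. \<forall>t. c < t \<longrightarrow> t < d \<longrightarrow> x + (t - x \<bullet> b) *\<^sub>R b \<in> A}"

text \<open>The dimension is fixed by the type, so induction on dimension becomes induction on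
  \<open>T\<close>: a set invariant outside \<open>T\<close> is in effect a subset of the coordinate
  space spanned by \<open>T\<close>.\<close>

definition invariant_outside :: "'a::euclidean_space set \<Rightarrow> 'a set \<Rightarrow> bool" where
  "invariant_outside T A \<longleftrightarrow> (\<forall>x\<in>A. \<forall>b\<in>Basis - T. \<forall>t. x + t *\<^sub>R b \<in> A)"

lemma invariant_outside_Compl:
  assumes "invariant_outside T A" shows "invariant_outside T (- A)"
  unfolding invariant_outside_def
proof (intro ballI allI notI ComplI)
  fix x b t assume "x \<in> - A" "b \<in> Basis - T" "x + t *\<^sub>R b \<in> A"
  then have "(x + t *\<^sub>R b) + (- t) *\<^sub>R b \<in> A" using assms unfolding invariant_outside_def by blast
  then show False using \<open>x \<in> - A\<close> by simp
qed

lemma invariant_outside_slab: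
  assumes "invariant_outside (insert b T) A" "b \<in> Basis"
  shows "invariant_outside T (slab b A c d)"
  unfolding invariant_outside_def
proof (intro ballI allI)
  fix x b' t assume x: "x \<in> slab b A c d" and b': "b' \<in> Basis - T"
  show "x + t *\<^sub>R b' \<in> slab b A c d"
  proof (cases "b' = b")
    case True
    then have eq: "x + t *\<^sub>R b' + (s - (x + t *\<^sub>R b') \<bullet> b) *\<^sub>R b = x + (s - x \<bullet> b) *\<^sub>R b" for s
      using assms(2) by (simp add: inner_add_left algebra_simps)
    show ?thesis using x unfolding slab_def mem_Collect_eq eq .
  next
    case False
    then have eq: "x + t *\<^sub>R b' + (s - (x + t *\<^sub>R b') \<bullet> b) *\<^sub>R b = (x + (s - x \<bullet> b) *\<^sub>R b) + t *\<^sub>R b'" for s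
      using assms(2) b' by (simp add: inner_add_left inner_Basis algebra_simps)
    have "b' \<in> Basis - insert b T" using False b' by simp
    then show ?thesis
      using x assms(1) unfolding slab_def mem_Collect_eq eq invariant_outside_def by blast
  qed
qed

lemma invariant_outside_empty:
  assumes "invariant_outside {} A" shows "A = {} \<or> A = UNIV"
proof -
  have "y \<in> A" if "x \<in> A" for x y
  proof -
    have "x + (\<Sum>b\<in>B. ((y - x) \<bullet> b) *\<^sub>R b) \<in> A" if "finite B" "B \<subseteq> Basis" for B
      using that
    proof (induction B rule: finite_induct)
      case (insert b B)
      then have "(x + (\<Sum>b\<in>B. ((y - x) \<bullet> b) *\<^sub>R b)) + ((y - x) \<bullet> b) *\<^sub>R b \<in> A"
        using assms by (auto simp: invariant_outside_def)
      then show ?case using insert by (simp add: algebra_simps)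
    qed (use \<open>x \<in> A\<close> in simp)
    from this[of Basis] show "y \<in> A" by (simp add: euclidean_representation)
  qed
  then show ?thesis by blast
qed

text \<open>Sweep \<open>V\<close> along \<open>b\<close> and keep the points with
  \<open>b\<close>-coordinate between \<open>c\<close> and \<open>d\<close>. The last conclusion
  lets the caller locate the new set, whose points differ from points of \<open>V\<close> only in
  the \<open>b\<close>-coordinate.\<close>

lemma slab_fill:
  assumes "open V" "V \<noteq> {}" "V \<subseteq> slab b A c d" "c < d" "b \<in> Basis"
  obtains V' where "open V'" "V' \<noteq> {}" "V' \<subseteq> A"
    "\<And>z. z \<in> V' \<Longrightarrow> c < z \<bullet> b \<and> z \<bullet> b < d \<and> (\<exists>s. z + s *\<^sub>R b \<in> V)"
proof
  let ?V = "{z. c < z \<bullet> b} \<inter> {z. z \<bullet> b < d} \<inter> (\<Union>s. (\<lambda>z. z + s *\<^sub>R b) -` V)"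
  show "open ?V"
    by (intro open_Int open_UN open_Collect_less ballI continuous_open_vimage assms)
      (auto intro!: continuous_intros)
  obtain v where v: "v \<in> V" using assms(2) by blast
  show "?V \<noteq> {}"
  proof -
    define k where "k = (c + d) / 2 - v \<bullet> b"
    have "(v + k *\<^sub>R b) \<bullet> b = (c + d) / 2" using assms(5) by (simp add: inner_add_left k_def)
    moreover have "v + k *\<^sub>R b + (- k) *\<^sub>R b \<in> V" using v by simp
    ultimately have "v + k *\<^sub>R b \<in> ?V" using assms(4) by (auto simp del: scaleR_minus_left)
    then show ?thesis by blast
  qed
  show "?V \<subseteq> A"
  proof
    fix z assume "z \<in> ?V"
    then obtain s where z: "c < z \<bullet> b" "z \<bullet> b < d" and s: "z + s *\<^sub>R b \<in> V" by auto
    from s assms(3) have "z + s *\<^sub>R b \<in> slab b A c d" by blast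
    with z have "z + s *\<^sub>R b + (z \<bullet> b - (z + s *\<^sub>R b) \<bullet> b) *\<^sub>R b \<in> A" unfolding slab_def by blast
    then show "z \<in> A" using assms(5) by (simp add: inner_add_left algebra_simps)
  qed
qed auto

section \<open>Dichotomy, countable covers and null sets\<close>

context o_minimal
begin

lemma definable_Un: "definable A \<Longrightarrow> definable B \<Longrightarrow> definable (A \<union> B)"
  using definable_Compl[OF definable_Int[OF definable_Compl definable_Compl]] by fastforce

lemma definable_real_finite_or_interior:
  assumes "definable (A :: real set)" shows "finite A \<or> interior A \<noteq> {}"
proof -
  obtain F where F: "A = \<Union>F" "finite F" "\<And>I. I \<in> F \<Longrightarrow> (open I \<and> is_interval I) \<or> (\<exists>a. I = {a})"
    using assms unfolding definable_real by auto
  show ?thesis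
  proof (cases "\<exists>I\<in>F. open I \<and> I \<noteq> {}")
    case True
    then obtain I where "I \<in> F" "open I" "I \<noteq> {}" by blast
    then have "I \<subseteq> interior A" using F(1) by (intro interior_maximal) auto
    then show ?thesis using \<open>I \<noteq> {}\<close> by blast
  next
    case False
    then have "finite I" if "I \<in> F" for I using F(3)[OF that] that by auto
    then show ?thesis using F by auto
  qed
qed

text \<open>An interval that meets every right neighbourhood of 0 contains one. Singletons count as
  intervals here, so both kinds of pieces are covered.\<close>

lemma definable_real_germ:
  assumes "definable (A :: real set)" obtains \<tau> where "\<tau> > 0" "{0<..<\<tau>} \<subseteq> A \<or> {0<..<\<tau>} \<inter> A = {}"
proof -
  obtain F where F: "A = \<Union>F" "finite F" "\<And>I. I \<in> F \<Longrightarrow> (open I \<and> is_interval I) \<or> (\<exists>a. I = {a})"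
    using assms unfolding definable_real by auto
  have "\<exists>\<tau>>0. {0<..<\<tau>} \<subseteq> \<Union>F \<or> {0<..<\<tau>} \<inter> \<Union>F = {}"
    using F(2,3)
  proof (induction F rule: finite_induct)
    case empty then show ?case by (auto intro: exI[of _ 1])
  next
    case (insert I F)
    then obtain \<tau> where \<tau>: "\<tau> > 0" "{0<..<\<tau>} \<subseteq> \<Union>F \<or> {0<..<\<tau>} \<inter> \<Union>F = {}" by auto
    have "(open I \<and> is_interval I) \<or> (\<exists>a. I = {a})" by (rule insert.prems) simp
    then have int: "is_interval I" by (auto simp: is_interval_1)
    show ?case
    proof (cases "\<exists>s>0. {0<..<s} \<inter> I = {}")
      case True
      then obtain s where "s > 0" "{0<..<s} \<inter> I = {}" by blast
      moreover have "{0<..<min s \<tau>} \<subseteq> {0<..<s}" "{0<..<min s \<tau>} \<subseteq> {0<..<\<tau>}" by auto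
      ultimately have "{0<..<min s \<tau>} \<subseteq> \<Union>(insert I F) \<or> {0<..<min s \<tau>} \<inter> \<Union>(insert I F) = {}"
        using \<tau>(2) by blast
      then show ?thesis using \<open>s > 0\<close> \<tau>(1) by (intro exI[of _ "min s \<tau>"]) simp
    next
      case False
      then have "{0<..<1} \<inter> I \<noteq> {}" using zero_less_one by blast
      then obtain s where s: "s \<in> I" "s > 0" by auto
      have "t \<in> I" if "0 < t" "t < s" for t
      proof -
        have "{0<..<t} \<inter> I \<noteq> {}" using False that(1) by blast
        then obtain r where "r \<in> I" "0 < r" "r < t" by auto
        then show ?thesis using int s that unfolding is_interval_1 by (meson less_imp_le)
      qed
      then show ?thesis using s by (intro exI[of _ s]) auto
    qed
  qed
  then show thesis using that F(1) by blast
qed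

text \<open>Rational endpoints keep the family of slabs over such intervals countable.\<close>

lemma definable_real_subinterval:
  assumes A: "definable (A :: real set)" and "l < u"
  obtains c d where "c \<in> \<rat>" "d \<in> \<rat>" "l < c" "c < d" "d < u" "{c<..<d} \<subseteq> A \<or> {c<..<d} \<subseteq> - A"
proof -
  obtain V where V: "open V" "V \<noteq> {}" "V \<subseteq> {l<..<u}" "V \<subseteq> A \<or> V \<subseteq> - A"
  proof (cases "interior (A \<inter> {l<..<u}) = {}")
    case True
    have "definable (A \<inter> {l<..<u})"
      by (rule definable_Int[OF A definable_interval]) (auto simp: is_interval_1)
    with True have fin: "finite (A \<inter> {l<..<u})" using definable_real_finite_or_interior by blast
    have "{l<..<u} - A \<inter> {l<..<u} \<noteq> {}"
      using fin infinite_Ioo[OF \<open>l < u\<close>] by (metis Diff_eq_empty_iff finite_subset)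
    then show thesis by (intro that[of "{l<..<u} - A \<inter> {l<..<u}"])
       (use fin in \<open>auto intro!: open_Diff finite_imp_closed\<close>)
  next
    case False
    then show thesis using interior_subset[of "A \<inter> {l<..<u}"] by (intro that[of "interior (A \<inter> {l<..<u})"]) auto
  qed
  then obtain x e where x: "x \<in> V" "e > 0" "\<And>y. \<bar>y - x\<bar> < e \<Longrightarrow> y \<in> V"
    unfolding open_real by (metis abs_minus_commute dist_real_def ex_in_conv open_dist)
  obtain c where c: "c \<in> \<rat>" "x - e < c" "c < x" using Rats_dense_in_real[of "x - e" x] x(2) by auto
  obtain d where d: "d \<in> \<rat>" "x < d" "d < x + e" using Rats_dense_in_real[of x "x + e"] x(2) by auto
  have mem: "y \<in> V" if "c \<le> y" "y \<le> d" for y using that c d by (intro x(3)) auto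
  then have "{c<..<d} \<subseteq> V" by auto
  with V mem[of c] mem[of d] c d show thesis by (intro that[of c d]) auto
qed

lemma definable_slab: "definable A \<Longrightarrow> definable (slab b A c d)"
proof -
  assume "definable A"
  then have "dpred (\<lambda>x. \<forall>t. c < t \<longrightarrow> t < d \<longrightarrow> x + (t - x \<bullet> b) *\<^sub>R b \<in> A)"
    by (intro dintros dpred_mem)
  then show ?thesis by (simp add: dpred_def slab_def)
qed

lemma definable_line:
  assumes "definable A" shows "definable {t. x + (t - s) *\<^sub>R b \<in> A}"
proof -
  have "dpred (\<lambda>t. x + (t - s) *\<^sub>R b \<in> A)" by (intro dintros dpred_mem assms)
  then show ?thesis by (simp add: dpred_def)
qed

text \<open>
  Induction on the set \<open>T\<close> of directions in which \<open>A\<close> may fail to be invariant. By the one-dimensional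
  axiom every point of a box lies in a slab of \<open>A\<close> or of \<open>- A\<close> over some rational interval in direction
  \<open>b\<close>, so one of these countably many slabs is somewhere dense; slabs are invariant in direction \<open>b\<close>.
\<close>

lemma definable_dichotomy_aux:
  assumes "finite T" "T \<subseteq> Basis" "definable A" "invariant_outside T A" "open W" "W \<noteq> {}"
  shows "\<exists>V. open V \<and> V \<noteq> {} \<and> V \<subseteq> W \<and> (V \<subseteq> A \<or> V \<subseteq> - A)"
  using assms
proof (induction T arbitrary: A W rule: finite_induct)
  case empty
  then show ?case using invariant_outside_empty[of A] by (intro exI[of _ W]) auto
next
  case (insert b T)
  have b: "b \<in> Basis" and T: "T \<subseteq> Basis" using insert.prems by auto
  obtain l u where lu: "box l u \<subseteq> W" "box l u \<noteq> {}"
    using insert.prems(4,5) by (metis open_contains_cbox ex_in_conv box_subset_cbox order_trans)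
  \<comment> \<open>The sign treats \<open>A\<close> and its complement in one countable
    cover.\<close>
  define A' where "A' s = (if s then A else - A)" for s
  define I where "I = {(s :: bool, c, d) |s c d. c \<in> \<rat> \<and> d \<in> \<rat> \<and> l \<bullet> b < c \<and> c < d \<and> d < u \<bullet> b}"
  have "I \<subseteq> UNIV \<times> \<rat> \<times> \<rat>" by (auto simp: I_def)
  then have "countable I" by (rule countable_subset) (simp add: countable_rat)
  moreover have "box l u \<subseteq> (\<Union>(s, c, d)\<in>I. slab b (A' s) c d)"
  proof
    fix x assume "x \<in> box l u"
    then have "l \<bullet> b < u \<bullet> b" using b by (auto simp: mem_box intro: less_trans)
    then obtain c d where cd: "c \<in> \<rat>" "d \<in> \<rat>" "l \<bullet> b < c" "c < d" "d < u \<bullet> b"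
      "{c<..<d} \<subseteq> {t. x + (t - x \<bullet> b) *\<^sub>R b \<in> A} \<or> {c<..<d} \<subseteq> - {t. x + (t - x \<bullet> b) *\<^sub>R b \<in> A}"
      using definable_real_subinterval[OF definable_line[OF insert.prems(2)]] by metis
    then have "x \<in> slab b (A' True) c d \<or> x \<in> slab b (A' False) c d"
      by (auto simp: slab_def A'_def)
    moreover have "(s, c, d) \<in> I" for s using cd by (simp add: I_def)
    ultimately show "x \<in> (\<Union>(s, c, d)\<in>I. slab b (A' s) c d)" by blast
  qed
  ultimately obtain i V where i: "i \<in> I" and V: "open V" "V \<noteq> {}" "V \<subseteq> box l u"
    "V \<subseteq> closure (case i of (s, c, d) \<Rightarrow> slab b (A' s) c d)"
    using Baire_cover[OF open_box lu(2), of I "\<lambda>(s, c, d). slab b (A' s) c d"] by metis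
  obtain s c d where icd: "i = (s, c, d)" by (cases i)
  have cd: "l \<bullet> b < c" "c < d" "d < u \<bullet> b" using i by (auto simp: I_def icd)
  have "definable (A' s)" "invariant_outside (insert b T) (A' s)"
    using insert.prems by (auto simp: A'_def intro: definable_Compl invariant_outside_Compl)
  then obtain V' where V': "open V'" "V' \<noteq> {}" "V' \<subseteq> V"
     "V' \<subseteq> slab b (A' s) c d \<or> V' \<subseteq> - slab b (A' s) c d"
    using insert.IH[OF T definable_slab invariant_outside_slab[OF _ b] V(1,2)] by metis
  \<comment> \<open>An open subset of the closure of the slab cannot avoid the slab, which leaves
    one side of the dichotomy.\<close>
  have "V' \<subseteq> slab b (A' s) c d"
  proof (rule ccontr)
    assume "\<not> ?thesis"
    then have "V' \<inter> closure (slab b (A' s) c d) = {}"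
      using V' by (subst open_Int_closure_eq_empty) auto
    then show False using V(4) V' by (auto simp: icd)
  qed
  then obtain V'' where V'': "open V''" "V'' \<noteq> {}" "V'' \<subseteq> A' s"
    "\<And>z. z \<in> V'' \<Longrightarrow> c < z \<bullet> b \<and> z \<bullet> b < d \<and> (\<exists>s. z + s *\<^sub>R b \<in> V')"
    by (rule slab_fill[OF V'(1,2) _ cd(2) b]) blast
  \<comment> \<open>The \<open>b\<close>-coordinate lies between \<open>c\<close> and
    \<open>d\<close>, hence strictly inside the box; the other coordinates are those of a point of
    \<open>V'\<close>.\<close>
  have "V'' \<subseteq> box l u"
  proof
    fix z assume "z \<in> V''"
    then obtain s where z: "c < z \<bullet> b" "z \<bullet> b < d" "z + s *\<^sub>R b \<in> box l u" using V''(4) V'(3) V(3) by blast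
    show "z \<in> box l u"
      unfolding mem_box
    proof
      fix b' :: 'a assume b': "b' \<in> Basis"
      show "l \<bullet> b' < z \<bullet> b' \<and> z \<bullet> b' < u \<bullet> b'"
      proof (cases "b' = b")
        case True then show ?thesis using z cd by auto
      next
        case False
        then have "(z + s *\<^sub>R b) \<bullet> b' = z \<bullet> b'" using b b' by (simp add: inner_add_left inner_Basis)
        then show ?thesis using z(3) b' unfolding mem_box by metis
      qed
    qed
  qed
  then show ?case using V'' lu(1) by (intro exI[of _ V'']) (auto simp: A'_def split: if_splits)
qed

theorem definable_dichotomy:
  assumes "definable A" "open W" "W \<noteq> {}"
  obtains V where "open V" "V \<noteq> {}" "V \<subseteq> W" "V \<subseteq> A \<or> V \<subseteq> - A"
proof -
  have "invariant_outside Basis A" by (simp add: invariant_outside_def)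
  then show thesis using definable_dichotomy_aux[OF finite_Basis order_refl assms(1) _ assms(2,3)] that by blast
qed

text \<open>The dichotomy excludes sets like the rationals: a definable set is not both dense and
  codense in a nonempty open set.\<close>

lemma definable_closure_interior:
  assumes "definable A" "interior A = {}" shows "interior (closure A) = {}"
proof (rule ccontr)
  assume "interior (closure A) \<noteq> {}"
  then obtain V where V: "open V" "V \<noteq> {}" "V \<subseteq> interior (closure A)" "V \<subseteq> A \<or> V \<subseteq> - A"
    using definable_dichotomy[OF assms(1) open_interior] by metis
  from V(4) show False
  proof
    assume "V \<subseteq> A" then show False using interior_maximal[OF _ V(1)] assms(2) V(2) by blast
  next
    assume "V \<subseteq> - A"
    then have "V \<inter> closure A = {}" using V(1) by (subst open_Int_closure_eq_empty) auto
    then show False using V(2,3) interior_subset by blast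
  qed
qed

lemma definable_Un_interior:
  assumes "definable A" "interior A = {}" "interior B = {}" shows "interior (A \<union> B) = {}"
proof (rule ccontr)
  assume "interior (A \<union> B) \<noteq> {}"
  then obtain V where V: "open V" "V \<noteq> {}" "V \<subseteq> interior (A \<union> B)" "V \<subseteq> A \<or> V \<subseteq> - A"
    using definable_dichotomy[OF assms(1) open_interior] by metis
  then have "V \<subseteq> A \<or> V \<subseteq> B" using interior_subset[of "A \<union> B"] by blast
  then show False using interior_maximal[OF _ V(1)] assms(2,3) V(2) by blast
qed

text \<open>Baire's theorem yields a piece that is merely dense in an open set; the dichotomy
  upgrades density to containment on a smaller open set.\<close>

theorem definable_countable_cover:
  assumes "\<And>i. i \<in> I \<Longrightarrow> definable (A i)" "countable I" "open W" "W \<noteq> {}" "W \<subseteq> (\<Union>i\<in>I. A i)"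
  obtains i V where "i \<in> I" "open V" "V \<noteq> {}" "V \<subseteq> W" "V \<subseteq> A i"
proof -
  obtain i V where i: "i \<in> I" "open V" "V \<noteq> {}" "V \<subseteq> W" "V \<subseteq> closure (A i)"
    using Baire_cover[OF assms(3,4,2,5)] by metis
  obtain V' where V': "open V'" "V' \<noteq> {}" "V' \<subseteq> V" "V' \<subseteq> A i \<or> V' \<subseteq> - A i"
    using definable_dichotomy[OF assms(1)[OF i(1)] i(2,3)] by metis
  have "\<not> V' \<subseteq> - A i"
    using open_Int_closure_eq_empty[OF V'(1), of "A i"] i(5) V'(2,3) by blast
  then show thesis using V' i by (intro that[of i V']) auto
qed

text \<open>
  The same induction: the slabs of the closure \<open>K\<close> are null, lines outside them meet \<open>K\<close> in finite sets,
  and Fubini's theorem applies because \<open>K\<close> is closed, hence measurable.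
\<close>

lemma definable_negligible_aux:
  assumes "finite T" "T \<subseteq> Basis" "definable A" "invariant_outside T A" "interior A = {}"
  shows "negligible A"
  using assms
proof (induction T arbitrary: A rule: finite_induct)
  case empty
  then show ?case using invariant_outside_empty[of A] by auto
next
  case (insert b T)
  have b: "b \<in> Basis" and T: "T \<subseteq> Basis" using insert.prems by auto
  define K where "K = closure A"
  have K: "definable K" "interior K = {}" "closed K"
    unfolding K_def using insert.prems by (simp_all add: definable_closure definable_closure_interior)
  have inv: "invariant_outside (insert b T) K"
    unfolding invariant_outside_def K_def
  proof (intro ballI allI)
    fix x b' t assume x: "x \<in> closure A" and b': "b' \<in> Basis - insert b T"
    have "(\<lambda>y. y + t *\<^sub>R b') ` closure A \<subseteq> closure ((\<lambda>y. y + t *\<^sub>R b') ` A)"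
      using closure_translation[of "t *\<^sub>R b'" A] by (simp add: add.commute)
    moreover have "(\<lambda>y. y + t *\<^sub>R b') ` A \<subseteq> A"
      using insert.prems(3) b' by (auto simp: invariant_outside_def)
    ultimately show "x + t *\<^sub>R b' \<in> closure A" using x closure_mono by blast
  qed
  define I where "I = {(c, d). c \<in> \<rat> \<and> d \<in> \<rat> \<and> c < (d :: real)}"
  have "I \<subseteq> \<rat> \<times> \<rat>" by (auto simp: I_def)
  then have I: "countable I" by (rule countable_subset) (simp add: countable_rat)
  have "negligible (slab b K c d)" if "(c, d) \<in> I" for c d
  proof (rule insert.IH[OF T definable_slab[OF K(1)] invariant_outside_slab[OF inv b]])
    show "interior (slab b K c d) = {}"
    proof (rule ccontr)
      assume "interior (slab b K c d) \<noteq> {}"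
      moreover have "c < d" using that by (simp add: I_def)
      ultimately obtain V' where "open V'" "V' \<noteq> {}" "V' \<subseteq> K"
        using slab_fill[OF open_interior _ interior_subset _ b] by metis
      then show False using K(2) interior_maximal by blast
    qed
  qed
  then have "negligible (\<Union>(c, d)\<in>I. slab b K c d)"
    by (intro negligible_countable_Union) (use I in auto)
  then have "AE x in lebesgue. x \<notin> (\<Union>(c, d)\<in>I. slab b K c d)"
    unfolding negligible_iff_null_sets by (rule AE_not_in)
  moreover have "AE t in lborel. x + t *\<^sub>R b \<notin> K" if "x \<notin> (\<Union>(c, d)\<in>I. slab b K c d)" for x
  proof -
    let ?D = "{t. x + (t - x \<bullet> b) *\<^sub>R b \<in> K}"
    have "interior ?D = {}"
    proof (rule ccontr)
      assume "interior ?D \<noteq> {}"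
      then obtain y e where ye: "e > 0" "ball y e \<subseteq> ?D" by (meson ex_in_conv mem_interior)
      obtain c where c: "c \<in> \<rat>" "y - e < c" "c < y" using Rats_dense_in_real[of "y - e" y] ye(1) by auto
      obtain d where d: "d \<in> \<rat>" "y < d" "d < y + e" using Rats_dense_in_real[of y "y + e"] ye(1) by auto
      have "x \<in> slab b K c d"
        unfolding slab_def using ye(2) c d by (auto simp: subset_iff dist_real_def abs_less_iff)
      then show False using that c d by (auto simp: I_def)
    qed
    then have "finite ?D" using definable_real_finite_or_interior[OF definable_line[OF K(1)]] by blast
    then have "finite ((\<lambda>t. t - x \<bullet> b) ` ?D)" by simp
    moreover have "(\<lambda>t. t - x \<bullet> b) ` ?D = {t. x + t *\<^sub>R b \<in> K}"
      by (auto simp: image_iff intro!: exI[of _ "_ + x \<bullet> b"])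
    ultimately have "{t. x + t *\<^sub>R b \<in> K} \<in> null_sets lborel"
      by (simp add: finite_imp_null_set_lborel)
    then show ?thesis by (auto dest: AE_not_in)
  qed
  ultimately have "AE x in lebesgue. AE t in lborel. x + t *\<^sub>R b \<notin> K" by (auto elim: eventually_mono)
  then have "AE x in lborel. AE t in lborel. x + t *\<^sub>R b \<notin> K" by (simp add: AE_completion_iff)
  then have "negligible K" using AE_lines_iff[OF K(3)] negligible_iff_AE[OF K(3)] by blast
  then show ?case unfolding K_def using closure_subset negligible_subset by blast
qed

theorem definable_negligible: "definable A \<Longrightarrow> interior A = {} \<Longrightarrow> negligible A"
  by (rule definable_negligible_aux[OF finite_Basis order_refl]) (auto simp: invariant_outside_def)

text \<open>The direction \<open>d\<close> is arbitrary, so the argument does not go through slabs: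
  the closure of \<open>A\<close> is null, almost every line meets it in a null set, and a definable
  null set of reals contains no interval, hence is finite.\<close>

lemma definable_AE_lines_finite:
  assumes "definable A" "interior A = {}"
  shows "AE x in lborel. finite {t. x + t *\<^sub>R d \<in> A}"
proof -
  have "negligible (closure A)"
    by (intro definable_negligible definable_closure definable_closure_interior assms)
  then have "AE x in lborel. AE t in lborel. x + t *\<^sub>R d \<notin> closure A"
    using AE_lines_iff[of "closure A" d] negligible_iff_AE[of "closure A"] by simp
  then show ?thesis
  proof (rule eventually_mono)
    fix x assume ae: "AE t in lborel. x + t *\<^sub>R d \<notin> closure A"
    let ?D = "{t. x + t *\<^sub>R d \<in> A}"
    have "interior ?D = {}"
    proof -
      have "AE t in lborel. t \<notin> interior ?D"
        using ae by (rule eventually_mono) (use interior_subset closure_subset in blast)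
      then have "interior ?D \<in> null_sets lborel" by (subst AE_iff_null_sets) auto
      then show ?thesis
        by (metis negligible_iff_null_sets null_sets_completion_iff open_interior open_not_negligible
            null_setsD2 null_sets_completionI)
    qed
    then show "finite ?D"
      using definable_real_finite_or_interior[OF definable_line[OF assms(1), of x 0 d]] by simp
  qed
qed

end

subsection \<open>Generic strict differentiability\<close>

text \<open>Continuous induction: the largest parameter at which the bound holds can be moved to the
  right unless it is \<open>T\<close>. The hypothesis is an inequality for small \<open>h\<close>
  and not a limit, so no epsilon is lost.\<close>

lemma increment_ge_of_right_slope:
  fixes \<phi> :: "real \<Rightarrow> real"
  assumes T: "0 \<le> T" and cont: "continuous_on {0..T} \<phi>"
    and slope: "\<And>s. 0 \<le> s \<Longrightarrow> s < T \<Longrightarrow> \<exists>\<tau>>0. \<forall>h. 0 < h \<longrightarrow> h < \<tau> \<longrightarrow> c * h \<le> \<phi> (s + h) - \<phi> s"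
  shows "c * T \<le> \<phi> T - \<phi> 0"
proof -
  define Z where "Z = {s \<in> {0..T}. c * s \<le> \<phi> s - \<phi> 0}"
  have "closed Z"
    unfolding Z_def by (rule continuous_on_closed_Collect_le) (intro continuous_intros cont closed_atLeastAtMost)+
  moreover have "bounded Z" by (rule bounded_subset[of "{0..T}"]) (auto simp: Z_def)
  ultimately have "compact Z" by (simp add: compact_eq_bounded_closed)
  moreover have "Z \<noteq> {}" using T by (auto simp: Z_def intro!: exI[of _ 0])
  ultimately obtain s where s: "s \<in> Z" "\<And>t. t \<in> Z \<Longrightarrow> t \<le> s"
    using compact_attains_sup by metis
  have "s = T"
  proof (rule ccontr)
    assume "s \<noteq> T"
    then have sT: "0 \<le> s" "s < T" using s(1) by (auto simp: Z_def)
    from slope[OF this] obtain \<tau> where \<tau>: "\<tau> > 0"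
      "\<And>h. 0 < h \<Longrightarrow> h < \<tau> \<Longrightarrow> c * h \<le> \<phi> (s + h) - \<phi> s" by blast
    define h where "h = min (\<tau> / 2) (T - s)"
    have h: "0 < h" "h < \<tau>" "s + h \<le> T" using \<tau>(1) sT by (auto simp: h_def)
    have "s + h \<in> Z" using s(1) \<tau>(2)[OF h(1,2)] h sT by (auto simp: Z_def algebra_simps)
    then show False using s(2)[of "s + h"] h(1) by simp
  qed
  then show ?thesis using s(1) by (simp add: Z_def)
qed

lemma increment_ge_on_segment:
  fixes F :: "'a::real_normed_vector \<Rightarrow> real"
  assumes V: "convex V" "open V" and cont: "continuous_on V F"
    and slope: "\<And>z. z \<in> V \<Longrightarrow> \<exists>\<tau>>0. \<forall>h. 0 < h \<longrightarrow> h < \<tau> \<longrightarrow> c * h \<le> F (z + h *\<^sub>R b) - F z"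
    and y: "y \<in> V" "y + t *\<^sub>R b \<in> V" "0 \<le> t"
  shows "c * t \<le> F (y + t *\<^sub>R b) - F y"
proof -
  have mem: "y + s *\<^sub>R b \<in> V" if "0 \<le> s" "s \<le> t" for s
  proof (cases "t = 0")
    case False
    then have "(1 - s / t) *\<^sub>R y + (s / t) *\<^sub>R (y + t *\<^sub>R b) \<in> V"
      using that V(1) y by (intro convexD) auto
    moreover have "(1 - s / t) *\<^sub>R y + (s / t) *\<^sub>R (y + t *\<^sub>R b) = y + s *\<^sub>R b"
      using False by (simp add: algebra_simps)
    ultimately show ?thesis by simp
  qed (use that y in simp)
  have "c * t \<le> F (y + t *\<^sub>R b) - F (y + 0 *\<^sub>R b)"
  proof (rule increment_ge_of_right_slope[OF y(3)])
    show "continuous_on {0..t} (\<lambda>s. F (y + s *\<^sub>R b))"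
      using mem by (intro continuous_on_compose2[OF cont] continuous_intros) auto
    fix s assume "0 \<le> s" "s < t"
    then show "\<exists>\<tau>>0. \<forall>h. 0 < h \<longrightarrow> h < \<tau> \<longrightarrow> c * h \<le> F (y + (s + h) *\<^sub>R b) - F (y + s *\<^sub>R b)"
      using slope[OF mem[of s]] by (simp add: algebra_simps)
  qed
  then show ?thesis by simp
qed

text \<open>The bound is uniform over pairs of points near \<open>x\<close>; this two-point form is
  what strict differentiability requires.\<close>

definition slope_ge :: "('a::euclidean_space \<Rightarrow> real) \<Rightarrow> 'a \<Rightarrow> real \<Rightarrow> 'a \<Rightarrow> bool" where
  "slope_ge F b c x \<longleftrightarrow> (\<exists>d. 0 < d \<and> (\<forall>y t. 0 < t \<longrightarrow> dist x y < d \<longrightarrow> dist x (y + t *\<^sub>R b) < d \<longrightarrow>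
     c * t \<le> F (y + t *\<^sub>R b) - F y))"

definition strict_partial :: "('a::euclidean_space \<Rightarrow> real) \<Rightarrow> 'a \<Rightarrow> 'a \<Rightarrow> bool" where
  "strict_partial F b x \<longleftrightarrow> (\<exists>p. \<forall>e. 0 < e \<longrightarrow> (\<exists>d. 0 < d \<and> (\<forall>y t. dist x y < d \<longrightarrow>
     dist x (y + t *\<^sub>R b) < d \<longrightarrow> \<bar>F (y + t *\<^sub>R b) - F y - p * t\<bar> \<le> e * \<bar>t\<bar>)))"

text \<open>Strict Frechet differentiability with gradient \<open>p\<close>. It stands in for being
  continuously differentiable near \<open>x\<close>, but is expressed at the single point
  \<open>x\<close> by quantifiers over points and reals.\<close>

definition strict_deriv :: "('a::euclidean_space \<Rightarrow> real) \<Rightarrow> 'a \<Rightarrow> 'a \<Rightarrow> bool" where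
  "strict_deriv F x p \<longleftrightarrow> (\<forall>e. 0 < e \<longrightarrow> (\<exists>d. 0 < d \<and> (\<forall>y z. dist x y < d \<longrightarrow> dist x z < d \<longrightarrow>
     \<bar>F y - F z - p \<bullet> (y - z)\<bar> \<le> e * norm (y - z))))"

lemma slope_ge_mono: "slope_ge F b c x \<Longrightarrow> c' \<le> c \<Longrightarrow> slope_ge F b c' x"
  unfolding slope_ge_def by (meson less_imp_le mult_right_mono order_trans)

lemma slope_ge_imp_right_slope:
  assumes "slope_ge F b c z" shows "\<exists>\<tau>>0. \<forall>h. 0 < h \<longrightarrow> h < \<tau> \<longrightarrow> c * h \<le> F (z + h *\<^sub>R b) - F z"
proof -
  obtain d where d: "0 < d" "\<And>y t. 0 < t \<Longrightarrow> dist z y < d \<Longrightarrow> dist z (y + t *\<^sub>R b) < d \<Longrightarrow>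
     c * t \<le> F (y + t *\<^sub>R b) - F y" using assms unfolding slope_ge_def by blast
  show ?thesis
  proof (intro exI[of _ "d / (norm b + 1)"] conjI allI impI)
    show "0 < d / (norm b + 1)" using d(1) by (intro divide_pos_pos) (auto simp: add_nonneg_pos)
    fix h assume h: "0 < h" "h < d / (norm b + 1)"
    have "h * norm b \<le> h * (norm b + 1)" using h by simp
    also have "\<dots> < d" using h(2) by (simp add: pos_less_divide_eq add_nonneg_pos)
    finally show "c * h \<le> F (z + h *\<^sub>R b) - F z" using h d(1) by (intro d(2)) (auto simp: dist_norm)
  qed
qed

text \<open>
  Note that \<open>slope_ge (\<lambda>x. - F x) b (- c) x\<close> says that the slopes near \<open>x\<close> are at most \<open>c\<close>.
\<close>

lemma strict_partial_of_slopes: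
  assumes dich: "\<And>c. c \<in> \<rat> \<Longrightarrow> slope_ge F b c x \<or> slope_ge (\<lambda>x. - F x) b (- c) x"
    and ge: "\<not> slope_ge F b c1 x" and le: "\<not> slope_ge (\<lambda>x. - F x) b c2 x"
  shows "strict_partial F b x"
proof -
  \<comment> \<open>A Dedekind cut: the strict partial derivative is the supremum of the slopes that
    bound from below. The assumption \<open>ge\<close> bounds \<open>P\<close> from above, and
    \<open>le\<close> makes it nonempty.\<close>
  define P where "P = {c. slope_ge F b c x}"
  have bdd: "c \<le> c1" if "c \<in> P" for c
    using slope_ge_mono[of F b c x c1] that ge unfolding P_def by force
  have "P \<noteq> {}"
  proof -
    obtain c where c: "c \<in> \<rat>" "c < - c2" using Rats_dense_in_real[of "- c2 - 1" "- c2"] by auto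
    have "\<not> slope_ge (\<lambda>x. - F x) b (- c) x" using slope_ge_mono[of _ b "- c" x c2] c(2) le by auto
    then show ?thesis using dich[OF c(1)] by (auto simp: P_def)
  qed
  define p where "p = Sup P"
  show ?thesis
    unfolding strict_partial_def
  proof (rule exI[of _ p], intro allI impI)
    fix e :: real assume e: "0 < e"
    obtain c' where "c' \<in> P" "p - e < c'"
      using less_cSup_iff[OF \<open>P \<noteq> {}\<close>, of "p - e"] bdd e unfolding p_def bdd_above_def by auto
    then have "slope_ge F b (p - e) x" using slope_ge_mono unfolding P_def by (metis mem_Collect_eq less_imp_le)
    then obtain d1 where d1: "0 < d1" "\<And>y t. 0 < t \<Longrightarrow> dist x y < d1 \<Longrightarrow> dist x (y + t *\<^sub>R b) < d1 \<Longrightarrow>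
       (p - e) * t \<le> F (y + t *\<^sub>R b) - F y" unfolding slope_ge_def by blast
    obtain c where c: "c \<in> \<rat>" "p < c" "c < p + e" using Rats_dense_in_real[of p "p + e"] e by auto
    have "c \<notin> P" using cSup_upper[of c P] bdd c(2) unfolding p_def bdd_above_def by fastforce
    then have "slope_ge (\<lambda>x. - F x) b (- (p + e)) x"
      using dich[OF c(1)] slope_ge_mono[of _ b "- c" x "- (p + e)"] c(3) by (auto simp: P_def)
    then obtain d2 where d2: "0 < d2" "\<And>y t. 0 < t \<Longrightarrow> dist x y < d2 \<Longrightarrow> dist x (y + t *\<^sub>R b) < d2 \<Longrightarrow>
       - (p + e) * t \<le> - F (y + t *\<^sub>R b) - - F y" unfolding slope_ge_def by blast
    have pos: "\<bar>F (y + t *\<^sub>R b) - F y - p * t\<bar> \<le> e * t"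
      if "0 < t" "dist x y < min d1 d2" "dist x (y + t *\<^sub>R b) < min d1 d2" for y t
      using d1(2)[of t y] d2(2)[of t y] that by (simp add: algebra_simps abs_le_iff)
    show "\<exists>d. 0 < d \<and> (\<forall>y t. dist x y < d \<longrightarrow> dist x (y + t *\<^sub>R b) < d \<longrightarrow>
      \<bar>F (y + t *\<^sub>R b) - F y - p * t\<bar> \<le> e * \<bar>t\<bar>)"
    proof (intro exI[of _ "min d1 d2"] conjI allI impI)
      show "0 < min d1 d2" using d1(1) d2(1) by simp
      fix y t assume y: "dist x y < min d1 d2" "dist x (y + t *\<^sub>R b) < min d1 d2"
      consider "0 < t" | "t = 0" | "t < 0" by linarith
      then show "\<bar>F (y + t *\<^sub>R b) - F y - p * t\<bar> \<le> e * \<bar>t\<bar>"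
      proof cases
        \<comment> \<open>A negative increment is a positive one started from the other
          endpoint.\<close>
        case 3
        have "y + t *\<^sub>R b + (- t) *\<^sub>R b = y" by simp
        then have "\<bar>F y - F (y + t *\<^sub>R b) - p * (- t)\<bar> \<le> e * (- t)"
          using pos[of "- t" "y + t *\<^sub>R b"] 3 y by (metis neg_0_less_iff_less)
        then show ?thesis using 3 by (simp add: abs_if split: if_splits)
      next
        case 1 then show ?thesis using pos[of t y] y by simp
      next
        case 2 then show ?thesis by simp
      qed
    qed
  qed
qed

text \<open>Go from \<open>z\<close> to \<open>y\<close> by changing one coordinate at a time and
  add up the strict partial estimates. Because these hold at all points near \<open>x\<close>, the
  corners of the path cause no trouble.\<close>

lemma strict_deriv_of_partials:
  fixes F :: "'a::euclidean_space \<Rightarrow> real"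
  assumes "\<forall>b\<in>Basis. strict_partial F b x"
  shows "\<exists>p. strict_deriv F x p"
proof -
  obtain P where P: "\<And>b e. b \<in> Basis \<Longrightarrow> 0 < e \<Longrightarrow> \<exists>d. 0 < d \<and> (\<forall>y t. dist x y < d \<longrightarrow>
     dist x (y + t *\<^sub>R b) < d \<longrightarrow> \<bar>F (y + t *\<^sub>R b) - F y - P b * t\<bar> \<le> e * \<bar>t\<bar>)"
    using bchoice[OF assms[unfolded strict_partial_def]] by blast
  define p :: 'a where "p = (\<Sum>b\<in>Basis. P b *\<^sub>R b)"
  let ?D = "real DIM('a)"
  show ?thesis
    unfolding strict_deriv_def
  proof (intro exI[of _ p] allI impI)
    fix e :: real assume "0 < e"
    define e' where "e' = e / ?D"
    have e': "0 < e'" using \<open>0 < e\<close> by (simp add: e'_def)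
    obtain d where d: "\<And>b. b \<in> Basis \<Longrightarrow> 0 < d b" "\<And>b y t. b \<in> Basis \<Longrightarrow> dist x y < d b \<Longrightarrow>
      dist x (y + t *\<^sub>R b) < d b \<Longrightarrow> \<bar>F (y + t *\<^sub>R b) - F y - P b * t\<bar> \<le> e' * \<bar>t\<bar>"
      using P[OF _ e'] by metis
    define d0 where "d0 = Min (d ` Basis)"
    have d0: "0 < d0" "\<And>b. b \<in> Basis \<Longrightarrow> d0 \<le> d b" using d(1) by (auto simp: d0_def)
    \<comment> \<open>Since \<open>norm w \<le> 2 * r\<close>, a corner is within
      \<open>r + 2 * r * ?D\<close> of \<open>x\<close>, which is below \<open>d0\<close>.\<close>
    define r where "r = d0 / (2 + 2 * ?D)"
    have "0 < 2 + 2 * ?D" by (simp add: add_pos_nonneg)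
    then have r: "0 < r" "(2 + 2 * ?D) * r = d0" using d0(1) by (simp_all add: r_def)
    show "\<exists>d. 0 < d \<and> (\<forall>y z. dist x y < d \<longrightarrow> dist x z < d \<longrightarrow>
      \<bar>F y - F z - p \<bullet> (y - z)\<bar> \<le> e * norm (y - z))"
    proof (intro exI[of _ "r"] conjI allI impI)
      show "0 < r" by (rule r)
      fix y z assume yz: "dist x y < r" "dist x z < r"
      define w where "w = y - z"
      have nw: "norm w \<le> 2 * r"
        using yz norm_triangle_ineq[of "y - x" "x - z"] by (simp add: w_def dist_norm norm_minus_commute)
      define zz where "zz T = z + (\<Sum>b\<in>T. (w \<bullet> b) *\<^sub>R b)" for T
      have sumw: "(\<Sum>b\<in>T. \<bar>w \<bullet> b\<bar>) \<le> ?D * norm w" if "T \<subseteq> Basis" for T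
      proof -
        have "(\<Sum>b\<in>T. \<bar>w \<bullet> b\<bar>) \<le> (\<Sum>b\<in>(Basis::'a set). \<bar>w \<bullet> b\<bar>)"
          using that by (intro sum_mono2) auto
        also have "\<dots> \<le> (\<Sum>b\<in>(Basis::'a set). norm w)"
          by (intro sum_mono Basis_le_norm)
        finally show ?thesis by simp
      qed
      have near: "dist x (zz T) < d0" if "T \<subseteq> Basis" for T
      proof -
        have "norm (\<Sum>b\<in>T. (w \<bullet> b) *\<^sub>R b) \<le> (\<Sum>b\<in>T. \<bar>w \<bullet> b\<bar>)"
          by (rule sum_norm_le) (use that in auto)
        also have "\<dots> \<le> ?D * (2 * r)"
          using sumw[OF that] nw by (meson mult_left_mono of_nat_0_le_iff order_trans)
        finally have n: "norm (\<Sum>b\<in>T. (w \<bullet> b) *\<^sub>R b) \<le> ?D * (2 * r)" .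
        have "dist x (zz T) \<le> dist x z + norm (\<Sum>b\<in>T. (w \<bullet> b) *\<^sub>R b)"
          using norm_triangle_ineq4[of "x - z" "\<Sum>b\<in>T. (w \<bullet> b) *\<^sub>R b"] by (simp add: zz_def dist_norm algebra_simps)
        also have "\<dots> < r + ?D * (2 * r)" using n yz(2) by linarith
        also have "\<dots> \<le> (2 + 2 * ?D) * r" using r(1) by (simp add: algebra_simps)
        also have "\<dots> = d0" by (rule r(2))
        finally show ?thesis .
      qed
      have main: "\<bar>F (zz T) - F z - (\<Sum>b\<in>T. P b * (w \<bullet> b))\<bar> \<le> e' * (\<Sum>b\<in>T. \<bar>w \<bullet> b\<bar>)"
        if "finite T" "T \<subseteq> Basis" for T
        using that
      proof (induction T rule: finite_induct)
        case empty then show ?case by (simp add: zz_def)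
      next
        case (insert b T)
        have zi: "zz (insert b T) = zz T + (w \<bullet> b) *\<^sub>R b" using insert by (simp add: zz_def algebra_simps)
        have "\<bar>F (zz T + (w \<bullet> b) *\<^sub>R b) - F (zz T) - P b * (w \<bullet> b)\<bar> \<le> e' * \<bar>w \<bullet> b\<bar>"
          by (rule d(2)) (use near[of T] near[of "insert b T"] d0(2)[of b] insert.prems zi in auto)
        moreover have "\<bar>F (zz T) - F z - (\<Sum>b\<in>T. P b * (w \<bullet> b))\<bar> \<le> e' * (\<Sum>b\<in>T. \<bar>w \<bullet> b\<bar>)"
          using insert by blast
        ultimately show ?case using insert.hyps unfolding zi by (simp add: algebra_simps)
      qed
      have "zz Basis = y" by (simp add: zz_def euclidean_representation w_def)
      moreover have "(\<Sum>b\<in>Basis. P b * (w \<bullet> b)) = p \<bullet> w"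
        by (simp add: p_def inner_sum_left inner_commute[of w])
      moreover have "e' * (\<Sum>b\<in>Basis. \<bar>w \<bullet> b\<bar>) \<le> e' * (?D * norm w)"
        using sumw[of Basis] e' by simp
      moreover have "e' * (?D * norm w) = e * norm w" by (simp add: e'_def)
      ultimately show "\<bar>F y - F z - p \<bullet> (y - z)\<bar> \<le> e * norm (y - z)"
        using main[of Basis] unfolding w_def by simp
    qed
  qed
qed

lemma strict_deriv_has_derivative:
  assumes "strict_deriv F x p" shows "(F has_derivative (\<lambda>h. p \<bullet> h)) (at x)"
  unfolding has_derivative_at_alt
proof (intro conjI allI impI)
  show "bounded_linear ((\<bullet>) p)" by (rule bounded_linear_inner_right)
  fix e :: real assume "0 < e"
  then obtain d where d: "0 < d" "\<And>y z. dist x y < d \<Longrightarrow> dist x z < d \<Longrightarrow>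
     \<bar>F y - F z - p \<bullet> (y - z)\<bar> \<le> e * norm (y - z)"
    using assms unfolding strict_deriv_def by blast
  show "\<exists>d>0. \<forall>y. norm (y - x) < d \<longrightarrow> norm (F y - F x - p \<bullet> (y - x)) \<le> e * norm (y - x)"
    by (intro exI[of _ d] conjI allI impI)
      (use d(1) d(2)[of _ x] in \<open>auto simp: dist_norm norm_minus_commute\<close>)
qed

lemma strict_deriv_unique:
  assumes "strict_deriv F x p" "strict_deriv F x q" shows "p = q"
proof -
  have "(\<lambda>h. p \<bullet> h) = (\<lambda>h. q \<bullet> h)"
    using assms by (intro has_derivative_unique[of F _ x]) (auto intro: strict_deriv_has_derivative)
  then show ?thesis by (metis inner_commute vector_eq_ldot)
qed

lemma generic_finite:
  assumes gen: "\<And>b (W :: 'a::topological_space set). b \<in> B \<Longrightarrow> open W \<Longrightarrow> W \<noteq> {} \<Longrightarrow>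
      \<exists>V. open V \<and> V \<noteq> {} \<and> V \<subseteq> W \<and> (\<forall>x\<in>V. Q b x)"
    and "finite B" "open W" "W \<noteq> {}"
  shows "\<exists>V. open V \<and> V \<noteq> {} \<and> V \<subseteq> W \<and> (\<forall>x\<in>V. \<forall>b\<in>B. Q b x)"
  using assms(2,1)
proof (induction B rule: finite_induct)
  case empty then show ?case using assms(3,4) by blast
next
  case (insert b B)
  then obtain V where V: "open V" "V \<noteq> {}" "V \<subseteq> W" "\<forall>x\<in>V. \<forall>b\<in>B. Q b x" by blast
  from insert.prems[OF _ V(1,2), of b] obtain V' where "open V'" "V' \<noteq> {}" "V' \<subseteq> V" "\<forall>x\<in>V'. Q b x"
    by blast
  then show ?case using V by (intro exI[of _ V']) auto
qed

section \<open>Generic continuity and slopes of definable functions\<close>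

context o_minimal
begin

text \<open>Otherwise \<open>F\<close> is discontinuous throughout an open set. A countable cover
  makes the jump at least some fixed \<open>e\<close> on a smaller open set, and a second one
  confines the values of \<open>F\<close> there to an interval of length \<open>e\<close>, half
  open, so that no jump fits.\<close>

lemma generic_continuous:
  fixes F :: "'a::euclidean_space \<Rightarrow> real"
  assumes F: "dterm F" and W: "open W" "W \<noteq> {}"
  obtains V where "open V" "V \<noteq> {}" "V \<subseteq> W" "continuous_on V F"
proof -
  define Cont where "Cont = {x. \<forall>e. 0 < e \<longrightarrow> (\<exists>d. 0 < d \<and> (\<forall>y. dist y x < d \<longrightarrow> dist (F y) (F x) < e))}"
  have "dpred (\<lambda>x. \<forall>e. 0 < e \<longrightarrow> (\<exists>d. 0 < d \<and> (\<forall>y. dist y x < d \<longrightarrow> dist (F y) (F x) < e)))"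
    by (intro dintros dterm_compose[OF F])
  then have "definable Cont" by (simp add: dpred_def Cont_def)
  then obtain V where V: "open V" "V \<noteq> {}" "V \<subseteq> W" "V \<subseteq> Cont \<or> V \<subseteq> - Cont"
    using definable_dichotomy[OF _ W] by metis
  show thesis
  proof (cases "V \<subseteq> Cont")
    case True
    then have "continuous_on V F"
      unfolding continuous_on_iff Cont_def by blast
    then show thesis using that V by blast
  next
    case False
    define A where "A k = {x. \<forall>d. 0 < d \<longrightarrow> (\<exists>y. dist y x < d \<and> inverse (real (Suc k)) \<le> dist (F y) (F x))}" for k
    have "dpred (\<lambda>x. \<forall>d. 0 < d \<longrightarrow> (\<exists>y. dist y x < d \<and> inverse (real (Suc k)) \<le> dist (F y) (F x)))" for k
      by (intro dintros dterm_compose[OF F])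
    then have A: "definable (A k)" for k by (simp add: dpred_def A_def)
    have "V \<subseteq> (\<Union>k\<in>UNIV. A k)"
    proof
      fix x assume "x \<in> V"
      then have "x \<notin> Cont" using V(4) False by blast
      then obtain e where e: "0 < e" "\<not> (\<exists>d. 0 < d \<and> (\<forall>y. dist y x < d \<longrightarrow> dist (F y) (F x) < e))"
        unfolding Cont_def by blast
      obtain k where k: "inverse (real (Suc k)) < e" using reals_Archimedean[OF e(1)] by blast
      have "x \<in> A k"
        unfolding A_def mem_Collect_eq
      proof (intro allI impI)
        fix d :: real assume "0 < d"
        with e(2) obtain y where "dist y x < d" "\<not> dist (F y) (F x) < e" by blast
        then show "\<exists>y. dist y x < d \<and> inverse (real (Suc k)) \<le> dist (F y) (F x)"
          using k by (intro exI[of _ y]) auto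
      qed
      then show "x \<in> (\<Union>k\<in>UNIV. A k)" by blast
    qed
    then obtain k V' where V': "open V'" "V' \<noteq> {}" "V' \<subseteq> V" "V' \<subseteq> A k"
      using definable_countable_cover[of UNIV A V] A V(1,2) by (metis countableI_type)
    define e where "e = inverse (real (Suc k))"
    have e: "0 < e" by (simp add: e_def)
    \<comment> \<open>Slices the range into half-open intervals whose length equals the
      jump.\<close>
    define B where "B j = {x. of_int j * e \<le> F x \<and> F x < (of_int j + 1) * e}" for j
    have "dpred (\<lambda>x. of_int j * e \<le> F x \<and> F x < (of_int j + 1) * e)" for j
      by (intro dintros dterm_compose[OF F])
    then have B: "definable (B j)" for j by (simp add: dpred_def B_def)
    have "V' \<subseteq> (\<Union>j\<in>UNIV. B j)"
    proof
      fix x assume "x \<in> V'"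
      have "of_int \<lfloor>F x / e\<rfloor> * e \<le> F x / e * e" "F x / e * e < (of_int \<lfloor>F x / e\<rfloor> + 1) * e"
        using e by (auto intro!: mult_right_mono mult_strict_right_mono simp del: times_divide_eq_left)
      then have "x \<in> B \<lfloor>F x / e\<rfloor>" using e by (simp add: B_def)
      then show "x \<in> (\<Union>j\<in>UNIV. B j)" by blast
    qed
    then obtain j V'' where V'': "open V''" "V'' \<noteq> {}" "V'' \<subseteq> V'" "V'' \<subseteq> B j"
      using definable_countable_cover[of UNIV B V'] B V'(1,2) by (metis countableI_type)
    obtain x where x: "x \<in> V''" using V''(2) by blast
    obtain d where d: "0 < d" "\<And>y. dist y x < d \<Longrightarrow> y \<in> V''" using V''(1) x unfolding open_dist by blast
    have "x \<in> A k" using x V'' V' by blast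
    then obtain y where y: "dist y x < d" "e \<le> dist (F y) (F x)" using d(1) unfolding A_def e_def by blast
    have "x \<in> B j" "y \<in> B j" using x d(2)[OF y(1)] V''(4) by auto
    then show thesis using y(2) by (auto simp: B_def dist_real_def algebra_simps abs_if split: if_splits)
  qed
qed

lemma dpred_slope_ge:
  assumes F: "dterm F" and h: "dterm h" and c: "dterm c"
  shows "dpred (\<lambda>p. slope_ge F b (c p) (h p))"
  unfolding slope_ge_def
  by (intro dintros dterm_compose[OF F] dterm_compose[OF h] dterm_compose[OF c])

lemma definable_slope_ge: "dterm F \<Longrightarrow> definable {x. slope_ge F b c x}"
  using dpred_slope_ge[OF _ dterm_id dterm_const] by (simp add: dpred_def)

lemma definable_strict_partial: assumes F: "dterm F" shows "definable {x. strict_partial F b x}"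
proof -
  have "dpred (\<lambda>x. strict_partial F b x)"
    unfolding strict_partial_def by (intro dintros dterm_compose[OF F])
  then show ?thesis by (simp add: dpred_def)
qed

text \<open>The dichotomy is applied to the one-sided condition at single points, the set
  \<open>R\<close>. On a ball where \<open>F\<close> is continuous,
  \<open>increment_ge_on_segment\<close> then integrates the one-sided bound to the two-point
  bound.\<close>

lemma generic_slope:
  assumes F: "dterm F" and W: "open W" "W \<noteq> {}"
  obtains V where "open V" "V \<noteq> {}" "V \<subseteq> W"
    "(\<forall>x\<in>V. slope_ge F b c x) \<or> (\<forall>x\<in>V. slope_ge (\<lambda>x. - F x) b (- c) x)"
proof -
  obtain V0 where V0: "open V0" "V0 \<noteq> {}" "V0 \<subseteq> W" "continuous_on V0 F"
    using generic_continuous[OF F W] by metis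
  define R where "R = {x. \<exists>\<tau>. 0 < \<tau> \<and> (\<forall>h. 0 < h \<longrightarrow> h < \<tau> \<longrightarrow> c * h \<le> F (x + h *\<^sub>R b) - F x)}"
  have "dpred (\<lambda>x. \<exists>\<tau>. 0 < \<tau> \<and> (\<forall>h. 0 < h \<longrightarrow> h < \<tau> \<longrightarrow> c * h \<le> F (x + h *\<^sub>R b) - F x))"
    by (intro dintros dterm_compose[OF F])
  then have "definable R" by (simp add: dpred_def R_def)
  then obtain V1 where V1: "open V1" "V1 \<noteq> {}" "V1 \<subseteq> V0" "V1 \<subseteq> R \<or> V1 \<subseteq> - R"
    using definable_dichotomy[OF _ V0(1,2)] by metis
  then obtain x0 r where r: "0 < r" "ball x0 r \<subseteq> V1" by (meson ex_in_conv open_contains_ball)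
  let ?V = "ball x0 r"
  have cont: "continuous_on ?V F" using V0(4) V1(3) r(2) continuous_on_subset by blast
  have local: "slope_ge G b k x"
    if x: "x \<in> ?V" and seg: "\<And>y t. y \<in> ?V \<Longrightarrow> y + t *\<^sub>R b \<in> ?V \<Longrightarrow> 0 \<le> t \<Longrightarrow> k * t \<le> G (y + t *\<^sub>R b) - G y"
    for G k x
  proof -
    obtain d where "0 < d" "ball x d \<subseteq> ?V" using openE[OF open_ball x] by blast
    then show ?thesis unfolding slope_ge_def using seg by (intro exI[of _ d]) (auto simp: subset_iff)
  qed
  show thesis
  proof (cases "V1 \<subseteq> R")
    case True
    have "c * t \<le> F (y + t *\<^sub>R b) - F y" if "y \<in> ?V" "y + t *\<^sub>R b \<in> ?V" "0 \<le> t" for y t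
      by (rule increment_ge_on_segment[OF convex_ball open_ball cont])
        (use True r(2) that in \<open>auto simp: R_def\<close>)
    then show thesis using local r V0 V1 by (intro that[of ?V]) auto
  next
    case False
    have "- c * t \<le> - F (y + t *\<^sub>R b) - - F y" if y: "y \<in> ?V" "y + t *\<^sub>R b \<in> ?V" "0 \<le> t" for y t
    proof (rule increment_ge_on_segment[OF convex_ball open_ball _ _ y, of "\<lambda>x. - F x"])
      show "continuous_on ?V (\<lambda>x. - F x)" using cont by (rule continuous_on_minus)
      fix z assume "z \<in> ?V"
      then have zR: "z \<notin> R" using False V1(4) r(2) by blast
      \<comment> \<open>Outside \<open>R\<close> the inequality is only known to fail for
        arbitrarily small \<open>h\<close>; the germ lemma turns this into failure for all small
        \<open>h\<close>.\<close>
      have "dpred (\<lambda>h. c * h \<le> F (z + h *\<^sub>R b) - F z)"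
        by (intro dintros dterm_compose[OF F])
      then have "definable {h. c * h \<le> F (z + h *\<^sub>R b) - F z}" by (simp add: dpred_def)
      then obtain \<tau> where \<tau>: "\<tau> > 0" "{0<..<\<tau>} \<subseteq> {h. c * h \<le> F (z + h *\<^sub>R b) - F z} \<or>
         {0<..<\<tau>} \<inter> {h. c * h \<le> F (z + h *\<^sub>R b) - F z} = {}"
        by (rule definable_real_germ)
      have "\<not> {0<..<\<tau>} \<subseteq> {h. c * h \<le> F (z + h *\<^sub>R b) - F z}"
      proof
        assume "{0<..<\<tau>} \<subseteq> {h. c * h \<le> F (z + h *\<^sub>R b) - F z}"
        then have "z \<in> R" unfolding R_def using \<tau>(1) by (auto intro!: exI[of _ \<tau>])
        then show False using zR by simp
      qed
      then have "\<forall>h. 0 < h \<longrightarrow> h < \<tau> \<longrightarrow> - c * h \<le> - F (z + h *\<^sub>R b) - - F z"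
        using \<tau>(2) by (auto simp: disjoint_iff not_le less_imp_le)
      then show "\<exists>\<tau>>0. \<forall>h. 0 < h \<longrightarrow> h < \<tau> \<longrightarrow> - c * h \<le> - F (z + h *\<^sub>R b) - - F z"
        using \<tau>(1) by blast
    qed
    then show thesis using local r V0 V1 by (intro that[of ?V]) auto
  qed
qed

text \<open>Infinite slope throughout an open set would make the increment along one fixed segment
  exceed every bound.\<close>

lemma not_all_slopes:
  assumes F: "dterm F" and W: "open W" "W \<noteq> {}"
  shows "\<exists>x\<in>W. \<exists>c. \<not> slope_ge F b c x"
proof (rule ccontr)
  assume "\<not> ?thesis"
  then have all: "slope_ge F b c x" if "x \<in> W" for c x using that by blast
  obtain V where V: "open V" "V \<noteq> {}" "V \<subseteq> W" "continuous_on V F"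
    using generic_continuous[OF F W] by metis
  then obtain x r where r: "0 < r" "ball x r \<subseteq> V" by (meson ex_in_conv open_contains_ball)
  define t where "t = r / (norm b + 1)"
  have nb: "0 < norm b + 1" by (simp add: add_nonneg_pos)
  have t: "0 < t" using r(1) nb by (simp add: t_def)
  have "t * norm b < t * (norm b + 1)" using t by simp
  then have tb: "t * norm b < r" using nb by (simp add: t_def)
  define D where "D = F (x + t *\<^sub>R b) - F x"
  have "(\<bar>D\<bar> + 1) / t * t \<le> F (x + t *\<^sub>R b) - F x"
  proof (rule increment_ge_on_segment[OF convex_ball open_ball, of x r])
    show "continuous_on (ball x r) F" using V(4) r(2) continuous_on_subset by blast
    show "\<exists>\<tau>>0. \<forall>h. 0 < h \<longrightarrow> h < \<tau> \<longrightarrow> (\<bar>D\<bar> + 1) / t * h \<le> F (z + h *\<^sub>R b) - F z" if "z \<in> ball x r" for z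
      by (rule slope_ge_imp_right_slope, rule all) (use that r V in auto)
  qed (use r t tb in \<open>auto simp: dist_norm\<close>)
  then show False using t by (simp add: D_def[symmetric])
qed

text \<open>Where the strict partial derivative fails to exist, a rational \<open>c\<close> is
  neither a lower nor an upper slope bound, or the slopes are infinite. These are countably many
  definable sets; \<open>generic_slope\<close> and \<open>not_all_slopes\<close> forbid each of them
  to contain an open set.\<close>

lemma generic_strict_partial:
  assumes F: "dterm F" and W: "open W" "W \<noteq> {}"
  shows "\<exists>V. open V \<and> V \<noteq> {} \<and> V \<subseteq> W \<and> (\<forall>x\<in>V. strict_partial F b x)"
proof -
  have mF: "dterm (\<lambda>x. - F x)" by (rule dterm_minus[OF F])
  define Inf_ge where "Inf_ge = {x. \<forall>c. slope_ge F b c x}"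
  define Inf_le where "Inf_le = {x. \<forall>c. slope_ge (\<lambda>x. - F x) b c x}"
  \<comment> \<open>The index \<open>Inl c\<close> stands for a rational \<open>c\<close> that
    bounds the slopes on neither side; \<open>Inr\<close> numbers the three remaining
    alternatives.\<close>
  define A where "A i = (case i of Inl c \<Rightarrow> - ({x. slope_ge F b c x} \<union> {x. slope_ge (\<lambda>x. - F x) b (- c) x})
    | Inr k \<Rightarrow> [{x. strict_partial F b x}, Inf_ge, Inf_le] ! k)" for i :: "real + nat"
  have "dpred (\<lambda>x. \<forall>c. slope_ge F b c x)" "dpred (\<lambda>x. \<forall>c. slope_ge (\<lambda>x. - F x) b c x)"
    by (intro dpred_all dpred_slope_ge F mF dintros)+
  then have inf: "definable Inf_ge" "definable Inf_le" by (simp_all add: dpred_def Inf_ge_def Inf_le_def)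
  let ?I = "Inl ` \<rat> \<union> Inr ` {0, 1, 2} :: (real + nat) set"
  have "countable ?I" by (simp add: countable_rat)
  have A: "definable (A i)" if "i \<in> ?I" for i
  proof -
    have "definable (- ({x. slope_ge F b c x} \<union> {x. slope_ge (\<lambda>x. - F x) b (- c) x}))" for c
      by (intro definable_Compl definable_Un definable_slope_ge F mF)
    then show ?thesis
      using that inf definable_strict_partial[OF F] unfolding A_def by (auto simp: numeral_2_eq_2 simp del: Compl_Un)
  qed
  have "W \<subseteq> (\<Union>i\<in>?I. A i)"
  proof
    fix x assume "x \<in> W"
    consider c where "c \<in> \<rat>" "\<not> slope_ge F b c x" "\<not> slope_ge (\<lambda>x. - F x) b (- c) x"
      | "x \<in> Inf_ge" | "x \<in> Inf_le" | "strict_partial F b x"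
      using strict_partial_of_slopes[of F b x] unfolding Inf_ge_def Inf_le_def by blast
    then show "x \<in> (\<Union>i\<in>?I. A i)"
    proof cases
      case 1 then show ?thesis by (intro UN_I[of "Inl c"]) (auto simp: A_def)
    next
      case 2 then show ?thesis by (intro UN_I[of "Inr 1"]) (auto simp: A_def)
    next
      case 3 then show ?thesis by (intro UN_I[of "Inr 2"]) (auto simp: A_def)
    next
      case 4 then show ?thesis by (intro UN_I[of "Inr 0"]) (auto simp: A_def)
    qed
  qed
  from definable_countable_cover[OF A \<open>countable ?I\<close> W this]
  obtain i V where i: "i \<in> ?I" and V: "open V" "V \<noteq> {}" "V \<subseteq> W" "V \<subseteq> A i" by metis
  from i consider c where "i = Inl c" | "i = Inr 0" | "i = Inr 1" | "i = Inr 2" by auto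
  then show ?thesis
  proof cases
    case 1
    obtain V' where "open V'" "V' \<noteq> {}" "V' \<subseteq> V"
      "(\<forall>x\<in>V'. slope_ge F b c x) \<or> (\<forall>x\<in>V'. slope_ge (\<lambda>x. - F x) b (- c) x)"
      using generic_slope[OF F V(1,2)] by metis
    then show ?thesis using V(4) 1 by (fastforce simp: A_def)
  next
    case 2 then show ?thesis using V by (intro exI[of _ V]) (auto simp: A_def)
  next
    case 3 then show ?thesis using not_all_slopes[OF F V(1,2), of b] V(4) by (auto simp: A_def Inf_ge_def)
  next
    case 4 then show ?thesis using not_all_slopes[OF mF V(1,2), of b] V(4)
      by (auto simp: A_def Inf_le_def numeral_2_eq_2)
  qed
qed

theorem generic_strict_deriv:
  assumes F: "dterm F" and W: "open W" "W \<noteq> {}"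
  shows "\<exists>V. open V \<and> V \<noteq> {} \<and> V \<subseteq> W \<and> (\<forall>x\<in>V. \<exists>p. strict_deriv F x p)"
proof -
  have "\<exists>V. open V \<and> V \<noteq> {} \<and> V \<subseteq> W \<and> (\<forall>x\<in>V. \<forall>b\<in>Basis. strict_partial F b x)"
    by (rule generic_finite[OF generic_strict_partial[OF F] finite_Basis W])
  then show ?thesis using strict_deriv_of_partials by meson
qed

theorem generic_differentiable:
  fixes h :: "'a::euclidean_space \<Rightarrow> 'b::euclidean_space"
  assumes h: "dterm h" and W: "open W" "W \<noteq> {}"
  shows "\<exists>V. open V \<and> V \<noteq> {} \<and> V \<subseteq> W \<and> (\<forall>x\<in>V. h differentiable (at x))"
proof -
  have "\<exists>V. open V \<and> V \<noteq> {} \<and> V \<subseteq> W \<and> (\<forall>x\<in>V. \<forall>b\<in>Basis. \<exists>p. strict_deriv (\<lambda>x. h x \<bullet> b) x p)"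
    by (rule generic_finite[OF generic_strict_deriv[OF dterm_inner_const[OF h]] finite_Basis W])
  moreover have "h differentiable (at x)" if "\<forall>b\<in>Basis. \<exists>p. strict_deriv (\<lambda>x. h x \<bullet> b) x p" for x
  proof -
    have "\<forall>b\<in>Basis. (\<lambda>x. h x \<bullet> b) differentiable (at x)"
      using that strict_deriv_has_derivative unfolding differentiable_def by meson
    then show ?thesis using differentiable_componentwise_within[of h x UNIV] by simp
  qed
  ultimately show ?thesis by meson
qed

lemma definable_strict_deriv:
  assumes F: "dterm F" shows "dpred (\<lambda>z. strict_deriv F (fst z) (snd z))"
  unfolding strict_deriv_def by (intro dintros dterm_compose[OF F])

end

subsection \<open>Gradient steps and null sets of initial points\<close>

text \<open>Such an \<open>\<alpha>\<close> is nonzero with \<open>inverse \<alpha>\<close> an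
  eigenvalue of \<open>L\<close>, and eigenvectors for distinct eigenvalues are independent.\<close>

lemma finite_characteristic_values:
  fixes L :: "'a::euclidean_space \<Rightarrow> 'a"
  assumes L: "linear L"
  shows "finite {\<alpha>. \<exists>v. v \<noteq> 0 \<and> v = \<alpha> *\<^sub>R L v}"
proof (rule ccontr)
  assume "infinite {\<alpha>. \<exists>v. v \<noteq> 0 \<and> v = \<alpha> *\<^sub>R L v}"
  then obtain A where A: "finite A" "card A = Suc DIM('a)" "A \<subseteq> {\<alpha>. \<exists>v. v \<noteq> 0 \<and> v = \<alpha> *\<^sub>R L v}"
    using infinite_arbitrarily_large by blast
  have "\<forall>\<alpha>\<in>A. \<exists>v. v \<noteq> 0 \<and> v = \<alpha> *\<^sub>R L v" using A(3) by blast
  then obtain v where v: "\<And>\<alpha>. \<alpha> \<in> A \<Longrightarrow> v \<alpha> \<noteq> 0 \<and> v \<alpha> = \<alpha> *\<^sub>R L (v \<alpha>)" by metis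
  have eig: "L (v \<alpha>) = inverse \<alpha> *\<^sub>R v \<alpha>" "\<alpha> \<noteq> 0" "v \<alpha> \<noteq> 0" if "\<alpha> \<in> A" for \<alpha>
  proof -
    show "\<alpha> \<noteq> 0" "v \<alpha> \<noteq> 0" using v[OF that] by (metis scale_zero_left)+
    then show "L (v \<alpha>) = inverse \<alpha> *\<^sub>R v \<alpha>"
      using v[OF that] by (metis scaleR_scaleR left_inverse scaleR_one)
  qed
  have indep: "\<forall>\<alpha>\<in>B. c \<alpha> = 0" if "finite B" "B \<subseteq> A" "(\<Sum>\<alpha>\<in>B. c \<alpha> *\<^sub>R v \<alpha>) = 0" for B c
    using that
  proof (induction B arbitrary: c rule: finite_induct)
    case (insert \<beta> B)
    \<comment> \<open>Applying \<open>L\<close> minus \<open>inverse \<beta>\<close> times the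
      identity to the relation removes the term of \<open>\<beta>\<close>.\<close>
    have "(\<Sum>\<alpha>\<in>insert \<beta> B. (c \<alpha> * (inverse \<alpha> - inverse \<beta>)) *\<^sub>R v \<alpha>)
      = (\<Sum>\<alpha>\<in>insert \<beta> B. c \<alpha> *\<^sub>R L (v \<alpha>) - inverse \<beta> *\<^sub>R (c \<alpha> *\<^sub>R v \<alpha>))"
      by (intro sum.cong refl) (use insert.prems(1) eig(1) in \<open>auto simp: algebra_simps subset_iff\<close>)
    also have "\<dots> = L (\<Sum>\<alpha>\<in>insert \<beta> B. c \<alpha> *\<^sub>R v \<alpha>) - inverse \<beta> *\<^sub>R (\<Sum>\<alpha>\<in>insert \<beta> B. c \<alpha> *\<^sub>R v \<alpha>)"
      by (simp only: sum_subtractf linear_sum[OF L] linear_cmul[OF L] scaleR_sum_right)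
    also have "\<dots> = 0" by (simp only: insert.prems(2) linear_0[OF L] scaleR_zero_right diff_self)
    finally have "(\<Sum>\<alpha>\<in>B. (c \<alpha> * (inverse \<alpha> - inverse \<beta>)) *\<^sub>R v \<alpha>) = 0"
      using insert.hyps by simp
    then have z: "\<forall>\<alpha>\<in>B. c \<alpha> * (inverse \<alpha> - inverse \<beta>) = 0"
      using insert.IH[of "\<lambda>\<alpha>. c \<alpha> * (inverse \<alpha> - inverse \<beta>)"] insert.prems(1) by simp
    have cB: "c \<alpha> = 0" if "\<alpha> \<in> B" for \<alpha>
      using bspec[OF z that] that insert.hyps(2) by (auto simp: inverse_eq_iff_eq)
    then have "(\<Sum>\<alpha>\<in>B. c \<alpha> *\<^sub>R v \<alpha>) = 0" by (intro sum.neutral) simp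
    then have "c \<beta> *\<^sub>R v \<beta> = 0" using insert.prems(2) insert.hyps by simp
    then have "c \<beta> = 0" using eig(3)[of \<beta>] insert.prems(1) by simp
    then show ?case using cB by simp
  qed simp
  have inj: "inj_on v A"
  proof (rule inj_onI)
    fix \<alpha> \<beta> assume ab: "\<alpha> \<in> A" "\<beta> \<in> A" "v \<alpha> = v \<beta>"
    then have "inverse \<alpha> *\<^sub>R v \<alpha> = inverse \<beta> *\<^sub>R v \<alpha>" using eig(1) by metis
    then show "\<alpha> = \<beta>" using eig(3)[OF ab(1)] by simp
  qed
  have "independent (v ` A)"
  proof (rule independent_if_scalars_zero)
    fix c x assume c: "(\<Sum>x\<in>v ` A. c x *\<^sub>R x) = 0" and x: "x \<in> v ` A"
    then have "(\<Sum>\<alpha>\<in>A. c (v \<alpha>) *\<^sub>R v \<alpha>) = 0" using sum.reindex[OF inj, of "\<lambda>x. c x *\<^sub>R x"] by simp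
    then show "c x = 0" using indep[OF A(1) order_refl, of "\<lambda>\<alpha>. c (v \<alpha>)"] x by auto
  qed (use A(1) in simp)
  then have "card (v ` A) \<le> DIM('a)" using independent_bound by blast
  then show False using card_image[OF inj] A(2) by simp
qed

text \<open>The two-point estimate makes the difference quotients converge as base point and step
  vary together, so the upper limit is the limit \<open>p \<bullet> d\<close>, linear in
  \<open>d\<close>.\<close>

lemma clarke_subdiff_strict_deriv:
  fixes f :: "'a::euclidean_space \<Rightarrow> real"
  assumes "strict_deriv f x p" shows "clarke_subdiff f x = {p}"
proof -
  have "clarke_derivative f x d = ereal (p \<bullet> d)" for d
  proof -
    have "((\<lambda>(y, t). (f (y + t *\<^sub>R d) - f y) / t) \<longlongrightarrow> p \<bullet> d) (nhds x \<times>\<^sub>F at_right 0)"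
      unfolding tendsto_iff
    proof (intro allI impI)
      fix e :: real assume e: "0 < e"
      have nd: "0 < norm d + 1" by (simp add: add_nonneg_pos)
      then have "0 < e / (norm d + 1)" using e by simp
      then obtain r where r: "0 < r" "\<And>y z. dist x y < r \<Longrightarrow> dist x z < r \<Longrightarrow>
        \<bar>f y - f z - p \<bullet> (y - z)\<bar> \<le> e / (norm d + 1) * norm (y - z)"
        using assms unfolding strict_deriv_def by blast
      have "eventually (\<lambda>y. dist x y < r / 2) (nhds x)"
        using eventually_nhds_ball[of "r / 2" x] r(1) by simp
      moreover have "eventually (\<lambda>t. 0 < t \<and> t < r / (2 * (norm d + 1))) (at_right (0::real))"
        using eventually_at_right_real[of 0 "r / (2 * (norm d + 1))"] r(1) nd by simp
      ultimately have "eventually (\<lambda>(y, t). dist x y < r / 2 \<and> 0 < t \<and> t < r / (2 * (norm d + 1)))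
         (nhds x \<times>\<^sub>F at_right 0)"
        unfolding eventually_prod_filter by (auto simp: case_prod_beta')
      then show "eventually (\<lambda>z. dist (case z of (y, t) \<Rightarrow> (f (y + t *\<^sub>R d) - f y) / t) (p \<bullet> d) < e)
         (nhds x \<times>\<^sub>F at_right 0)"
      proof (rule eventually_mono, clarify)
        fix y t assume y: "dist x y < r / 2" and t: "(0::real) < t" "t < r / (2 * (norm d + 1))"
        have td: "t * (norm d + 1) < r / 2" using t nd by (simp add: field_simps)
        have "t * norm d \<le> t * (norm d + 1)" using t(1) by simp
        then have "dist x (y + t *\<^sub>R d) < r"
          using norm_triangle_ineq4[of "x - y" "t *\<^sub>R d"] y td t(1) by (simp add: dist_norm algebra_simps)
        moreover have "dist x y < r" using y r(1) by simp
        ultimately have "\<bar>f (y + t *\<^sub>R d) - f y - p \<bullet> (t *\<^sub>R d)\<bar> \<le> e / (norm d + 1) * norm (t *\<^sub>R d)"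
          using r(2)[of "y + t *\<^sub>R d" y] by simp
        also have "\<dots> < e * t"
          using t(1) e nd by (simp add: field_simps)
        finally have "\<bar>f (y + t *\<^sub>R d) - f y - t * (p \<bullet> d)\<bar> < e * t" by simp
        moreover have "(f (y + t *\<^sub>R d) - f y) / t - p \<bullet> d = (f (y + t *\<^sub>R d) - f y - t * (p \<bullet> d)) / t"
          using t(1) by (simp add: diff_divide_distrib)
        ultimately show "dist ((f (y + t *\<^sub>R d) - f y) / t) (p \<bullet> d) < e"
          using t(1) by (simp add: dist_real_def pos_divide_less_eq)
      qed
    qed
    then have "((\<lambda>(y, t). ereal ((f (y + t *\<^sub>R d) - f y) / t)) \<longlongrightarrow> ereal (p \<bullet> d)) (nhds x \<times>\<^sub>F at_right 0)"
      by (simp add: case_prod_beta')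
    then show ?thesis
      unfolding clarke_derivative_def
      by (intro lim_imp_Limsup) (auto simp: prod_filter_eq_bot)
  qed
  then have "clarke_subdiff f x = {s. \<forall>d. s \<bullet> d \<le> p \<bullet> d}" by (simp add: clarke_subdiff_def)
  also have "\<dots> = {p}"
  proof (intro set_eqI iffI)
    fix s assume "s \<in> {s. \<forall>d. s \<bullet> d \<le> p \<bullet> d}"
    then have "s \<bullet> (s - p) \<le> p \<bullet> (s - p)" by blast
    then have "(s - p) \<bullet> (s - p) \<le> 0" by (simp add: inner_diff_left)
    then have "(s - p) \<bullet> (s - p) = 0" using inner_ge_zero[of "s - p"] by linarith
    then show "s \<in> {p}" by simp
  qed simp
  finally show ?thesis .
qed

lemma strict_deriv_cong:
  assumes "strict_deriv F x p" "open W" "x \<in> W" "\<And>y. y \<in> W \<Longrightarrow> F y = f y"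
  shows "strict_deriv f x p"
  unfolding strict_deriv_def
proof (intro allI impI)
  fix e :: real assume "0 < e"
  then obtain d where d: "0 < d" "\<And>y z. dist x y < d \<Longrightarrow> dist x z < d \<Longrightarrow>
     \<bar>F y - F z - p \<bullet> (y - z)\<bar> \<le> e * norm (y - z)"
    using assms(1) unfolding strict_deriv_def by blast
  obtain r where r: "0 < r" "ball x r \<subseteq> W" using openE[OF assms(2,3)] by blast
  show "\<exists>d. 0 < d \<and> (\<forall>y z. dist x y < d \<longrightarrow> dist x z < d \<longrightarrow> \<bar>f y - f z - p \<bullet> (y - z)\<bar> \<le> e * norm (y - z))"
  proof (intro exI[of _ "min d r"] conjI allI impI)
    show "0 < min d r" using d(1) r(1) by simp
    fix y z assume yz: "dist x y < min d r" "dist x z < min d r"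
    then have "y \<in> W" "z \<in> W" using r(2) by auto
    then show "\<bar>f y - f z - p \<bullet> (y - z)\<bar> \<le> e * norm (y - z)" using d(2)[of y z] yz assms(4) by simp
  qed
qed

definition strict_gradient :: "('a::euclidean_space \<Rightarrow> real) \<Rightarrow> 'a \<Rightarrow> 'a" where
  "strict_gradient F x = (if \<exists>p. strict_deriv F x p then THE p. strict_deriv F x p else 0)"

definition strict_domain :: "('a::euclidean_space \<Rightarrow> real) \<Rightarrow> 'a set" where
  "strict_domain F = {x. \<exists>p. strict_deriv F x p}"

lemma strict_gradient_eq: "strict_deriv F x p \<Longrightarrow> strict_gradient F x = p"
  unfolding strict_gradient_def using strict_deriv_unique by (metis the_equality)

lemma strict_deriv_gradient: "x \<in> strict_domain F \<Longrightarrow> strict_deriv F x (strict_gradient F x)"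
  unfolding strict_domain_def using strict_gradient_eq by fastforce

text \<open>Near \<open>y\<close> both expansions, the one at \<open>x\<close> and the one at
  \<open>y\<close>, describe the same increment. Testing it in the direction of the difference of
  the two gradients bounds that difference.\<close>

lemma continuous_on_strict_gradient:
  assumes W: "open W" "W \<subseteq> strict_domain F"
  shows "continuous_on W (strict_gradient F)"
  unfolding continuous_on_iff
proof (intro ballI allI impI)
  fix x and e :: real assume x: "x \<in> W" and e: "0 < e"
  let ?g = "strict_gradient F"
  have e3: "0 < e / 3" using e by simp
  have "strict_deriv F x (?g x)" using x W(2) strict_deriv_gradient by blast
  then obtain d where d: "0 < d" "\<And>y z. dist x y < d \<Longrightarrow> dist x z < d \<Longrightarrow>
     \<bar>F y - F z - ?g x \<bullet> (y - z)\<bar> \<le> e / 3 * norm (y - z)"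
    using e3 unfolding strict_deriv_def by blast
  show "\<exists>d>0. \<forall>x'\<in>W. dist x' x < d \<longrightarrow> dist (?g x') (?g x) < e"
  proof (intro exI[of _ d] conjI ballI impI d(1))
    fix y assume y: "y \<in> W" "dist y x < d"
    have "strict_deriv F y (?g y)" using y W(2) strict_deriv_gradient by blast
    then obtain d' where d': "0 < d'" "\<And>u v. dist y u < d' \<Longrightarrow> dist y v < d' \<Longrightarrow>
      \<bar>F u - F v - ?g y \<bullet> (u - v)\<bar> \<le> e / 3 * norm (u - v)"
      using e3 unfolding strict_deriv_def by blast
    define r where "r = min d' (d - dist y x)"
    have r: "0 < r" "r \<le> d'" "r \<le> d - dist y x" using d'(1) y(2) by (auto simp: r_def)
    define w where "w = ?g y - ?g x"
    \<comment> \<open>Short enough for \<open>y + s *\<^sub>R w\<close> to lie in both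
      neighbourhoods.\<close>
    define s where "s = r / (norm w + 1)"
    have nw: "0 < norm w + 1" by (simp add: add_nonneg_pos)
    have s: "0 < s" using r nw by (simp add: s_def)
    have "s * norm w < s * (norm w + 1)" using s by simp
    also have "\<dots> = r" using nw by (simp add: s_def)
    finally have sw: "norm (s *\<^sub>R w) < r" using s by simp
    have "dist x (y + s *\<^sub>R w) \<le> dist y x + norm (s *\<^sub>R w)"
      using norm_triangle_ineq4[of "x - y" "s *\<^sub>R w"] by (simp add: dist_norm norm_minus_commute algebra_simps)
    then have "\<bar>F (y + s *\<^sub>R w) - F y - ?g x \<bullet> (s *\<^sub>R w)\<bar> \<le> e / 3 * norm (s *\<^sub>R w)"
      using d(2)[of "y + s *\<^sub>R w" y] sw r(3) y(2) by (simp add: dist_commute)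
    moreover have "\<bar>F (y + s *\<^sub>R w) - F y - ?g y \<bullet> (s *\<^sub>R w)\<bar> \<le> e / 3 * norm (s *\<^sub>R w)"
      using d'(2)[of "y + s *\<^sub>R w" y] sw r(2) d'(1) by (simp add: dist_norm)
    ultimately have "\<bar>?g y \<bullet> (s *\<^sub>R w) - ?g x \<bullet> (s *\<^sub>R w)\<bar> \<le> 2 * e / 3 * norm (s *\<^sub>R w)" by linarith
    moreover have "?g y \<bullet> (s *\<^sub>R w) - ?g x \<bullet> (s *\<^sub>R w) = w \<bullet> (s *\<^sub>R w)"
      by (simp only: w_def inner_diff_left)
    moreover have "w \<bullet> (s *\<^sub>R w) = s * (norm w * norm w)"
      by (simp add: dot_square_norm power2_eq_square)
    ultimately have "s * (norm w * norm w) \<le> 2 * e / 3 * (s * norm w)" using s by simp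
    then have "norm w * (s * norm w) \<le> (2 * e / 3) * (s * norm w)" by (simp add: algebra_simps)
    then have "norm w \<le> 2 * e / 3 \<or> s * norm w = 0" using s by (auto simp: mult_le_cancel_right)
    then have "norm w < e" using e s by auto
    then show "dist (?g y) (?g x) < e" by (simp add: dist_norm w_def)
  qed
qed

definition gradient_step :: "('a::euclidean_space \<Rightarrow> real) \<Rightarrow> real \<Rightarrow> 'a \<Rightarrow> 'a" where
  "gradient_step F \<alpha> x = x - \<alpha> *\<^sub>R strict_gradient F x"

text \<open>Its negation lets emptiness of the interior be pulled back under the step. Balls instead
  of general open sets keep the condition first-order in \<open>\<alpha>\<close>.\<close>

definition degenerate_step :: "('a::euclidean_space \<Rightarrow> real) \<Rightarrow> real \<Rightarrow> bool" where
  "degenerate_step F \<alpha> \<longleftrightarrow> (\<exists>x r. 0 < r \<and> ball x r \<subseteq> strict_domain F \<and>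
     interior (gradient_step F \<alpha> ` ball x r) = {})"

text \<open>The points that reach \<open>Z\<close> in at most \<open>k\<close> gradient steps, each
  taken from a point of strict differentiability.\<close>

fun hitting_set :: "('a::euclidean_space \<Rightarrow> real) \<Rightarrow> real \<Rightarrow> 'a set \<Rightarrow> nat \<Rightarrow> 'a set" where
  "hitting_set F \<alpha> Z 0 = Z"
| "hitting_set F \<alpha> Z (Suc k) = Z \<union> (strict_domain F \<inter> gradient_step F \<alpha> -` hitting_set F \<alpha> Z k)"

text \<open>The derivative of the step at \<open>x\<close> is the identity minus
  \<open>\<alpha>\<close> times \<open>L\<close>, injective by the choice of
  \<open>\<alpha>\<close>. Sussmann's open mapping theorem asks for continuity on \<open>W\<close>
  and a derivative with right inverse at the single point \<open>x\<close>.\<close>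

lemma image_gradient_step_interior:
  assumes W: "open W" "x \<in> W" "W \<subseteq> strict_domain F"
    and D: "(strict_gradient F has_derivative L) (at x)"
    and \<alpha>: "\<alpha> \<notin> {\<alpha>. \<exists>v. v \<noteq> 0 \<and> v = \<alpha> *\<^sub>R L v}"
  shows "interior (gradient_step F \<alpha> ` W) \<noteq> {}"
proof -
  have L: "linear L" using D has_derivative_linear by blast
  let ?K = "\<lambda>v. v - \<alpha> *\<^sub>R L v"
  have K: "linear ?K"
    using L by (intro linearI) (auto simp: linear_add linear_cmul algebra_simps)
  have "inj ?K"
    unfolding linear_injective_0[OF K] using \<alpha> by auto
  then obtain K' where K': "linear K'" "\<forall>x. K' (?K x) = x" "\<forall>x. ?K (K' x) = x"
    using linear_injective_isomorphism[OF K] by blast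
  have "gradient_step F \<alpha> x \<in> interior (gradient_step F \<alpha> ` W)"
  proof (rule sussmann_open_mapping[OF W(1) _ W(2), of _ ?K K'])
    show "continuous_on W (gradient_step F \<alpha>)"
      unfolding gradient_step_def[abs_def]
      by (intro continuous_intros continuous_on_strict_gradient W(1,3))
    show "(gradient_step F \<alpha> has_derivative ?K) (at x)"
      unfolding gradient_step_def[abs_def] by (intro derivative_intros D)
    show "bounded_linear K'" using K'(1) by (simp add: linear_conv_bounded_linear)
    show "?K \<circ> K' = id" using K'(3) by auto
  qed (use W in \<open>auto simp: interior_open\<close>)
  then show ?thesis by blast
qed

text \<open>The first-order form needed for \<open>definable_degenerate_steps\<close>.\<close>

lemma interior_empty_iff:
  "interior A = {} \<longleftrightarrow> (\<forall>z s. 0 < s \<longrightarrow> (\<exists>z'. dist z z' < s \<and> z' \<notin> A))"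
proof -
  have "z \<in> interior A \<longleftrightarrow> (\<exists>s>0. \<forall>z'. dist z z' < s \<longrightarrow> z' \<in> A)" for z
    by (simp add: mem_interior subset_iff)
  then show ?thesis by blast
qed

lemma coordinate_basis_graph:
  fixes bs :: "'a::euclidean_space list"
  assumes "coordinate_basis bs"
  shows "coordinate_basis (map (\<lambda>b. (b, 0)) bs @ [(0, 1 :: real)])"
proof -
  let ?cs = "map (\<lambda>b. (b, 0)) bs @ [(0, 1 :: real)]"
  have bs: "distinct bs" "independent (set bs)" "span (set bs) = UNIV"
    using assms by (auto simp: coordinate_basis_def)
  have dist: "distinct ?cs" using bs(1) by (auto simp: distinct_map inj_on_def)
  have sp: "span (set ?cs) = UNIV"
  proof -
    have lin: "linear (\<lambda>b::'a. (b, 0::real))" by (auto intro!: linearI)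
    have 1: "(x, 0) \<in> span (set ?cs)" for x :: 'a
    proof -
      have "(x, 0) \<in> (\<lambda>b. (b, 0::real)) ` span (set bs)" using bs(3) by simp
      then have "(x, 0) \<in> span ((\<lambda>b. (b, 0::real)) ` set bs)" using linear_span_image[OF lin] by blast
      then show ?thesis using span_mono[of "(\<lambda>b. (b, 0::real)) ` set bs" "set ?cs"] by auto
    qed
    have "(x, t) \<in> span (set ?cs)" for x :: 'a and t :: real
    proof -
      have "t *\<^sub>R (0, 1) \<in> span (set ?cs)" by (intro span_scale span_base) auto
      from span_add[OF 1[of x] this] show ?thesis by simp
    qed
    then show ?thesis by auto
  qed
  have "length bs = DIM('a)"
    using bs dim_eq_card_independent[of "set bs"] dim_span[of "set bs"] by (simp add: distinct_card)
  then have "card (set ?cs) = DIM('a \<times> real)" using distinct_card[OF dist] by simp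
  then have "independent (set ?cs)"
    by (intro card_le_dim_spanning[of _ UNIV]) (use sp in auto)
  then show ?thesis using dist sp by (simp add: coordinate_basis_def)
qed

lemma locally_lipschitz_isCont:
  assumes "locally_lipschitz f" shows "isCont f x"
proof -
  obtain r L where r: "0 < r" "L-lipschitz_on (ball x r) f"
    using assms unfolding locally_lipschitz_def by blast
  then have "continuous_on (ball x r) f" using lipschitz_on_continuous_on by blast
  then show ?thesis using r(1) by (simp add: continuous_on_eq_continuous_at)
qed

section \<open>Exceptional step sizes and exceptional initial points\<close>

context o_minimal
begin

text \<open>By continuity the graph over a small ball fits into one ball of the product space, where
  tameness applies; extension by 0 makes the piece a globally definable function.\<close>

lemma tame_local_dterm:
  fixes f :: "'a::euclidean_space \<Rightarrow> real"
  assumes "coordinate_basis bs" "tame_fun Om bs f" "locally_lipschitz f"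
  obtains r where "0 < r" "dterm (\<lambda>y. if y \<in> ball x r then f y else 0)"
proof -
  obtain r where r: "0 < r" "\<And>y. dist y x < r \<Longrightarrow> dist (f y) (f x) < 1"
    using locally_lipschitz_isCont[OF assms(3), of x] unfolding continuous_at_eps_delta
    by (metis zero_less_one)
  \<comment> \<open>The radius \<open>r + 1\<close> allows \<open>r\<close> for the argument and 1
    for the value.\<close>
  let ?G = "{(y, f y) |y. True} \<inter> cball (x, f x) (r + 1)"
  have "definable ?G"
    by (rule definableI[OF coordinate_basis_graph[OF assms(1)]])
      (use assms(2) r(1) in \<open>simp add: tame_fun_def tame_set_def\<close>)
  moreover have "definable {z :: 'a \<times> real. fst z \<in> ball x r}"
    using dpred_mem[OF definable_ball dterm_fst[OF dterm_id]] by (simp add: dpred_def)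
  ultimately have "definable (?G \<inter> {z. fst z \<in> ball x r})" by (rule definable_Int)
  moreover have "?G \<inter> {z. fst z \<in> ball x r} = {(y, t). y \<in> ball x r \<and> t = f y}"
  proof -
    have "dist (x, f x) (y, f y) \<le> r + 1" if "dist x y < r" for y
    proof -
      have "dist (x, f x) (y, f y) \<le> dist x y + dist (f x) (f y)"
        unfolding dist_prod_def by (simp add: sqrt_sum_squares_le_sum)
      then show ?thesis using r(2)[of y] that by (simp add: dist_commute)
    qed
    then show ?thesis by auto
  qed
  ultimately have "dpred (\<lambda>z. fst z \<in> ball x r \<and> snd z = f (fst z))"
    by (simp add: dpred_def case_prod_beta')
  then have "dpred (\<lambda>z. (fst z \<in> ball x r \<and> snd z = f (fst z)) \<or> (\<not> fst z \<in> ball x r \<and> snd z = 0))"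
    by (rule dpred_disj[OF _ dpred_conj[OF dpred_not[OF dpred_mem[OF definable_ball dterm_fst[OF dterm_id]]]
          dpred_eq[OF dterm_snd[OF dterm_id] dterm_const]]])
  then have "dterm (\<lambda>y. if y \<in> ball x r then f y else 0)"
    by (rule dterm_relation[where R = "\<lambda>y t. (y \<in> ball x r \<and> t = f y) \<or> (\<not> y \<in> ball x r \<and> t = 0)"]) auto
  then show thesis using r(1) that by blast
qed

context
  fixes F :: "'a::euclidean_space \<Rightarrow> real"
  assumes F: "dterm F"
begin

lemma definable_strict_domain: "definable (strict_domain F)"
proof -
  have "dpred (\<lambda>x. \<exists>p. strict_deriv F x p)" by (rule dpred_ex[OF definable_strict_deriv[OF F]])
  then show ?thesis by (simp add: dpred_def strict_domain_def)
qed

lemma interior_Compl_strict_domain: "interior (- strict_domain F) = {}"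
proof (rule ccontr)
  assume "interior (- strict_domain F) \<noteq> {}"
  from generic_strict_deriv[OF F open_interior this]
  obtain V where V: "V \<noteq> {}" "V \<subseteq> interior (- strict_domain F)" "V \<subseteq> strict_domain F"
    unfolding strict_domain_def by blast
  then show False using interior_subset by blast
qed

lemma dterm_strict_gradient: "dterm (strict_gradient F)"
proof (rule dterm_relation[where R = "\<lambda>x y. strict_deriv F x y \<or> (x \<notin> strict_domain F \<and> y = 0)"])
  show "dpred (\<lambda>z. strict_deriv F (fst z) (snd z) \<or> (fst z \<notin> strict_domain F \<and> snd z = 0))"
    by (intro dintros definable_strict_deriv F dpred_mem definable_strict_domain)
  show "(strict_deriv F x y \<or> (x \<notin> strict_domain F \<and> y = 0)) = (y = strict_gradient F x)" for x y
    using strict_gradient_eq[of F x] strict_deriv_gradient[of x F]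
    by (auto simp: strict_domain_def strict_gradient_def)
qed

lemma definable_degenerate_steps: "definable {\<alpha>. 0 < \<alpha> \<and> degenerate_step F \<alpha>}"
proof -
  have eq: "degenerate_step F \<alpha> \<longleftrightarrow> (\<exists>x r. 0 < r \<and> (\<forall>w. dist x w < r \<longrightarrow> w \<in> strict_domain F) \<and>
    (\<forall>z s. 0 < s \<longrightarrow> (\<exists>z'. dist z z' < s \<and> \<not> (\<exists>w. dist x w < r \<and> z' = w - \<alpha> *\<^sub>R strict_gradient F w))))" for \<alpha>
    unfolding degenerate_step_def interior_empty_iff by (simp add: subset_iff image_iff gradient_step_def Bex_def)
  have "dpred (\<lambda>\<alpha>. 0 < \<alpha> \<and> (\<exists>x r. 0 < r \<and> (\<forall>w. dist x w < r \<longrightarrow> w \<in> strict_domain F) \<and>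
    (\<forall>z s. 0 < s \<longrightarrow> (\<exists>z'. dist z z' < s \<and> \<not> (\<exists>w. dist x w < r \<and> z' = w - \<alpha> *\<^sub>R strict_gradient F w)))))"
    by (intro dintros dpred_mem[OF definable_strict_domain] dterm_compose[OF dterm_strict_gradient])
  then show ?thesis unfolding eq by (simp add: dpred_def)
qed

theorem finite_degenerate_steps: "finite {\<alpha>. 0 < \<alpha> \<and> degenerate_step F \<alpha>}"
proof (rule ccontr)
  let ?A = "{\<alpha>. 0 < \<alpha> \<and> degenerate_step F \<alpha>}"
  assume "infinite ?A"
  then have "interior ?A \<noteq> {}"
    using definable_real_finite_or_interior[OF definable_degenerate_steps] by blast
  then have unc: "uncountable ?A"
    by (metis countable_subset ex_in_conv mem_interior uncountable_ball)
  \<comment> \<open>Balls form an uncountable family; passing to members of a countable base lets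
    uncountably many \<open>\<alpha>\<close> share one open set.\<close>
  obtain B :: "'a set set" where B: "countable B" "topological_basis B"
    using ex_countable_basis by blast
  define B' where "B' = {W \<in> B. W \<noteq> {} \<and> W \<subseteq> strict_domain F}"
  define AW where "AW W = {\<alpha>. interior (gradient_step F \<alpha> ` W) = {}}" for W
  have "?A \<subseteq> (\<Union>W\<in>B'. AW W)"
  proof
    fix \<alpha> assume "\<alpha> \<in> ?A"
    then obtain x r where xr: "0 < r" "ball x r \<subseteq> strict_domain F" "interior (gradient_step F \<alpha> ` ball x r) = {}"
      unfolding degenerate_step_def by blast
    obtain W where W: "W \<in> B" "x \<in> W" "W \<subseteq> ball x r"
      using topological_basisE[OF B(2) open_ball, of x x r] xr(1) by auto
    have "interior (gradient_step F \<alpha> ` W) \<subseteq> interior (gradient_step F \<alpha> ` ball x r)"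
      using W(3) by (intro interior_mono image_mono)
    then show "\<alpha> \<in> (\<Union>W\<in>B'. AW W)" using W xr by (auto simp: B'_def AW_def)
  qed
  moreover have "countable B'" using B(1) by (simp add: B'_def)
  ultimately obtain W where W: "W \<in> B'" "uncountable (AW W)"
    using unc by (metis countable_UN countable_subset)
  have Wo: "open W" "W \<noteq> {}" "W \<subseteq> strict_domain F"
    using W(1) topological_basis_open[OF B(2)] by (auto simp: B'_def)
  obtain x where x: "x \<in> W" "strict_gradient F differentiable (at x)"
    using generic_differentiable[OF dterm_strict_gradient Wo(1,2)] by blast
  then obtain L where L: "(strict_gradient F has_derivative L) (at x)" unfolding differentiable_def by blast
  have "finite {\<alpha>. \<exists>v. v \<noteq> 0 \<and> v = \<alpha> *\<^sub>R L v}"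
    by (rule finite_characteristic_values[OF has_derivative_linear[OF L]])
  then have "\<not> AW W \<subseteq> {\<alpha>. \<exists>v. v \<noteq> 0 \<and> v = \<alpha> *\<^sub>R L v}"
    using W(2) countable_finite finite_subset by blast
  then obtain \<alpha> where "\<alpha> \<in> AW W" "\<alpha> \<notin> {\<alpha>. \<exists>v. v \<noteq> 0 \<and> v = \<alpha> *\<^sub>R L v}" by blast
  then show False using image_gradient_step_interior[OF Wo(1) x(1) Wo(3) L] by (simp add: AW_def)
qed

text \<open>The induction carries definability and empty interior, the two properties that a
  nondegenerate step pulls back; nullness follows from them.\<close>

lemma hitting_set_negligible:
  assumes Z: "definable Z" "interior Z = {}" and \<alpha>: "\<not> degenerate_step F \<alpha>"
  shows "negligible (hitting_set F \<alpha> Z k)"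
proof -
  have "definable (hitting_set F \<alpha> Z k) \<and> interior (hitting_set F \<alpha> Z k) = {}"
  proof (induction k)
    case (Suc k)
    let ?Y = "strict_domain F \<inter> gradient_step F \<alpha> -` hitting_set F \<alpha> Z k"
    have "dpred (\<lambda>x. x - \<alpha> *\<^sub>R strict_gradient F x \<in> hitting_set F \<alpha> Z k)"
      using Suc by (intro dpred_mem dintros dterm_compose[OF dterm_strict_gradient]) auto
    then have Y: "definable ?Y"
      by (intro definable_Int definable_strict_domain) (simp add: dpred_def vimage_def gradient_step_def)
    have "interior ?Y = {}"
    proof (rule ccontr)
      assume "interior ?Y \<noteq> {}"
      then obtain x r where r: "0 < r" "ball x r \<subseteq> ?Y" by (meson ex_in_conv mem_interior)
      then have "interior (gradient_step F \<alpha> ` ball x r) \<subseteq> interior (hitting_set F \<alpha> Z k)"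
        by (intro interior_mono) auto
      then have "degenerate_step F \<alpha>" unfolding degenerate_step_def using r Suc by blast
      then show False using \<alpha> by blast
    qed
    then show ?case
      using definable_Un[OF Z(1) Y] definable_Un_interior[OF Z] by (simp only: hitting_set.simps simp_thms)
  qed (use Z in simp)
  then show ?thesis using definable_negligible by blast
qed

end

text \<open>A trapped sequence is followed backwards from a visit to \<open>S\<close>: the visited
  point lies in \<open>Z\<close>, and each earlier point either lies in \<open>Z\<close> too or was
  moved by the single-valued gradient step, so the initial point is in a hitting set.
  \<open>Z\<close> is also the exceptional set of the later gradient estimates.\<close>

theorem subgradient_avoids_critical_points:
  fixes f :: "'a::euclidean_space \<Rightarrow> real"
  assumes F: "dterm F" "\<And>y. y \<in> ball xs r \<Longrightarrow> F y = f y"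
    and S: "S = {x. 0 \<in> clarke_subdiff f x}" "interior (S \<inter> ball xs r) = {}"
  obtains Z where "definable Z" "interior Z = {}"
    "\<And>y. y \<in> ball xs r - Z \<Longrightarrow> y \<notin> S \<and> (\<exists>p. strict_deriv f y p)"
    "\<And>\<epsilon>. \<epsilon> < r \<Longrightarrow> finite {\<alpha>. 0 < \<alpha> \<and> \<not> (AE x0 in lebesgue. \<forall>x. subgradient_sequence f \<alpha> x \<and> x 0 = x0 \<and>
       (\<forall>k. x k \<in> cball xs \<epsilon>) \<longrightarrow> (\<forall>k. x k \<notin> S))}"
proof -
  let ?g = "strict_gradient F"
  \<comment> \<open>Only critical points with a strict derivative are collected here, which is
    definable at once; all other critical points in the ball lie outside
    \<open>strict_domain F\<close> anyway.\<close>
  define Y where "Y = {y. y \<in> strict_domain F \<and> y \<in> ball xs r \<and> ?g y = 0}"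
  define Z where "Z = - strict_domain F \<union> Y"
  have fd: "strict_deriv f y (?g y)" "clarke_subdiff f y = {?g y}" if "y \<in> strict_domain F" "y \<in> ball xs r" for y
  proof -
    show "strict_deriv f y (?g y)"
      by (rule strict_deriv_cong[OF strict_deriv_gradient[OF that(1)] open_ball that(2) F(2)])
    then show "clarke_subdiff f y = {?g y}" by (rule clarke_subdiff_strict_deriv)
  qed
  have "dpred (\<lambda>y. y \<in> strict_domain F \<and> y \<in> ball xs r \<and> ?g y = 0)"
    by (intro dpred_conj dpred_eq dpred_mem definable_strict_domain definable_ball dterm_strict_gradient F(1)
        dterm_id dterm_const)
  then have "definable Y" by (simp add: dpred_def Y_def)
  then have Z1: "definable Z"
    unfolding Z_def by (intro definable_Un definable_Compl definable_strict_domain F(1))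
  have "Y \<subseteq> S \<inter> ball xs r" using fd(2) by (auto simp: Y_def S(1))
  from interior_mono[OF this] have "interior Y = {}" using S(2) by blast
  then have Z2: "interior Z = {}"
    unfolding Z_def
    by (intro definable_Un_interior definable_Compl definable_strict_domain interior_Compl_strict_domain F(1))
  have Z3: "y \<notin> S \<and> (\<exists>p. strict_deriv f y p)" if "y \<in> ball xs r - Z" for y
    using fd[of y] that by (auto simp: Z_def Y_def S(1))
  have Z4: "finite {\<alpha>. 0 < \<alpha> \<and> \<not> (AE x0 in lebesgue. \<forall>x. subgradient_sequence f \<alpha> x \<and> x 0 = x0 \<and>
       (\<forall>k. x k \<in> cball xs \<epsilon>) \<longrightarrow> (\<forall>k. x k \<notin> S))}" if \<epsilon>: "\<epsilon> < r" for \<epsilon>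
  proof (rule finite_subset[OF _ finite_degenerate_steps[OF F(1)]], clarify, rule ccontr)
    fix \<alpha> :: real
    assume \<alpha>: "0 < \<alpha>" "\<not> degenerate_step F \<alpha>"
      and not_AE: "\<not> (AE x0 in lebesgue. \<forall>x. subgradient_sequence f \<alpha> x \<and> x 0 = x0 \<and>
         (\<forall>k. x k \<in> cball xs \<epsilon>) \<longrightarrow> (\<forall>k. x k \<notin> S))"
    let ?H = "hitting_set F \<alpha> Z"
    have "negligible (\<Union>k. ?H k)"
      by (intro negligible_Union_nat hitting_set_negligible[OF F(1) Z1 Z2 \<alpha>(2)])
    then have "AE x0 in lebesgue. x0 \<notin> (\<Union>k. ?H k)"
      unfolding negligible_iff_null_sets by (rule AE_not_in)
    moreover have "x 0 \<in> ?H k"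
      if x: "subgradient_sequence f \<alpha> x" "\<And>j. x j \<in> cball xs \<epsilon>" "x k \<in> S" for x k
    proof -
      have ball: "x j \<in> ball xs r" for j using x(2)[of j] \<epsilon> by simp
      have "x (k - j) \<in> ?H j" if "j \<le> k" for j
        using that
      proof (induction j)
        case 0
        show ?case using x(3) ball[of k] fd(2)[of "x k"] by (auto simp: Z_def Y_def S(1))
      next
        case (Suc j)
        let ?i = "k - Suc j"
        have i: "k - j = Suc ?i" using Suc.prems by simp
        show ?case
        proof (cases "x ?i \<in> strict_domain F")
          case True
          obtain s where "s \<in> clarke_subdiff f (x ?i)" "x (Suc ?i) = x ?i - \<alpha> *\<^sub>R s"
            using x(1) unfolding subgradient_sequence_def by blast
          then have "x (k - j) = gradient_step F \<alpha> (x ?i)"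
            using fd(2)[OF True ball] i by (simp add: gradient_step_def)
          then show ?thesis using Suc True by simp
        qed (simp add: Z_def)
      qed
      from this[of k] show ?thesis by simp
    qed
    ultimately have "AE x0 in lebesgue. \<forall>x. subgradient_sequence f \<alpha> x \<and> x 0 = x0 \<and>
         (\<forall>k. x k \<in> cball xs \<epsilon>) \<longrightarrow> (\<forall>k. x k \<notin> S)"
      by (elim eventually_mono) blast
    then show False using not_AE by blast
  qed
  show thesis by (rule that[OF Z1 Z2 Z3 Z4])
qed

end

subsection \<open>Geometry of the critical manifold\<close>

lemma Ck_on_Suc_imp:
  fixes f :: "'a::euclidean_space \<Rightarrow> 'b::real_normed_vector"
  shows "Ck_on (Suc k) U f \<Longrightarrow> Ck_on k U f"
proof (induction k arbitrary: f)
  case 0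
  then show ?case
    by (auto simp: continuous_on_eq_continuous_within intro!: differentiable_imp_continuous_within
        elim: differentiable_at_withinI)
next
  case (Suc k) then show ?case by (simp only: Ck_on.simps) blast
qed

lemma local_equation_1D:
  assumes "local_equation (Suc 0) S m x E U \<phi>" and "y \<in> U"
  shows "subspace E" "open U" "\<phi> y \<in> E" "(\<phi> has_derivative frechet_derivative \<phi> (at y)) (at y)"
    "linear (frechet_derivative \<phi> (at y))" "range (frechet_derivative \<phi> (at y)) = E"
    "continuous_on U \<phi>" "continuous_on U (\<lambda>y. frechet_derivative \<phi> (at y) v)"
    "y \<in> S \<longleftrightarrow> \<phi> y = 0"
proof -
  note le = assms(1)[unfolded local_equation_def]
  show "subspace E" "open U" "range (frechet_derivative \<phi> (at y)) = E" using le assms(2) by blast+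
  show "\<phi> y \<in> E" "y \<in> S \<longleftrightarrow> \<phi> y = 0" using le assms(2) by blast+
  have C1: "Ck_on (Suc 0) U \<phi>" using le by blast
  then have "\<phi> differentiable (at y)" using assms(2) by simp
  then show d: "(\<phi> has_derivative frechet_derivative \<phi> (at y)) (at y)" by (simp add: frechet_derivative_works)
  then show "linear (frechet_derivative \<phi> (at y))" by (rule has_derivative_linear)
  show "continuous_on U (\<lambda>y. frechet_derivative \<phi> (at y) v)" using C1 by simp
  show "continuous_on U \<phi>" using Ck_on_Suc_imp[OF C1] by simp
qed

text \<open>
  With a right inverse \<open>R\<close> of \<open>D = \<phi>'(y)\<close>, a solution \<open>h\<close> of \<open>R \<phi>(y + h) + h - R D h = t w\<close> satisfies
  \<open>\<phi>(y + h) = 0\<close>; Brouwer's theorem provides one close to \<open>t w\<close>.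
\<close>

lemma tangent_direction:
  assumes le: "local_equation (Suc 0) S m y E U \<phi>" and y: "y \<in> S"
    and w: "frechet_derivative \<phi> (at y) w = 0" and pos: "0 < \<eta>" "0 < \<delta>"
  obtains t h where "0 < t" "t < \<delta>" "norm (h - t *\<^sub>R w) \<le> \<eta> * t" "y + h \<in> S"
proof -
  let ?D = "frechet_derivative \<phi> (at y)"
  have yU: "y \<in> U" using le by (simp add: local_equation_def)
  note D = local_equation_1D[OF le yU]
  obtain R where R: "linear R" "\<forall>v\<in>range ?D. ?D (R v) = v"
    using linear_exists_right_inverse_on[OF D(5) subspace_UNIV] by blast
  obtain K where K: "0 < K" "\<And>v. norm (R v) \<le> K * norm v"
    using linear_bounded_pos[OF R(1)] by blast
  have wpos: "0 < norm w + \<eta>" using pos(1) by (simp add: add_nonneg_pos)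
  \<comment> \<open>The admissible linearisation error is fixed so that the map \<open>G\<close>
    below sends the ball of radius \<open>\<eta> * t\<close> into itself.\<close>
  obtain e where e: "0 < e" "K * e * (norm w + \<eta>) = \<eta>"
  proof
    define p where "p = norm w + \<eta>"
    have "0 < p" using wpos by (simp add: p_def)
    then show "0 < \<eta> / p / K" "K * (\<eta> / p / K) * (norm w + \<eta>) = \<eta>"
      unfolding p_def[symmetric] using pos K(1) by auto
  qed
  obtain r1 where r1: "0 < r1" "\<And>z. norm (z - y) < r1 \<Longrightarrow> norm (\<phi> z - \<phi> y - ?D (z - y)) \<le> e * norm (z - y)"
    using D(4) e(1) unfolding has_derivative_at_alt by blast
  obtain r2 where r2: "0 < r2" "ball y r2 \<subseteq> U" using openE[OF D(2) yU] by blast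
  define r where "r = min r1 r2"
  have r: "0 < r" using r1 r2 by (simp add: r_def)
  define t where "t = min (\<delta> / 2) (r / 2 / (norm w + \<eta>))"
  have t: "0 < t" "t < \<delta>" using pos r wpos by (auto simp: t_def)
  have "t * (norm w + \<eta>) \<le> r / 2 / (norm w + \<eta>) * (norm w + \<eta>)"
    by (intro mult_right_mono) (use wpos in \<open>auto simp: t_def\<close>)
  also have "\<dots> = r / 2" using wpos by (intro nonzero_eq_divide_eq[THEN iffD1, OF _ refl]) simp
  finally have tr: "t * (norm w + \<eta>) < r" using r by linarith
  let ?B = "cball (t *\<^sub>R w) (\<eta> * t)"
  have nh: "norm h \<le> t * (norm w + \<eta>)" if "h \<in> ?B" for h
  proof -
    have "norm h \<le> norm (t *\<^sub>R w) + norm (h - t *\<^sub>R w)" using norm_triangle_ineq[of "t *\<^sub>R w" "h - t *\<^sub>R w"] by simp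
    then show ?thesis using that t(1) by (simp add: dist_norm norm_minus_commute algebra_simps)
  qed
  have hU: "y + h \<in> U" if "h \<in> ?B" for h
    using nh[OF that] tr r2 by (auto simp: dist_norm r_def subset_iff)
  define G where "G h = t *\<^sub>R w - (R (\<phi> (y + h)) - R (?D h))" for h
  have phiy: "\<phi> y = 0" using D(9) y by simp
  have "continuous_on ?B (\<lambda>h. \<phi> (y + h))"
  proof (rule continuous_on_compose2[OF D(7)])
    show "continuous_on ?B ((+) y)" by (intro continuous_intros)
    show "(+) y ` ?B \<subseteq> U" using hU by blast
  qed
  from continuous_on_compose2[OF _ this, of UNIV R]
  have "continuous_on ?B (\<lambda>h. R (\<phi> (y + h)))"
    using R(1) by (simp add: linear_continuous_on linear_conv_bounded_linear)
  moreover have "continuous_on ?B (\<lambda>h. R (?D h))"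
    using linear_compose[OF D(5) R(1)] by (simp add: linear_continuous_on linear_conv_bounded_linear o_def)
  ultimately have "continuous_on ?B G"
    unfolding G_def by (intro continuous_on_diff continuous_on_const)
  moreover have "G ` ?B \<subseteq> ?B"
  proof clarify
    fix h assume h: "h \<in> ?B"
    have nhr: "norm h < r" using nh[OF h] tr by linarith
    have "R (\<phi> (y + h)) - R (?D h) = R (\<phi> (y + h) - ?D h)" by (simp add: linear_diff[OF R(1)])
    then have "norm (R (\<phi> (y + h)) - R (?D h)) \<le> K * norm (\<phi> (y + h) - ?D h)" using K(2) by simp
    also have "\<dots> \<le> K * (e * norm h)"
      using r1(2)[of "y + h"] nhr K(1) phiy by (simp add: r_def)
    also have "\<dots> \<le> K * (e * (t * (norm w + \<eta>)))" using nh[OF h] K(1) e(1) by simp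
    also have "\<dots> = (K * e * (norm w + \<eta>)) * t" by simp
    also have "\<dots> = \<eta> * t" by (simp only: e(2))
    finally show "G h \<in> ?B" by (simp add: G_def dist_norm)
  qed
  ultimately obtain h where h: "h \<in> ?B" "G h = h"
    using brouwer_ball[of "\<eta> * t" "t *\<^sub>R w" G] pos t by (metis image_subset_iff_funcset mult_pos_pos)
  \<comment> \<open>The value lies in \<open>E\<close>, the range of \<open>?D\<close>, where
    \<open>R\<close> is a right inverse; so applying \<open>?D\<close> to the fixed point equation
    gives zero.\<close>
  have "\<phi> (y + h) \<in> range ?D" using local_equation_1D(3)[OF le hU[OF h(1)]] D(6) by simp
  then have "\<phi> (y + h) = ?D (R (\<phi> (y + h)))" using R(2) by metis
  also have "R (\<phi> (y + h)) = t *\<^sub>R w + R (?D h) - h" using h(2) by (simp add: G_def algebra_simps)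
  also have "?D \<dots> = t *\<^sub>R ?D w + ?D (R (?D h)) - ?D h"
    by (simp add: linear_add[OF D(5)] linear_diff[OF D(5)] linear_cmul[OF D(5)])
  also have "\<dots> = 0" using w R(2) by simp
  finally have "y + h \<in> S" using local_equation_1D(9)[OF le hU[OF h(1)]] by simp
  moreover have "norm (h - t *\<^sub>R w) \<le> \<eta> * t" using h(1) by (simp add: dist_norm norm_minus_commute)
  ultimately show thesis using that t by blast
qed

text \<open>By \<open>tangent_direction\<close> the vector \<open>w\<close> is a limit of scaled
  chords of \<open>S\<close> from \<open>y\<close>, and \<open>\<psi>\<close> vanishes along these
  chords. By symmetry all local equations have the same kernel, which legitimates the definite
  description in \<open>tangent_cone\<close>.\<close>

lemma kernel_subset:
  assumes le1: "local_equation (Suc 0) S m y E U \<phi>" and le2: "local_equation (Suc 0) S m' y E' U' \<psi>"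
    and y: "y \<in> S" and w: "frechet_derivative \<phi> (at y) w = 0"
  shows "frechet_derivative \<psi> (at y) w = 0"
proof -
  let ?D = "frechet_derivative \<psi> (at y)"
  have yU: "y \<in> U'" using le2 by (simp add: local_equation_def)
  note D = local_equation_1D[OF le2 yU]
  obtain K where K: "0 < K" "\<And>v. norm (?D v) \<le> K * norm v"
    using linear_bounded_pos[OF D(5)] by blast
  have bound: "norm (?D w) \<le> \<eta> * (norm w + 1 + K)" if \<eta>: "0 < \<eta>" "\<eta> \<le> 1" for \<eta>
  proof -
    obtain r1 where r1: "0 < r1" "\<And>z. norm (z - y) < r1 \<Longrightarrow> norm (\<psi> z - \<psi> y - ?D (z - y)) \<le> \<eta> * norm (z - y)"
      using D(4) \<eta>(1) unfolding has_derivative_at_alt by blast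
    obtain r2 where r2: "0 < r2" "ball y r2 \<subseteq> U'" using openE[OF D(2) yU] by blast
    have w1: "0 < norm w + 1" by (simp add: add_nonneg_pos)
    have "0 < min r1 r2 / (norm w + 1)" using r1 r2 w1 by simp
    then obtain t h where th: "0 < t" "t < min r1 r2 / (norm w + 1)" "norm (h - t *\<^sub>R w) \<le> \<eta> * t" "y + h \<in> S"
      using tangent_direction[OF le1 y w \<eta>(1)] by metis
    have "norm h \<le> norm (t *\<^sub>R w) + norm (h - t *\<^sub>R w)" using norm_triangle_ineq[of "t *\<^sub>R w" "h - t *\<^sub>R w"] by simp
    also have "\<dots> \<le> t * norm w + 1 * t"
    proof -
      have "\<eta> * t \<le> 1 * t" using \<eta> th(1) by (intro mult_right_mono) auto
      moreover have "norm (t *\<^sub>R w) = t * norm w" using th(1) by simp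
      ultimately show ?thesis using th(3) by linarith
    qed
    finally have nh: "norm h \<le> t * (norm w + 1)" by (simp add: algebra_simps)
    have "t * (norm w + 1) < min r1 r2" using th(2) w1 by (simp add: pos_less_divide_eq)
    with nh have nh': "norm h < r1" "norm h < r2" by auto
    have "y + h \<in> U'" using nh'(2) r2(2) by (auto simp: dist_norm)
    then have "\<psi> (y + h) = 0" using local_equation_1D(9)[OF le2] th(4) by blast
    moreover have "\<psi> y = 0" using D(9) y by simp
    ultimately have "norm (?D h) \<le> \<eta> * norm h" using r1(2)[of "y + h"] nh'(1) by simp
    also have "\<dots> \<le> \<eta> * (t * (norm w + 1))" using nh \<eta> by simp
    finally have 1: "norm (?D h) \<le> \<eta> * (t * (norm w + 1))" .
    have 2: "norm (?D (h - t *\<^sub>R w)) \<le> K * (\<eta> * t)"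
      using K(2)[of "h - t *\<^sub>R w"] th(3) K(1) by (meson less_imp_le mult_left_mono order_trans)
    have "t *\<^sub>R ?D w = ?D h - ?D (h - t *\<^sub>R w)"
      by (simp add: linear_diff[OF D(5)] linear_cmul[OF D(5)])
    then have "norm (t *\<^sub>R ?D w) \<le> norm (?D h) + norm (?D (h - t *\<^sub>R w))" using norm_triangle_ineq4 by metis
    then have "t * norm (?D w) \<le> t * (\<eta> * (norm w + 1 + K))" using 1 2 th(1) by (simp add: algebra_simps)
    then show ?thesis using th(1) by simp
  qed
  have "norm (?D w) \<le> 0"
  proof (rule field_le_epsilon)
    fix e :: real assume e: "0 < e"
    let ?c = "norm w + 1 + K"
    have c: "0 < ?c" using K(1) by (simp add: add_nonneg_pos)
    have "norm (?D w) \<le> min 1 (e / ?c) * ?c" by (rule bound) (use e c in auto)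
    also have "\<dots> \<le> e / ?c * ?c" by (rule mult_right_mono) (use c in auto)
    finally show "norm (?D w) \<le> 0 + e" using c by simp
  qed
  then show ?thesis by simp
qed

lemma tangent_cone_eq:
  assumes le: "local_equation (Suc 0) S m y E U \<phi>" and y: "y \<in> S"
  shows "tangent_cone S y = {v. frechet_derivative \<phi> (at y) v = 0}"
  unfolding tangent_cone_def One_nat_def
proof (rule the_equality)
  show "\<exists>m E U \<psi>. local_equation (Suc 0) S m y E U \<psi> \<and>
      {v. frechet_derivative \<phi> (at y) v = 0} = {v. frechet_derivative \<psi> (at y) v = 0}"
    using le by blast
  fix T assume "\<exists>m E U \<psi>. local_equation (Suc 0) S m y E U \<psi> \<and> T = {v. frechet_derivative \<psi> (at y) v = 0}"
  then obtain m' E' U' \<psi> where le': "local_equation (Suc 0) S m' y E' U' \<psi>"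
    and T: "T = {v. frechet_derivative \<psi> (at y) v = 0}" by blast
  show "T = {v. frechet_derivative \<phi> (at y) v = 0}"
    unfolding T using kernel_subset[OF le le' y] kernel_subset[OF le' le y] by blast
qed

lemma local_equation_shift:
  assumes "local_equation (Suc (Suc 0)) S m x E U \<phi>" "y \<in> U"
  shows "local_equation (Suc 0) S m y E U \<phi>"
  using assms Ck_on_Suc_imp[of "Suc 0" U \<phi>] unfolding local_equation_def by blast

text \<open>On an open subset of \<open>S\<close> the map \<open>\<phi>\<close> is constant, so its
  derivative is zero, yet has range \<open>E\<close> of positive dimension.\<close>

lemma interior_submanifold:
  assumes le: "local_equation (Suc 0) S m x E U \<phi>" and m: "m < DIM('a::euclidean_space)" and B: "B \<subseteq> U"
  shows "interior (S \<inter> B :: 'a set) = {}"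
proof (rule ccontr)
  assume "interior (S \<inter> B) \<noteq> {}"
  then obtain y where y: "y \<in> interior (S \<inter> B)" by blast
  then have yU: "y \<in> U" using interior_subset B by blast
  have "(\<phi> has_derivative (\<lambda>_. 0)) (at y)"
  proof (rule has_derivative_transform_within_open[OF has_derivative_const open_interior y])
    show "0 = \<phi> z" if "z \<in> interior (S \<inter> B)" for z
      using that interior_subset[of "S \<inter> B"] B local_equation_1D(9)[OF le, of z] by auto
  qed
  then have "frechet_derivative \<phi> (at y) = (\<lambda>_. 0)" by (rule frechet_derivative_at[symmetric])
  then have "E = {0}" using local_equation_1D(6)[OF le yU] by auto
  then show False using le m by (simp add: local_equation_def)
qed

text \<open>Directionwise continuity on the finitely many basis vectors already gives continuity in
  operator norm.\<close>

lemma uniform_derivative: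
  fixes D :: "'a::euclidean_space \<Rightarrow> 'a \<Rightarrow> 'b::real_normed_vector"
  assumes U: "open U" "x \<in> U" and lin: "\<And>y. y \<in> U \<Longrightarrow> linear (D y)"
    and cont: "\<And>v. continuous_on U (\<lambda>y. D y v)" and e: "0 < e"
  obtains r where "0 < r" "ball x r \<subseteq> U" "\<And>y u. y \<in> ball x r \<Longrightarrow> norm (D y u - D x u) \<le> e * norm u"
proof -
  let ?e = "e / real DIM('a)"
  have e': "0 < ?e" using e by simp
  have "\<exists>d>0. \<forall>y\<in>U. dist y x < d \<longrightarrow> dist (D y b) (D x b) < ?e" for b
    using cont[of b] U(2) e' unfolding continuous_on_iff by blast
  then obtain d where d: "\<And>b. 0 < d b" "\<And>b y. y \<in> U \<Longrightarrow> dist y x < d b \<Longrightarrow> dist (D y b) (D x b) < ?e"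
    by metis
  obtain r2 where r2: "0 < r2" "ball x r2 \<subseteq> U" using openE[OF U] by blast
  define r where "r = min r2 (Min (d ` Basis))"
  show thesis
  proof
    show "0 < r" using r2(1) d(1) by (simp add: r_def)
    show "ball x r \<subseteq> U" using r2(2) by (auto simp: r_def)
    fix y u assume y: "y \<in> ball x r"
    then have yU: "y \<in> U" and db: "\<And>b. b \<in> Basis \<Longrightarrow> dist y x < d b" using r2(2) by (auto simp: r_def dist_commute)
    have "D z u = (\<Sum>b\<in>Basis. (u \<bullet> b) *\<^sub>R D z b)" if "z \<in> U" for z
    proof -
      have "D z u = D z (\<Sum>b\<in>Basis. (u \<bullet> b) *\<^sub>R b)" by (simp only: euclidean_representation)
      then show ?thesis by (simp only: linear_sum[OF lin[OF that]] linear_cmul[OF lin[OF that]])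
    qed
    then have "D y u - D x u = (\<Sum>b\<in>Basis. (u \<bullet> b) *\<^sub>R (D y b - D x b))"
      using yU U(2) by (simp add: sum_subtractf scaleR_diff_right)
    also have "norm \<dots> \<le> (\<Sum>b\<in>(Basis::'a set). norm u * ?e)"
    proof (rule sum_norm_le)
      fix b :: 'a assume b: "b \<in> Basis"
      have "norm (D y b - D x b) \<le> ?e" using d(2)[OF yU db[OF b]] by (simp add: dist_norm)
      then show "norm ((u \<bullet> b) *\<^sub>R (D y b - D x b)) \<le> norm u * ?e"
        using Basis_le_norm[OF b, of u] by (simp add: mult_mono del: times_divide_eq_right)
    qed
    also have "\<dots> = e * norm u" by simp
    finally show "norm (D y u - D x u) \<le> e * norm u" .
  qed
qed

section \<open>Orthogonal projection onto a subspace\<close>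

lemma closest_point_subspace:
  fixes T :: "'a::euclidean_space set"
  assumes T: "subspace T"
  shows "closest_point T u \<in> T" "t \<in> T \<Longrightarrow> (u - closest_point T u) \<bullet> t = 0"
proof -
  have cl: "closed T" "convex T" "T \<noteq> {}"
    using T by (auto intro: closed_subspace subspace_imp_convex dest: subspace_0)
  show mem: "closest_point T u \<in> T" by (rule closest_point_in_set[OF cl(1,3)])
  assume t: "t \<in> T"
  have "(u - closest_point T u) \<bullet> (closest_point T u + s *\<^sub>R t - closest_point T u) \<le> 0" for s
    by (rule closest_point_dot[OF cl(2,1)]) (intro subspace_add subspace_scale T mem t)
  from this[of 1] this[of "-1"] show "(u - closest_point T u) \<bullet> t = 0" by simp
qed

lemma closest_point_subspace_unique:
  fixes T :: "'a::euclidean_space set"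
  assumes T: "subspace T" and p: "p \<in> T" "\<And>t. t \<in> T \<Longrightarrow> (u - p) \<bullet> t = 0"
  shows "closest_point T u = p"
proof -
  let ?q = "closest_point T u"
  have d: "p - ?q \<in> T" using closest_point_subspace(1)[OF T] p(1) T subspace_diff by blast
  have "(p - ?q) \<bullet> (p - ?q) = ((u - ?q) - (u - p)) \<bullet> (p - ?q)" by simp
  also have "\<dots> = 0" using closest_point_subspace(2)[OF T d] p(2)[OF d] by (simp only: inner_diff_left[of "u - ?q"])
  finally show ?thesis by simp
qed

lemma closest_point_subspace_linear:
  fixes T :: "'a::euclidean_space set"
  assumes T: "subspace T" shows "linear (closest_point T)"
proof (rule linearI)
  note cp = closest_point_subspace[OF T]
  show "closest_point T (u + v) = closest_point T u + closest_point T v" for u v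
  proof (rule closest_point_subspace_unique[OF T])
    show "closest_point T u + closest_point T v \<in> T" by (intro subspace_add T cp(1))
    show "(u + v - (closest_point T u + closest_point T v)) \<bullet> t = 0" if "t \<in> T" for t
      using cp(2)[OF that, of u] cp(2)[OF that, of v] by (simp add: inner_diff_left inner_add_left)
  qed
  show "closest_point T (c *\<^sub>R u) = c *\<^sub>R closest_point T u" for c u
  proof (rule closest_point_subspace_unique[OF T])
    show "c *\<^sub>R closest_point T u \<in> T" by (intro subspace_scale T cp(1))
    show "(c *\<^sub>R u - c *\<^sub>R closest_point T u) \<bullet> t = 0" if "t \<in> T" for t
      using cp(2)[OF that, of u] by (simp add: inner_diff_left)
  qed
qed

lemma norm_minus_closest_point_le:
  fixes T :: "'a::euclidean_space set"
  assumes T: "subspace T" shows "norm (u - closest_point T u) \<le> norm u"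
proof -
  have "dist u (closest_point T u) \<le> dist u 0"
    using T by (intro closest_point_le closed_subspace subspace_0)
  then show ?thesis by (simp add: dist_norm)
qed

text \<open>
  A vector orthogonal to the kernel of \<open>D y\<close> is of the form \<open>adjoint (D y) e\<close> with \<open>e \<in> E\<close>, and the
  adjoint is bounded below on \<open>E\<close>, uniformly near \<open>x\<close>.
\<close>

lemma uniform_lower_bound:
  fixes D :: "'a::euclidean_space \<Rightarrow> 'a \<Rightarrow> 'a"
  assumes U: "open U" "x \<in> U" and lin: "\<And>y. y \<in> U \<Longrightarrow> linear (D y)"
    and range: "\<And>y. y \<in> U \<Longrightarrow> range (D y) = E" and E: "subspace E"
    and cont: "\<And>v. continuous_on U (\<lambda>y. D y v)"
  obtains r M where "0 < r" "0 < M" "ball x r \<subseteq> U"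
    "\<And>y w. y \<in> ball x r \<Longrightarrow> (\<And>u. D y u = 0 \<Longrightarrow> w \<bullet> u = 0) \<Longrightarrow> norm w \<le> M * norm (D y w)"
proof -
  obtain R where R: "linear R" "\<forall>v\<in>range (D x). D x (R v) = v"
    using linear_exists_right_inverse_on[OF lin[OF U(2)] subspace_UNIV] by blast
  obtain K where K: "0 < K" "\<And>v. norm (R v) \<le> K * norm v"
    using linear_bounded_pos[OF R(1)] by blast
  \<comment> \<open>The tolerance \<open>1 / (2 * K)\<close> lets the perturbation absorb at most
    half of \<open>norm e\<close> in the estimate below.\<close>
  obtain r where r: "0 < r" "ball x r \<subseteq> U" "\<And>y u. y \<in> ball x r \<Longrightarrow> norm (D y u - D x u) \<le> 1 / (2 * K) * norm u"
    using uniform_derivative[OF U lin cont, of "1 / (2 * K)"] K(1) by auto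
  show thesis
  proof
    fix y w assume y: "y \<in> ball x r" and w: "\<And>u. D y u = 0 \<Longrightarrow> w \<bullet> u = 0"
    have yU: "y \<in> U" using y r(2) by blast
    note L = lin[OF yU]
    have "w \<in> orthogonal_comp (D y -` {0})"
      using w by (auto simp: orthogonal_comp_def orthogonal_def inner_commute)
    also have "\<dots> = orthogonal_comp (orthogonal_comp (range (adjoint (D y))))"
      by (simp add: ker_orthogonal_comp_adjoint[OF L])
    also have "\<dots> = range (adjoint (D y))"
      by (intro orthogonal_comp_self linear_subspace_image adjoint_linear L subspace_UNIV)
    finally obtain e' where e': "w = adjoint (D y) e'" by blast
    \<comment> \<open>Only the component in \<open>E\<close> counts: the values of
      \<open>D y\<close> lie in \<open>E\<close>, and \<open>R\<close> inverts \<open>D x\<close>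
      there.\<close>
    define e where "e = closest_point E e'"
    have eE: "e \<in> E" unfolding e_def by (rule closest_point_subspace(1)[OF E])
    have adj: "w \<bullet> u = e \<bullet> D y u" for u
    proof -
      have "w \<bullet> u = e' \<bullet> D y u" unfolding e' by (simp add: adjoint_works[OF L] inner_commute)
      moreover have "(e' - e) \<bullet> D y u = 0"
        unfolding e_def by (rule closest_point_subspace(2)[OF E]) (use range[OF yU] in blast)
      ultimately show ?thesis by (simp add: inner_diff_left)
    qed
    have "norm e * norm e = e \<bullet> D x (R e)" using R(2) range[OF U(2)] eE by (simp add: dot_square_norm power2_eq_square)
    also have "\<dots> = w \<bullet> R e - e \<bullet> (D y (R e) - D x (R e))" by (simp add: adj inner_diff_right)
    also have "\<dots> \<le> norm w * norm (R e) + norm e * norm (D y (R e) - D x (R e))"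
      using norm_cauchy_schwarz[of w "R e"] norm_cauchy_schwarz[of e "- (D y (R e) - D x (R e))"]
      by (simp add: inner_diff_right norm_minus_commute)
    also have "\<dots> \<le> norm w * (K * norm e) + norm e * (1 / (2 * K) * (K * norm e))"
    proof (intro add_mono mult_left_mono K(2) norm_ge_zero)
      have "norm (D y (R e) - D x (R e)) \<le> 1 / (2 * K) * norm (R e)" by (rule r(3)[OF y])
      also have "\<dots> \<le> 1 / (2 * K) * (K * norm e)" using K by (intro mult_left_mono) auto
      finally show "norm (D y (R e) - D x (R e)) \<le> 1 / (2 * K) * (K * norm e)" .
    qed
    also have "\<dots> = norm e * (K * norm w + norm e / 2)" using K(1) by (simp add: algebra_simps)
    finally have "norm e = 0 \<or> norm e \<le> K * norm w + norm e / 2" by (auto simp: mult_le_cancel_left)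
    then have ne: "norm e \<le> 2 * K * norm w" using K(1) by auto
    have "norm w * norm w = e \<bullet> D y w" using adj[of w] by (simp add: dot_square_norm power2_eq_square)
    also have "\<dots> \<le> norm e * norm (D y w)" by (rule norm_cauchy_schwarz)
    also have "\<dots> \<le> norm w * (2 * K * norm (D y w))" using mult_right_mono[OF ne, of "norm (D y w)"] by (simp add: algebra_simps)
    finally show "norm w \<le> 2 * K * norm (D y w)" using K(1) by (cases "w = 0") auto
  qed (use r K in auto)
qed

text \<open>The map \<open>\<phi>\<close> vanishes at both ends of a chord and its derivative is
  nearly constant near \<open>x\<close>, so the derivative at \<open>y\<close> almost kills
  \<open>z - y\<close>. The uniform lower bound on vectors normal to the kernel then controls the
  normal part of the chord.\<close>

lemma chord_almost_tangent:
  assumes le: "local_equation (Suc (Suc 0)) S m x E U \<phi>" and \<eta>: "0 < \<eta>"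
  obtains r where "0 < r" "ball x r \<subseteq> U" "\<And>y. y \<in> S \<inter> ball x r \<Longrightarrow> subspace (tangent_cone S y)"
    "\<And>y z. y \<in> S \<inter> ball x r \<Longrightarrow> z \<in> S \<inter> ball x r \<Longrightarrow>
      norm ((z - y) - closest_point (tangent_cone S y) (z - y)) \<le> \<eta> * norm (z - y)"
proof -
  let ?D = "\<lambda>y. frechet_derivative \<phi> (at y)"
  have xU: "x \<in> U" using le by (simp add: local_equation_def)
  note le1 = local_equation_shift[OF le]
  note LE = local_equation_1D[OF le1[OF xU]]
  have U: "open U" and E: "subspace E" using LE[OF xU] by blast+
  obtain r1 M where r1: "0 < r1" "0 < M" "ball x r1 \<subseteq> U"
    "\<And>y w. y \<in> ball x r1 \<Longrightarrow> (\<And>u. ?D y u = 0 \<Longrightarrow> w \<bullet> u = 0) \<Longrightarrow> norm w \<le> M * norm (?D y w)"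
    using uniform_lower_bound[OF U xU LE(5,6) E LE(8)[OF xU]] by metis
  \<comment> \<open>Half for the mean value estimate and half for replacing the derivative at
    \<open>x\<close> by that at \<open>y\<close>; \<open>M\<close> is the constant of the lower
    bound.\<close>
  let ?e = "\<eta> / (2 * M)"
  have e: "0 < ?e" using \<eta> r1 by simp
  obtain r2 where r2: "0 < r2" "ball x r2 \<subseteq> U" "\<And>y u. y \<in> ball x r2 \<Longrightarrow> norm (?D y u - ?D x u) \<le> ?e * norm u"
    using uniform_derivative[OF U xU LE(5) LE(8)[OF xU] e] by metis
  let ?r = "min r1 r2"
  have tc: "tangent_cone S y = {v. ?D y v = 0}" if "y \<in> S \<inter> ball x ?r" for y
    by (rule tangent_cone_eq[OF le1]) (use that r1 in auto)
  have sub: "subspace (tangent_cone S y)" if y: "y \<in> S \<inter> ball x ?r" for y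
    unfolding tc[OF y] by (rule linear_subspace_kernel[OF LE(5)]) (use y r1 in auto)
  show thesis
  proof (rule that[of ?r])
    fix y z assume y: "y \<in> S \<inter> ball x ?r" and z: "z \<in> S \<inter> ball x ?r"
    have yU: "y \<in> U" "z \<in> U" using y z r1 by auto
    let ?T = "tangent_cone S y"
    let ?w = "(z - y) - closest_point ?T (z - y)"
    have "norm ((\<phi> z - ?D x z) - (\<phi> y - ?D x y)) \<le> ?e * norm (z - y)"
    proof (rule differentiable_bound[OF convex_ball[of x r2]])
      fix u assume u: "u \<in> ball x r2"
      then have uU: "u \<in> U" using r2 by blast
      have "((\<lambda>z. \<phi> z - ?D x z) has_derivative (\<lambda>v. ?D u v - ?D x v)) (at u)"
        by (intro has_derivative_diff LE(4)[OF uU] bounded_linear_imp_has_derivative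
            linear_conv_bounded_linear[THEN iffD1] LE(5)[OF xU])
      then show "((\<lambda>z. \<phi> z - ?D x z) has_derivative (\<lambda>v. ?D u v - ?D x v)) (at u within ball x r2)"
        by (rule has_derivative_at_withinI)
      show "onorm (\<lambda>v. ?D u v - ?D x v) \<le> ?e"
        by (rule onorm_le) (rule r2(3)[OF u])
    qed (use y z in auto)
    moreover have "\<phi> z = 0" "\<phi> y = 0" using LE(9) y z yU by auto
    ultimately have "norm (?D x y - ?D x z) \<le> ?e * norm (z - y)" by simp
    then have 1: "norm (?D x (z - y)) \<le> ?e * norm (z - y)"
      by (simp add: linear_diff[OF LE(5)[OF xU]] norm_minus_commute)
    have 2: "norm (?D y (z - y) - ?D x (z - y)) \<le> ?e * norm (z - y)" by (rule r2(3)) (use y in auto)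
    have 3: "norm (?D y (z - y)) \<le> 2 * (?e * norm (z - y))"
      using norm_triangle_ineq[of "?D y (z - y) - ?D x (z - y)" "?D x (z - y)"] 1 2 by simp
    have "closest_point ?T (z - y) \<in> ?T" by (rule closest_point_subspace(1)[OF sub[OF y]])
    then have "?D y ?w = ?D y (z - y)"
      using tc[OF y] by (simp add: linear_diff[OF LE(5)[OF yU(1)]])
    moreover have "norm ?w \<le> M * norm (?D y ?w)"
    proof -
      have "y \<in> ball x r1" using y by auto
      moreover have "?w \<bullet> u = 0" if "?D y u = 0" for u
      proof -
        have "u \<in> ?T" unfolding tc[OF y] using that by blast
        then show ?thesis by (rule closest_point_subspace(2)[OF sub[OF y]])
      qed
      ultimately show ?thesis by (rule r1(4)[of y ?w])
    qed
    ultimately have "norm ?w \<le> M * norm (?D y (z - y))" by simp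
    also have "\<dots> \<le> M * (2 * (?e * norm (z - y)))" by (rule mult_left_mono[OF 3]) (use r1(2) in simp)
    also have "\<dots> = \<eta> * norm (z - y)" using r1(2) by simp
    finally show "norm ?w \<le> \<eta> * norm (z - y)" .
  qed (use r1 r2 sub in auto)
qed

text \<open>The local equation makes \<open>S\<close> closed within a ball around \<open>x\<close>;
  the distance is attained there, and points of \<open>S\<close> outside that ball are too far away
  to compete.\<close>

lemma nearest_point:
  assumes le: "local_equation (Suc 0) S m x E U \<phi>" and x: "x \<in> S"
  obtains r where "0 < r"
    "\<And>u. u \<in> cball x r \<Longrightarrow> \<exists>y\<in>S. dist u y = infdist u S \<and> dist x y \<le> 2 * dist x u"
proof -
  have xU: "x \<in> U" using le by (simp add: local_equation_def)
  obtain r0 where r0: "0 < r0" "cball x r0 \<subseteq> U"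
    using local_equation_1D(2)[OF le xU] xU open_contains_cball by blast
  \<comment> \<open>A point of \<open>S\<close> beyond \<open>r0\<close> is more than
    \<open>3 * r\<close> away from \<open>u\<close>, whereas \<open>x\<close> is within
    \<open>r\<close>.\<close>
  define r where "r = r0 / 4"
  have r: "0 < r" "4 * r = r0" using r0 by (simp_all add: r_def)
  let ?K = "S \<inter> cball x r0"
  have "?K = {y \<in> cball x r0. \<phi> y = 0}" using r0(2) local_equation_1D(9)[OF le] by blast
  moreover have "closed {y \<in> cball x r0. \<phi> y = 0}"
    using continuous_on_subset[OF local_equation_1D(7)[OF le xU] r0(2)]
    by (intro continuous_closed_preimage_constant) auto
  ultimately have K: "closed ?K" "x \<in> ?K" using x r0 by auto
  show thesis
  proof (rule that[OF r(1)])
    fix u assume u: "u \<in> cball x r"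
    obtain y where y: "y \<in> ?K" "\<And>z. z \<in> ?K \<Longrightarrow> dist u y \<le> dist u z"
      using distance_attains_inf[OF K(1), of u] K(2) by blast
    have yx: "dist u y \<le> dist u x" using y(2) K(2) by blast
    have min: "dist u y \<le> dist u z" if z: "z \<in> S" for z
    proof (cases "z \<in> cball x r0")
      case False
      then have "r0 < dist x z" by simp
      also have "\<dots> \<le> dist x u + dist u z" by (rule dist_triangle)
      finally show ?thesis using u yx r by (simp add: dist_commute)
    qed (use y z in auto)
    have "dist u y = infdist u S"
      using min y(1) by (intro antisym infdist_le) (auto simp: infdist_def intro!: cINF_greatest)
    moreover have "dist x y \<le> 2 * dist x u"
      using dist_triangle[of x y u] yx by (simp add: dist_commute)
    ultimately show "\<exists>y\<in>S. dist u y = infdist u S \<and> dist x y \<le> 2 * dist x u" using y(1) by blast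
  qed
qed

text \<open>For \<open>\<theta> > 1\<close> the inequality forces \<open>v\<close> to be of larger
  order than \<open>\<delta>\<close> as \<open>\<delta>\<close> tends to 0. The threshold solves
  \<open>c * (K * \<delta>) powr \<theta> = \<delta>\<close>.\<close>

lemma powr_superlinear:
  fixes \<theta> c K :: real
  assumes "1 < \<theta>" "0 < c" "0 < K"
  obtains \<delta>\<^sub>0 where "0 < \<delta>\<^sub>0" "\<And>\<delta> v. 0 < \<delta> \<Longrightarrow> \<delta> < \<delta>\<^sub>0 \<Longrightarrow> 0 \<le> v \<Longrightarrow> \<delta> \<le> c * v powr \<theta> \<Longrightarrow> K * \<delta> \<le> v"
proof
  let ?q = "1 / (c * K powr \<theta>)"
  let ?d = "?q powr (1 / (\<theta> - 1))"
  have q: "0 < ?q" using assms by simp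
  then show "0 < ?d" using assms by simp
  fix \<delta> v assume d: "0 < \<delta>" "\<delta> < ?d" and v: "0 \<le> v" "\<delta> \<le> c * v powr \<theta>"
  show "K * \<delta> \<le> v"
  proof (rule ccontr)
    assume "\<not> K * \<delta> \<le> v"
    then have "v powr \<theta> \<le> (K * \<delta>) powr \<theta>" using v assms by (intro powr_mono2) auto
    then have "\<delta> \<le> c * (K * \<delta>) powr \<theta>" using v(2) assms(2) by (meson less_imp_le mult_left_mono order_trans)
    also have "\<dots> = c * K powr \<theta> * (\<delta> * \<delta> powr (\<theta> - 1))"
      using d assms powr_add[of \<delta> 1 "\<theta> - 1"] by (simp add: powr_mult)
    finally have "\<delta> * 1 \<le> \<delta> * (c * K powr \<theta> * \<delta> powr (\<theta> - 1))" by (simp add: algebra_simps)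
    then have "1 \<le> c * K powr \<theta> * \<delta> powr (\<theta> - 1)" using d(1) by (simp only: mult_le_cancel_left_pos)
    moreover have "\<delta> powr (\<theta> - 1) < ?d powr (\<theta> - 1)" using d assms by (intro powr_less_mono2) auto
    moreover have "?d powr (\<theta> - 1) = ?q" using assms q by (simp add: powr_powr)
    ultimately have "1 < c * K powr \<theta> * ?q" using assms by (smt (verit) mult_strict_left_mono powr_gt_zero mult_pos_pos)
    then show False using assms by simp
  qed
qed

text \<open>Let \<open>N\<close> be the normal projection at \<open>y\<close>. Then
  \<open>\<alpha>\<close> times \<open>N v\<close> is the normal part of \<open>x - y\<close> minus
  those of the new offset from \<open>z\<close> and of the chord \<open>z - y\<close>. The chord is
  at most \<open>2 * (norm (x - y) + \<alpha> * norm v)\<close>, and one eighth of this accounts for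
  the loss of 1/4 in both 3/4 and 5/4.\<close>

lemma distance_after_step:
  fixes T :: "'a::euclidean_space set"
  assumes T: "subspace T" and \<alpha>: "0 < \<alpha>"
    and v: "norm (closest_point T v) \<le> c * norm (x - y)"
    and z: "norm ((z - y) - closest_point T (z - y)) \<le> 1 / 8 * norm (z - y)"
    and near: "norm (x - \<alpha> *\<^sub>R v - z) \<le> norm (x - \<alpha> *\<^sub>R v - y)"
  shows "3 / 4 * (\<alpha> * norm v) - (\<alpha> * c + 5 / 4) * norm (x - y) \<le> norm (x - \<alpha> *\<^sub>R v - z)"
proof -
  define N where "N u = u - closest_point T u" for u
  have N: "linear N"
    unfolding N_def[abs_def] by (intro linear_compose_sub linear_id[unfolded id_def] closest_point_subspace_linear T)
  have N_le: "norm (N u) \<le> norm u" for u unfolding N_def by (rule norm_minus_closest_point_le[OF T])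
  let ?x = "x - \<alpha> *\<^sub>R v"
  have "norm (?x - y) \<le> norm (x - y) + \<alpha> * norm v"
    using norm_triangle_ineq4[of "x - y" "\<alpha> *\<^sub>R v"] \<alpha> by (simp add: algebra_simps)
  moreover have "norm (z - y) \<le> norm (?x - y) + norm (?x - z)"
    using norm_triangle_ineq4[of "?x - y" "?x - z"] by simp
  ultimately have zy: "norm (z - y) \<le> 2 * (norm (x - y) + \<alpha> * norm v)"
    using near by (smt (verit))
  have "norm v \<le> norm (N v) + norm (closest_point T v)"
    using norm_triangle_ineq[of "N v" "closest_point T v"] by (simp add: N_def)
  then have "norm v - c * norm (x - y) \<le> norm (N v)" using v by linarith
  then have Nv: "\<alpha> * (norm v - c * norm (x - y)) \<le> \<alpha> * norm (N v)" using \<alpha> by simp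
  have "\<alpha> *\<^sub>R N v = N (x - y) - N (?x - z) - N (z - y)"
    by (simp add: linear_diff[OF N] linear_cmul[OF N])
  then have "\<alpha> * norm (N v) = norm (N (x - y) - N (?x - z) - N (z - y))"
    using \<alpha> by (metis abs_of_pos norm_scaleR)
  also have "\<dots> \<le> norm (N (x - y)) + norm (N (?x - z)) + norm (N (z - y))"
    by (smt (verit) norm_triangle_ineq4)
  also have "\<dots> \<le> norm (x - y) + norm (?x - z) + 1 / 8 * norm (z - y)"
    using N_le[of "x - y"] N_le[of "?x - z"] z unfolding N_def by linarith
  finally show ?thesis using Nv zy by (simp add: algebra_simps)
qed

subsection \<open>Strong instability\<close>

text \<open>Continuity of \<open>\<phi>\<close> excludes jumps at the finitely many exceptional
  points, so the fundamental theorem of calculus still applies.\<close>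

lemma increment_le_of_derivative:
  fixes \<phi> :: "real \<Rightarrow> real"
  assumes t: "0 \<le> t" and cont: "continuous_on {0..t} \<phi>" and fin: "finite N"
    and der: "\<And>s. s \<in> {0..t} - N \<Longrightarrow> \<exists>D. (\<phi> has_real_derivative D) (at s) \<and> D \<le> k"
  shows "\<phi> t - \<phi> 0 \<le> k * t"
proof -
  obtain D where D: "\<And>s. s \<in> {0..t} - N \<Longrightarrow> (\<phi> has_real_derivative D s) (at s) \<and> D s \<le> k"
    using der by metis
  define D' where "D' s = (if s \<in> {0..t} - N then D s else k)" for s
  have "(D' has_integral (\<phi> t - \<phi> 0)) {0..t}"
  proof (rule fundamental_theorem_of_calculus_strong[OF fin t _ cont])
    show "(\<phi> has_vector_derivative D' s) (at s)" if "s \<in> {0..t} - N" for s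
      using D[OF that] that by (simp add: D'_def has_real_derivative_iff_has_vector_derivative)
  qed
  moreover have "((\<lambda>_. k) has_integral (k * t)) {0..t}"
    using has_integral_const_real[of k 0 t] t by (simp add: mult.commute)
  ultimately show ?thesis
    by (rule has_integral_le) (use D in \<open>auto simp: D'_def\<close>)
qed

context o_minimal
begin

text \<open>
  The difference quotients in the Clarke derivative are estimated on almost every line, which meets
  \<open>Z\<close> in a finite set, and then everywhere by continuity.
\<close>

lemma clarke_derivative_le:
  fixes f :: "'a::euclidean_space \<Rightarrow> real"
  assumes Z: "definable Z" "interior Z = {}" and f: "\<And>x. isCont f x" and B: "0 < \<delta>"
    and grad: "\<And>x. x \<in> ball y \<delta> - Z \<Longrightarrow> \<exists>p. strict_deriv f x p \<and> p \<bullet> d \<le> k"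
  shows "clarke_derivative f y d \<le> ereal k"
proof -
  have nd: "0 < norm d + 1" by (simp add: add_nonneg_pos)
  have inc: "f (z + t *\<^sub>R d) - f z \<le> k * t"
    if z: "dist y z < \<delta> / 2" and t: "0 < t" "t < \<delta> / (2 * (norm d + 1))" for z t
  proof (rule ccontr)
    assume neg: "\<not> ?thesis"
    \<comment> \<open>For fixed \<open>t\<close> a violated inequality persists on an open set of
      base points, which is not null and therefore contains the start of a line meeting
      \<open>Z\<close> finitely often.\<close>
    let ?W = "{u. k * t < f (u + t *\<^sub>R d) - f u} \<inter> ball y (\<delta> / 2)"
    have contf: "continuous_on UNIV f" using f by (simp add: continuous_on_eq_continuous_at)
    have "open ?W"
      by (intro open_Int open_ball open_Collect_less continuous_on_diff continuous_on_const
          continuous_on_compose2[OF contf] contf continuous_on_add continuous_on_id) auto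
    moreover have "z \<in> ?W" using neg z by auto
    ultimately have nn: "\<not> negligible ?W" using open_not_negligible by blast
    have "\<exists>u\<in>?W. finite {s. u + s *\<^sub>R d \<in> Z}"
    proof (rule ccontr)
      assume "\<not> ?thesis"
      moreover have "AE u in lebesgue. finite {s. u + s *\<^sub>R d \<in> Z}"
        using definable_AE_lines_finite[OF Z] by (rule AE_completion)
      ultimately have "AE u in lebesgue. u \<notin> ?W" by (elim eventually_mono) blast
      moreover have "?W \<in> sets lebesgue" using \<open>open ?W\<close> by simp
      ultimately have "?W \<in> null_sets lebesgue" by (simp add: AE_iff_null_sets)
      then show False using nn by (simp add: negligible_iff_null_sets)
    qed
    then obtain u where u: "k * t < f (u + t *\<^sub>R d) - f u" "dist y u < \<delta> / 2" "finite {s. u + s *\<^sub>R d \<in> Z}"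
      by auto
    have "f (u + t *\<^sub>R d) - f (u + 0 *\<^sub>R d) \<le> k * t"
    proof (rule increment_le_of_derivative[OF _ _ u(3)])
      show "continuous_on {0..t} (\<lambda>s. f (u + s *\<^sub>R d))"
        by (intro continuous_on_compose2[OF contf] continuous_intros) auto
      fix s assume s: "s \<in> {0..t} - {s. u + s *\<^sub>R d \<in> Z}"
      have "s * norm d \<le> t * (norm d + 1)" using s t(1) by (intro mult_mono) auto
      also have "\<dots> < \<delta> / 2" using t(2) nd by (simp add: pos_less_divide_eq mult.commute mult.left_commute)
      finally have "norm (s *\<^sub>R d) < \<delta> / 2" using s by simp
      then have "dist y (u + s *\<^sub>R d) < \<delta>"
        using norm_triangle_ineq4[of "y - u" "s *\<^sub>R d"] u(2) by (simp add: dist_norm algebra_simps)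
      then obtain p where p: "strict_deriv f (u + s *\<^sub>R d) p" "p \<bullet> d \<le> k" using grad s by force
      have "((\<lambda>s. u + s *\<^sub>R d) has_derivative (\<lambda>h. h *\<^sub>R d)) (at s)"
        by (auto intro!: derivative_eq_intros)
      from has_derivative_compose[OF this strict_deriv_has_derivative[OF p(1)]]
      have "((\<lambda>s. f (u + s *\<^sub>R d)) has_real_derivative (p \<bullet> d)) (at s)"
        by (simp add: has_field_derivative_def mult_commute_abs)
      then show "\<exists>D. ((\<lambda>s. f (u + s *\<^sub>R d)) has_real_derivative D) (at s) \<and> D \<le> k" using p(2) by blast
    qed (use t in simp)
    then show False using u(1) by simp
  qed
  have "eventually (\<lambda>z. dist y z < \<delta> / 2) (nhds y)"
    using eventually_nhds_ball[of "\<delta> / 2" y] B by simp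
  moreover have "eventually (\<lambda>t. 0 < t \<and> t < \<delta> / (2 * (norm d + 1))) (at_right (0::real))"
    using eventually_at_right_real[of 0 "\<delta> / (2 * (norm d + 1))"] B nd by simp
  ultimately have "eventually (\<lambda>(z, t). dist y z < \<delta> / 2 \<and> 0 < t \<and> t < \<delta> / (2 * (norm d + 1)))
     (nhds y \<times>\<^sub>F at_right 0)"
    unfolding eventually_prod_filter by (auto simp: case_prod_beta')
  then have "eventually (\<lambda>w. (\<lambda>(z, t). ereal ((f (z + t *\<^sub>R d) - f z) / t)) w \<le> ereal k) (nhds y \<times>\<^sub>F at_right 0)"
  proof (rule eventually_mono, clarify)
    fix z t assume "dist y z < \<delta> / 2" "(0::real) < t" "t < \<delta> / (2 * (norm d + 1))"
    then show "ereal ((f (z + t *\<^sub>R d) - f z) / t) \<le> ereal k"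
      using inc[of z t] by (simp add: pos_divide_le_eq)
  qed
  then show ?thesis unfolding clarke_derivative_def by (rule Limsup_bounded)
qed

text \<open>If \<open>r\<close> were nonzero, every strict gradient \<open>p\<close> near
  \<open>y\<close> off \<open>Z\<close> would satisfy
  \<open>p \<bullet> r \<ge> norm r * norm r / 2\<close>. Then \<open>f\<close> would decrease along
  \<open>- r\<close> at a uniform rate, contradicting that 0 is a Clarke subgradient at
  \<open>y\<close>.\<close>

lemma verdier_gradient_zero:
  fixes f :: "'a::euclidean_space \<Rightarrow> real"
  assumes Z: "definable Z" "interior Z = {}" and f: "\<And>x. isCont f x" and B: "0 < \<delta>"
    and grad: "\<And>x. x \<in> ball y \<delta> - Z \<Longrightarrow> x \<notin> S \<and> (\<exists>p. strict_deriv f x p)"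
    and crit: "0 \<in> clarke_subdiff f y" and T: "subspace T" and c: "0 < c"
    and verdier: "\<And>x v. x \<in> ball y \<delta> - S \<Longrightarrow> v \<in> clarke_subdiff f x \<Longrightarrow>
      norm (closest_point T v - r) \<le> c * norm (x - y)"
  shows "r = 0"
proof (rule ccontr)
  assume "r \<noteq> 0"
  then have nr: "0 < norm r" by simp
  have near: "\<exists>p. strict_deriv f x p \<and> norm (closest_point T p - r) \<le> c * norm (x - y)"
    if x: "x \<in> ball y \<delta> - Z" for x
  proof -
    obtain p where p: "x \<notin> S" "strict_deriv f x p" using grad[OF x] by blast
    then show ?thesis using verdier[of x p] clarke_subdiff_strict_deriv[OF p(2)] x by auto
  qed
  \<comment> \<open>\<open>r\<close> is a limit of projections onto \<open>T\<close>. Membership in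
    \<open>T\<close> is needed to exchange \<open>p\<close> for its projection in the inner product
    with \<open>r\<close>.\<close>
  have "r \<in> closure T"
    unfolding closure_approachable
  proof (intro allI impI)
    fix e :: real assume e: "0 < e"
    have "\<not> ball y (min \<delta> (e / c)) \<subseteq> Z"
    proof
      assume "ball y (min \<delta> (e / c)) \<subseteq> Z"
      then have "ball y (min \<delta> (e / c)) \<subseteq> interior Z" by (intro interior_maximal) auto
      moreover have "0 < min \<delta> (e / c)" using B e c by simp
      ultimately show False using Z(2) by auto
    qed
    then obtain x where "x \<in> ball y (min \<delta> (e / c))" "x \<notin> Z" by blast
    then have x: "dist y x < \<delta>" "dist y x < e / c" "x \<notin> Z" by simp_all
    then obtain p where p: "norm (closest_point T p - r) \<le> c * norm (x - y)" using near[of x] by auto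
    also have "\<dots> < e" using x(2) c by (simp add: dist_norm norm_minus_commute pos_less_divide_eq mult.commute)
    finally show "\<exists>t\<in>T. dist t r < e"
      using closest_point_subspace(1)[OF T] by (auto simp: dist_norm)
  qed
  then have rT: "r \<in> T" using closed_subspace[OF T] by simp
  \<comment> \<open>Within \<open>norm r / (2 * c)\<close> of \<open>y\<close> the Verdier error is
    at most half of \<open>norm r\<close>.\<close>
  let ?d = "min \<delta> (norm r / (2 * c))"
  have "clarke_derivative f y (- r) \<le> ereal (- (norm r * norm r / 2))"
  proof (rule clarke_derivative_le[OF Z f])
    show "0 < ?d" using B nr c by simp
    fix x assume x: "x \<in> ball y ?d - Z"
    then obtain p where p: "strict_deriv f x p" "norm (closest_point T p - r) \<le> c * norm (x - y)"
      using near[of x] by auto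
    have "norm (x - y) \<le> norm r / (2 * c)" using x by (simp add: dist_norm norm_minus_commute)
    then have "c * norm (x - y) \<le> norm r / 2" using c by (simp add: field_simps)
    then have pr: "norm (closest_point T p - r) \<le> norm r / 2" using p(2) by linarith
    have "p \<bullet> r = closest_point T p \<bullet> r"
      using closest_point_subspace(2)[OF T rT, of p] by (simp add: inner_diff_left)
    also have "\<dots> = norm r * norm r + (closest_point T p - r) \<bullet> r"
      by (simp add: inner_diff_left dot_square_norm power2_eq_square)
    finally have "p \<bullet> r = norm r * norm r + (closest_point T p - r) \<bullet> r" .
    moreover have "\<bar>(closest_point T p - r) \<bullet> r\<bar> \<le> norm r / 2 * norm r"
      using Cauchy_Schwarz_ineq2[of "closest_point T p - r" r] mult_right_mono[OF pr, of "norm r"] by simp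
    ultimately have "p \<bullet> - r \<le> - (norm r * norm r / 2)" by simp
    then show "\<exists>p. strict_deriv f x p \<and> p \<bullet> - r \<le> - (norm r * norm r / 2)" using p(1) by blast
  qed
  moreover have "ereal (0 \<bullet> - r) \<le> clarke_derivative f y (- r)"
    using crit unfolding clarke_subdiff_def by blast
  ultimately have "ereal 0 \<le> ereal (- (norm r * norm r / 2))" by (metis inner_zero_left order_trans)
  then show False using mult_pos_pos[OF nr nr] by simp
qed

end

text \<open>The increments of \<open>C\<close> telescope and \<open>C\<close> is bounded on
  \<open>K\<close>, so the gaps are summable.\<close>

lemma ascent_gap_tendsto_0:
  fixes C :: "'a::metric_space \<Rightarrow> real"
  assumes C: "continuous_on K C" "compact K" and x: "\<And>k. x k \<in> K" and c: "0 < c"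
    and a: "\<And>k. 0 \<le> a k" "\<And>k. c * a k \<le> C (x (Suc k)) - C (x k)"
  shows "a \<longlonglongrightarrow> 0"
proof -
  have "bounded (C ` K)" using compact_continuous_image[OF C] by (rule compact_imp_bounded)
  then obtain B where B: "\<And>u. u \<in> K \<Longrightarrow> \<bar>C u\<bar> \<le> B" unfolding bounded_iff by auto
  have "summable a"
  proof (rule summableI_nonneg_bounded[OF a(1)])
    fix n
    have "c * (\<Sum>k<n. a k) \<le> (\<Sum>k<n. C (x (Suc k)) - C (x k))"
      unfolding sum_distrib_left by (rule sum_mono) (rule a(2))
    also have "\<dots> = C (x n) - C (x 0)" by (rule sum_lessThan_telescope)
    also have "\<dots> \<le> 2 * B" using B[OF x[of n]] B[OF x[of 0]] by linarith
    finally show "(\<Sum>k<n. a k) \<le> 2 * B / c" using c by (simp add: pos_le_divide_eq mult.commute)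
  qed
  then show ?thesis by (rule summable_LIMSEQ_zero)
qed

theorem theorem5p10:
  fixes Om :: "nat \<Rightarrow> real list set set"
    and bs :: "'a::euclidean_space list"
    and f C :: "'a \<Rightarrow> real"
    and S U :: "'a set"
    and xs :: 'a
    and \<theta>\<^sub>1 :: real
  assumes "o_minimal_structure Om"
    and "coordinate_basis bs"
    and "locally_lipschitz f"
    and "tame_fun Om bs f"
    and "S = {x. 0 \<in> clarke_subdiff f x}"
    and "xs \<in> S"
    and "\<exists>m < DIM('a). Cp_manifold_at 2 m S xs"
    and "\<theta>\<^sub>1 \<ge> 0"
    and "xs \<in> interior U"
    and "continuous_on UNIV C"
    and "\<forall>\<alpha>>0. \<exists>c\<^sub>1>0. \<forall>x. subgradient_sequence f \<alpha> x \<and> (\<forall>k. x k \<in> U - S) \<longrightarrow>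
           (\<forall>k. C (x (Suc k)) - C (x k) \<ge> c\<^sub>1 * infdist (x k) S powr \<theta>\<^sub>1)"
    and "\<theta>\<^sub>1 = 0 \<or>
         (\<exists>\<theta>\<^sub>2>1. metrically_subregular \<theta>\<^sub>2 (clarke_subdiff f) xs 0) \<and> verdier_condition f S xs"
  shows "strongly_unstable f xs"
proof -
  interpret o_minimal Om by unfold_locales (rule assms(1))
  note S_def = assms(5)
  have f: "isCont f x" for x by (rule locally_lipschitz_isCont[OF assms(3)])
  obtain m E U0 \<phi> where m: "m < DIM('a)" and le2: "local_equation (Suc (Suc 0)) S m xs E U0 \<phi>"
    using assms(7) unfolding Cp_manifold_at_def numeral_2_eq_2 by blast
  have xU0: "xs \<in> U0" using le2 by (simp add: local_equation_def)
  have le: "local_equation (Suc 0) S m xs E U0 \<phi>" by (rule local_equation_shift[OF le2 xU0])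
  obtain r0 where r0: "0 < r0" "dterm (\<lambda>y. if y \<in> ball xs r0 then f y else 0)"
    using tame_local_dterm[OF assms(2,4,3)] by metis
  obtain r1 where r1: "0 < r1" "ball xs r1 \<subseteq> U0"
    using openE[OF local_equation_1D(2)[OF le xU0] xU0] by blast
  obtain r2 where r2: "0 < r2" "\<And>u. u \<in> cball xs r2 \<Longrightarrow> \<exists>y\<in>S. dist u y = infdist u S \<and> dist xs y \<le> 2 * dist xs u"
    using nearest_point[OF le assms(6)] by metis
  obtain r3 where r3: "0 < r3" "ball xs r3 \<subseteq> U" using assms(9) mem_interior by blast
  define r where "r = min r0 r1"
  have r: "0 < r" using r0 r1 by (simp add: r_def)
  have "interior (S \<inter> ball xs r) = {}"
    by (rule interior_submanifold[OF le m]) (use r1 in \<open>auto simp: r_def\<close>)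
  then obtain Z where Z: "definable Z" "interior Z = {}"
    "\<And>y. y \<in> ball xs r - Z \<Longrightarrow> y \<notin> S \<and> (\<exists>p. strict_deriv f y p)"
    "\<And>\<epsilon>. \<epsilon> < r \<Longrightarrow> finite {\<alpha>. 0 < \<alpha> \<and> \<not> (AE x0 in lebesgue. \<forall>x. subgradient_sequence f \<alpha> x \<and> x 0 = x0 \<and>
       (\<forall>k. x k \<in> cball xs \<epsilon>) \<longrightarrow> (\<forall>k. x k \<notin> S))}"
    using subgradient_avoids_critical_points[OF r0(2) _ S_def, of xs r] by (auto simp: r_def)
  \<comment> \<open>Reduction: outside finitely many \<open>\<alpha>\<close> a trapped sequence from
    almost every start avoids \<open>S\<close>, so it remains to exclude sequences that stay in the
    ball and off \<open>S\<close> forever.\<close>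
  have unstable: "strongly_unstable f xs"
    if \<epsilon>: "0 < \<epsilon>" "\<epsilon> < r" and leave: "\<And>\<alpha> x. 0 < \<alpha> \<Longrightarrow> subgradient_sequence f \<alpha> x \<Longrightarrow>
      \<forall>k. x k \<in> cball xs \<epsilon> - S \<Longrightarrow> False" for \<epsilon>
    unfolding strongly_unstable_def
  proof (intro exI[of _ \<epsilon>] conjI \<epsilon>(1) finite_subset[OF _ Z(4)[OF \<epsilon>(2)]], clarify)
    fix \<alpha> :: real
    assume \<alpha>: "0 < \<alpha>" and na: "\<not> (AE x0 in lebesgue. x0 \<in> cball xs \<epsilon> \<longrightarrow>
        (\<forall>x. subgradient_sequence f \<alpha> x \<and> x 0 = x0 \<longrightarrow> (\<exists>k. x k \<notin> cball xs \<epsilon>)))"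
      and ae: "AE x0 in lebesgue. \<forall>x. subgradient_sequence f \<alpha> x \<and> x 0 = x0 \<and>
        (\<forall>k. x k \<in> cball xs \<epsilon>) \<longrightarrow> (\<forall>k. x k \<notin> S)"
    from ae have "AE x0 in lebesgue. x0 \<in> cball xs \<epsilon> \<longrightarrow>
        (\<forall>x. subgradient_sequence f \<alpha> x \<and> x 0 = x0 \<longrightarrow> (\<exists>k. x k \<notin> cball xs \<epsilon>))"
      by (rule eventually_mono) (use leave[OF \<alpha>] in blast)
    then show False using na by blast
  qed
  \<comment> \<open>The distance is attained, so it vanishes only at points of
    \<open>S\<close>.\<close>
  have pos: "0 < infdist u S" if u: "u \<in> cball xs r2" "u \<notin> S" for u
  proof -
    obtain y where "y \<in> S" "dist u y = infdist u S" using r2(2)[OF u(1)] by blast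
    then show ?thesis using u(2) by (metis zero_less_dist_iff)
  qed
  have tends: "(\<lambda>k. infdist (x k) S powr \<theta>\<^sub>1) \<longlonglongrightarrow> 0"
    if x: "0 < \<alpha>" "subgradient_sequence f \<alpha> x" "\<forall>k. x k \<in> cball xs \<epsilon> - S" "\<epsilon> < r3" for \<alpha> x \<epsilon>
  proof -
    have "x k \<in> U - S" for k
    proof -
      have "x k \<in> cball xs \<epsilon>" "x k \<notin> S" using x(3) by blast+
      then have "x k \<in> ball xs r3" using x(4) by simp
      then show ?thesis using \<open>x k \<notin> S\<close> r3(2) by blast
    qed
    then obtain c where c: "0 < c" "\<And>k. C (x (Suc k)) - C (x k) \<ge> c * infdist (x k) S powr \<theta>\<^sub>1"
      using assms(11) x(1,2) by blast
    show ?thesis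
    proof (rule ascent_gap_tendsto_0[where K = "cball xs \<epsilon>" and C = C and x = x])
      show "continuous_on (cball xs \<epsilon>) C" using assms(10) continuous_on_subset by blast
    qed (use x(3) c in auto)
  qed
  show ?thesis
  proof (cases "\<theta>\<^sub>1 = 0")
    case True
    define \<epsilon> where "\<epsilon> = Min {r, r2, r3} / 2"
    have \<epsilon>: "0 < \<epsilon>" "\<epsilon> < r" "\<epsilon> < r2" "\<epsilon> < r3" using r r2(1) r3(1) by (auto simp: \<epsilon>_def)
    show ?thesis
    proof (rule unstable[OF \<epsilon>(1,2)])
      fix \<alpha> x assume x: "0 < \<alpha>" "subgradient_sequence f \<alpha> x" "\<forall>k. x k \<in> cball xs \<epsilon> - S"
      \<comment> \<open>Since \<open>0 powr 0 = 0\<close>, the power is 1 only because the distance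
        is positive.\<close>
      have "infdist (x k) S powr \<theta>\<^sub>1 = 1" for k
      proof -
        have "x k \<in> cball xs \<epsilon>" "x k \<notin> S" using x(3) by blast+
        then show ?thesis using pos[of "x k"] \<epsilon>(3) True by simp
      qed
      then have "(\<lambda>k. 1 :: real) \<longlonglongrightarrow> 0" using tends[OF x \<epsilon>(4)] by simp
      then show False by (simp add: LIMSEQ_const_iff)
    qed
  next
    case False
    then have \<theta>\<^sub>1: "0 < \<theta>\<^sub>1" using assms(8) by simp
    obtain \<theta>\<^sub>2 where \<theta>\<^sub>2: "1 < \<theta>\<^sub>2" and sub: "metrically_subregular \<theta>\<^sub>2 (clarke_subdiff f) xs 0"
      and ver: "verdier_condition f S xs" using False assms(12) by blast
    obtain c2 U2 where c2: "0 < c2" "xs \<in> interior U2"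
      "\<And>x. x \<in> U2 \<Longrightarrow> clarke_subdiff f x \<noteq> {} \<Longrightarrow> infdist x S \<le> c2 * infdist 0 (clarke_subdiff f x) powr \<theta>\<^sub>2"
      using sub unfolding metrically_subregular_def S_def by blast
    obtain c U3 where c: "0 < c" "xs \<in> interior U3"
      "\<And>y x v. y \<in> S \<inter> U3 \<Longrightarrow> x \<in> U3 - S \<Longrightarrow> v \<in> clarke_subdiff f x \<Longrightarrow>
        norm (closest_point (tangent_cone S y) v - riemannian_gradient f S y) \<le> c * norm (x - y)"
      using ver unfolding verdier_condition_def by blast
    obtain r4 where r4: "0 < r4" "ball xs r4 \<subseteq> U2" using c2(2) mem_interior by blast
    obtain r5 where r5: "0 < r5" "ball xs r5 \<subseteq> U3" using c(2) mem_interior by blast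
    obtain r6 where r6: "0 < r6" "\<And>y. y \<in> S \<inter> ball xs r6 \<Longrightarrow> subspace (tangent_cone S y)"
      "\<And>y z. y \<in> S \<inter> ball xs r6 \<Longrightarrow> z \<in> S \<inter> ball xs r6 \<Longrightarrow>
        norm ((z - y) - closest_point (tangent_cone S y) (z - y)) \<le> 1 / 8 * norm (z - y)"
      using chord_almost_tangent[OF le2, of "1 / 8"] by (metis zero_less_divide_1_iff zero_less_numeral)
    \<comment> \<open>Points of \<open>S\<close> nearest to iterates lie within
      \<open>2 * \<epsilon>\<close> of \<open>xs\<close>, and balls of radius
      \<open>\<epsilon>\<close> about them within \<open>4 * \<epsilon>\<close>, where all local
      estimates are available.\<close>
    define \<epsilon> where "\<epsilon> = Min {r, r2, r3, r4, r5, r6} / 4"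
    have \<epsilon>: "0 < \<epsilon>" "4 * \<epsilon> \<le> r" "4 * \<epsilon> \<le> r2" "4 * \<epsilon> \<le> r3" "4 * \<epsilon> \<le> r4" "4 * \<epsilon> \<le> r5" "4 * \<epsilon> \<le> r6"
      using r r2(1) r3(1) r4(1) r5(1) r6(1) by (auto simp: \<epsilon>_def)
    have tangential: "norm (closest_point (tangent_cone S y) v) \<le> c * norm (x - y)"
      if y: "y \<in> S \<inter> cball xs (2 * \<epsilon>)" and x: "x \<in> cball xs \<epsilon> - S" and v: "v \<in> clarke_subdiff f x" for x y v
    proof -
      have y': "y \<in> S" "dist xs y \<le> 2 * \<epsilon>" using y by auto
      have sub_ball: "ball y \<epsilon> \<subseteq> ball xs (4 * \<epsilon>)"
      proof
        fix u assume "u \<in> ball y \<epsilon>"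
        then show "u \<in> ball xs (4 * \<epsilon>)" using y'(2) \<epsilon>(1) dist_triangle[of xs u y] by simp
      qed
      have r_ball: "ball xs (4 * \<epsilon>) \<subseteq> ball xs r" and U3_ball: "ball xs (4 * \<epsilon>) \<subseteq> U3"
        using \<epsilon> r5(2) by (auto intro: subset_ball)
      have yU: "y \<in> S \<inter> U3" using y' \<epsilon>(1) U3_ball by auto
      have "riemannian_gradient f S y = 0"
      proof (rule verdier_gradient_zero[OF Z(1,2) f \<epsilon>(1) _ _ _ c(1)])
        show "u \<notin> S \<and> (\<exists>p. strict_deriv f u p)" if "u \<in> ball y \<epsilon> - Z" for u
          using Z(3)[of u] that sub_ball r_ball by blast
        show "0 \<in> clarke_subdiff f y" using y' S_def by simp
        show "subspace (tangent_cone S y)" using r6(2)[of y] y' \<epsilon> by auto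
        show "norm (closest_point (tangent_cone S y) v - riemannian_gradient f S y) \<le> c * norm (u - y)"
          if "u \<in> ball y \<epsilon> - S" "v \<in> clarke_subdiff f u" for u v
          using c(3)[OF yU, of u v] that sub_ball U3_ball by blast
      qed
      moreover have "x \<in> U3 - S" using x U3_ball \<epsilon>(1) by auto
      ultimately show ?thesis using c(3)[OF yU _ v] by simp
    qed
    show ?thesis
    proof (rule unstable[of \<epsilon>])
      fix \<alpha> x assume x: "0 < \<alpha>" "subgradient_sequence f \<alpha> x" "\<forall>k. x k \<in> cball xs \<epsilon> - S"
      let ?\<delta> = "\<lambda>k. infdist (x k) S"
      have xb: "dist xs (x k) \<le> \<epsilon>" "x k \<notin> S" for k using x(3) by auto
      have \<delta>_pos: "0 < ?\<delta> k" for k using pos[of "x k"] xb[of k] \<epsilon>(1,3) by auto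
      have "(\<lambda>k. ?\<delta> k powr \<theta>\<^sub>1) \<longlonglongrightarrow> 0" using tends[OF x] \<epsilon>(1,4) by simp
      \<comment> \<open>The ascent condition controls only a power of the distance; the root is
        available because the exponent is positive.\<close>
      then have "(\<lambda>k. (?\<delta> k powr \<theta>\<^sub>1) powr (1 / \<theta>\<^sub>1)) \<longlonglongrightarrow> 0 powr (1 / \<theta>\<^sub>1)"
        by (rule tendsto_powr') (use \<theta>\<^sub>1 in auto)
      then have \<delta>_0: "?\<delta> \<longlonglongrightarrow> 0" using \<theta>\<^sub>1 \<delta>_pos by (simp add: powr_powr less_imp_le)
      \<comment> \<open>Solves \<open>3 / 4 * (\<alpha> * K) = \<alpha> * c + 9 / 4\<close>, which
        exceeds the loss \<open>\<alpha> * c + 5 / 4\<close> by exactly 1; this leaves the old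
        distance as a lower bound for the new one.\<close>
      define K where "K = 4 / 3 * (\<alpha> * c + 9 / 4) / \<alpha>"
      have "0 < \<alpha> * c + 9 / 4" using x(1) c(1) by (simp add: add_pos_pos)
      then have K: "0 < K" "3 / 4 * (\<alpha> * K) = \<alpha> * c + 9 / 4" using x(1) by (simp_all add: K_def)
      obtain \<delta>\<^sub>0 where \<delta>\<^sub>0: "0 < \<delta>\<^sub>0" "\<And>\<delta> v. 0 < \<delta> \<Longrightarrow> \<delta> < \<delta>\<^sub>0 \<Longrightarrow> 0 \<le> v \<Longrightarrow> \<delta> \<le> c2 * v powr \<theta>\<^sub>2 \<Longrightarrow> K * \<delta> \<le> v"
        using powr_superlinear[OF \<theta>\<^sub>2 c2(1) K(1)] by metis
      have step: "?\<delta> k \<le> ?\<delta> (Suc k)" if small: "?\<delta> k < \<delta>\<^sub>0" for k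
      proof -
        obtain v where v: "v \<in> clarke_subdiff f (x k)" "x (Suc k) = x k - \<alpha> *\<^sub>R v"
          using x(2) unfolding subgradient_sequence_def by blast
        have near: "\<exists>y\<in>S. dist (x j) y = ?\<delta> j \<and> dist xs y \<le> 2 * \<epsilon>" for j
          using r2(2)[of "x j"] xb(1)[of j] \<epsilon>(1,3) by fastforce
        obtain y where y: "y \<in> S" "dist (x k) y = ?\<delta> k" "dist xs y \<le> 2 * \<epsilon>" using near by blast
        obtain z where z: "z \<in> S" "dist (x (Suc k)) z = ?\<delta> (Suc k)" "dist xs z \<le> 2 * \<epsilon>" using near by blast
        have yz: "y \<in> S \<inter> ball xs r6" "z \<in> S \<inter> ball xs r6" using y z \<epsilon>(1,7) by auto
        have "infdist (x k) S \<le> c2 * infdist 0 (clarke_subdiff f (x k)) powr \<theta>\<^sub>2"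
          by (rule c2(3)) (use r4(2) xb(1)[of k] \<epsilon>(1,5) v(1) in auto)
        also have "\<dots> \<le> c2 * norm v powr \<theta>\<^sub>2"
          using infdist_le[OF v(1), of 0] c2(1) \<theta>\<^sub>2 infdist_nonneg[of 0 "clarke_subdiff f (x k)"]
          by (intro mult_left_mono powr_mono2) auto
        finally have Kv: "K * ?\<delta> k \<le> norm v" by (intro \<delta>\<^sub>0(2) \<delta>_pos small) auto
        have "3 / 4 * (\<alpha> * norm v) - (\<alpha> * c + 5 / 4) * norm (x k - y) \<le> norm (x k - \<alpha> *\<^sub>R v - z)"
        proof (rule distance_after_step[OF r6(2)[OF yz(1)] x(1)])
          show "norm (closest_point (tangent_cone S y) v) \<le> c * norm (x k - y)"
            by (rule tangential) (use y v x(3) in auto)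
          show "norm (x k - \<alpha> *\<^sub>R v - z) \<le> norm (x k - \<alpha> *\<^sub>R v - y)"
            using infdist_le[OF y(1), of "x (Suc k)"] z(2) v(2) by (simp add: dist_norm)
        qed (rule r6(3)[OF yz])
        then have "3 / 4 * (\<alpha> * norm v) - (\<alpha> * c + 5 / 4) * ?\<delta> k \<le> ?\<delta> (Suc k)"
          using y(2) z(2) v(2) by (simp add: dist_norm)
        moreover have "3 / 4 * (\<alpha> * (K * ?\<delta> k)) \<le> 3 / 4 * (\<alpha> * norm v)" using Kv x(1) by simp
        moreover have "3 / 4 * (\<alpha> * (K * ?\<delta> k)) = (\<alpha> * c + 9 / 4) * ?\<delta> k"
          unfolding K(2)[symmetric] by simp
        ultimately show ?thesis by (simp add: algebra_simps)
      qed
      obtain N where N: "\<And>k. N \<le> k \<Longrightarrow> ?\<delta> k < \<delta>\<^sub>0"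
        using order_tendstoD(2)[OF \<delta>_0 \<delta>\<^sub>0(1)] unfolding eventually_sequentially by blast
      \<comment> \<open>From \<open>N\<close> on the distances never decrease, so a positive number
        bounds a null sequence from below.\<close>
      have "?\<delta> N \<le> ?\<delta> k" if "N \<le> k" for k
        using that by (induction k rule: dec_induct) (use step N in \<open>auto intro: order_trans\<close>)
      then have "?\<delta> N \<le> 0" by (intro LIMSEQ_le_const[OF \<delta>_0]) blast
      then show False using \<delta>_pos[of N] by simp
    qed (use \<epsilon> r in auto)
  qed
qed

end
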